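(* Let $X$ be a Banach space, let $\Gamma:[0,1]\to c(X)$ be a multifunction, and let $Q$ be any one of the three types of integrability DP (Denjoy-Pettis), HKP (Henstock-Kurzweil-Pettis), wMS (weakly McShane). Let $\mathcal{S}_Q(\Gamma)$ be the family of all scalarly measurable selections of $\Gamma$ that are $Q$-integrable. Then the following conditions are equivalent: (i) $\Gamma$ is $Q$-integrable in $cb(X)$ and $\mathcal{S}_Q(\Gamma)\neq\emptyset$; (ii) $\mathcal{S}_Q(\Gamma)\neq\emptyset$ and for all $f\in\mathcal{S}_Q(\Gamma)$ the multifunction $G:[0,1]\to c(X)$ defined by $G(t)=\Gamma(t)-f(t)$ is Pettis integrable in $cb(X)$; (iii) there exists $f\in\mathcal{S}_Q(\Gamma)$ such that the multifunction $G=\Gamma-f$ is Pettis integrable in $cb(X)$.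
   Context: $X$ is a (real) Banach space with dual $X^*$. $c(X)$ is the family of all nonempty closed convex subsets of $X$, and $cb(X)$ is the family of bounded members of $c(X)$. For $C\in c(X)$ and $x^*\in X^*$, $s(x^*,C)=\sup\{\langle x^*,x\rangle: x\in C\}$. The interval $[0,1]$ carries Lebesgue measure $\lambda$; $\mathcal{L}$ is the family of Lebesgue measurable subsets of $[0,1]$ and $\mathcal{I}$ the family of closed subintervals of $[0,1]$. A multifunction is a map $\Gamma:[0,1]\to c(X)$; $s(x^*,\Gamma)$ denotes $t\mapsto s(x^*,\Gamma(t))$. A selection of $\Gamma$ is a function $f:[0,1]\to X$ with $f(t)\in\Gamma(t)$ for all $t$; it is scalarly measurable if $\langle x^*,f\rangle$ is measurable for every $x^*\in X^*$. Denjoy integral (in the wide sense, Denjoy-Khintchine): a function $F$ is AC on a set $E$ if for every $\varepsilon>0$ there is $\delta>0$ with $\sum_i|F(d_i)-F(c_i)|<\varepsilon$ for every finite family of nonoverlapping intervals $[c_i,d_i]$ with endpoints in $E$ and $\sum_i(d_i-c_i)<\delta$; $F$ is ACG on $[0,1]$ if it is continuous on $[0,1]$ and $[0,1]$ is a countable union of sets on each of which $F$ is AC. A real function $f$ on $[0,1]$ is Denjoy integrable if there is an ACG function $F$ whose approximate derivative equals $f$ almost everywhere; then $(D)\int_{[a,b]}f=F(b)-F(a)$. Let $\mathcal{C}\subset c(X)$ be nonempty. $\Gamma$ is DP-integrable in $\mathcal{C}$ if $s(x^*,\Gamma)$ is Denjoy integrable for every $x^*\in X^*$ and for each $I\in\mathcal{I}$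 there is $N_\Gamma(I)\in\mathcal{C}$ with $s(x^*,N_\Gamma(I))=(D)\int_I s(x^*,\Gamma)$ for all $x^*\in X^*$. $\Gamma$ is HKP-integrable in $\mathcal{C}$ if the same holds with the Denjoy integral replaced by the Henstock-Kurzweil integral. $\Gamma$ is wMS-integrable in $\mathcal{C}$ if it is HKP-integrable in $\mathcal{C}$ and $s(x^*,\Gamma)$ is Lebesgue integrable for every $x^*\in X^*$. $\Gamma$ is Pettis integrable in $\mathcal{C}$ if $s(x^*,\Gamma)$ is Lebesgue integrable for every $x^*\in X^*$ and for each $A\in\mathcal{L}$ there is $M_\Gamma(A)\in\mathcal{C}$ with $s(x^*,M_\Gamma(A))=\int_A s(x^*,\Gamma)\,d\lambda$ for all $x^*\in X^*$. A function $f:[0,1]\to X$ is DP- (HKP-, wMS-) integrable if the singleton-valued multifunction $t\mapsto\{f(t)\}$ is so in the family of singletons, i.e. the integrals over intervals are elements of $X$. *)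

theory Defs
  imports "HOL-Analysis.Analysis"
begin

definition closed_convex_sets :: "'a::banach set set" where
  "closed_convex_sets = {C. C \<noteq> {} \<and> closed C \<and> convex C}"

definition bounded_closed_convex_sets :: "'a::banach set set" where
  "bounded_closed_convex_sets = {C \<in> closed_convex_sets. bounded C}"

text \<open>The support function is extended-real valued, since members of
  \<^const>\<open>closed_convex_sets\<close> may be unbounded.  The dual space is the type of bounded linear
  functionals.\<close>

definition support_fun :: "('a::banach \<Rightarrow>\<^sub>L real) \<Rightarrow> 'a set \<Rightarrow> ereal" where
  "support_fun x' C = (SUP x\<in>C. ereal (blinfun_apply x' x))"

text \<open>A multifunction on \<open>[0,1]\<close> is represented by a total function on the reals whose values
  outside \<open>[0,1]\<close> are irrelevant.  All integrability notions for extended-real valued functions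
  on \<open>[0,1]\<close> below require the function to be finite almost everywhere and disregard its values
  on the exceptional null set.\<close>

definition AC_on :: "(real \<Rightarrow> real) \<Rightarrow> real set \<Rightarrow> bool" where
  "AC_on F E \<longleftrightarrow>
     (\<forall>\<epsilon>>0. \<exists>\<delta>>0. \<forall>P :: (real \<times> real) set.
        finite P \<and>
        (\<forall>(c, d)\<in>P. c \<in> E \<and> d \<in> E \<and> c < d) \<and>
        (\<forall>(c, d)\<in>P. \<forall>(c', d')\<in>P. (c, d) \<noteq> (c', d') \<longrightarrow> {c<..<d} \<inter> {c'<..<d'} = {}) \<and>
        (\<Sum>(c, d)\<in>P. d - c) < \<delta>
        \<longrightarrow> (\<Sum>(c, d)\<in>P. \<bar>F d - F c\<bar>) < \<epsilon>)"

definition ACG :: "(real \<Rightarrow> real) \<Rightarrow> bool" where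
  "ACG F \<longleftrightarrow> continuous_on {0..1} F \<and>
     (\<exists>E :: nat \<Rightarrow> real set. (\<Union>n. E n) = {0..1} \<and> (\<forall>n. AC_on F (E n)))"

definition density_point :: "real set \<Rightarrow> real \<Rightarrow> bool" where
  "density_point E t \<longleftrightarrow>
     ((\<lambda>h. measure lebesgue (E \<inter> {t - h..t + h}) / (2 * h)) \<longlongrightarrow> 1) (at_right 0)"

definition has_approx_derivative :: "(real \<Rightarrow> real) \<Rightarrow> real \<Rightarrow> real \<Rightarrow> bool" where
  "has_approx_derivative F l t \<longleftrightarrow>
     (\<exists>E \<in> sets lebesgue. E \<subseteq> {0..1} \<and> density_point E t \<and>
        (F has_real_derivative l) (at t within E))"

definition denjoy_primitive :: "(real \<Rightarrow> ereal) \<Rightarrow> (real \<Rightarrow> real) \<Rightarrow> bool" where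
  "denjoy_primitive f F \<longleftrightarrow> ACG F \<and>
     (AE t in lebesgue_on {0..1}. \<exists>l. has_approx_derivative F l t \<and> f t = ereal l)"

definition denjoy_integrable :: "(real \<Rightarrow> ereal) \<Rightarrow> bool" where
  "denjoy_integrable f \<longleftrightarrow> (\<exists>F. denjoy_primitive f F)"

text \<open>Any two primitives of \<open>f\<close> differ by a constant on \<open>[0,1]\<close>, so the choice is immaterial.\<close>

definition denjoy_integral :: "(real \<Rightarrow> ereal) \<Rightarrow> real \<Rightarrow> real \<Rightarrow> real" where
  "denjoy_integral f a b = (let F = (SOME F. denjoy_primitive f F) in F b - F a)"

text \<open>On intervals, \<^const>\<open>integrable_on\<close> and \<^const>\<open>integral\<close> are the Henstock-Kurzweil notions.\<close>

definition HK_integrable :: "(real \<Rightarrow> ereal) \<Rightarrow> bool" where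
  "HK_integrable f \<longleftrightarrow>
     (AE t in lebesgue_on {0..1}. \<bar>f t\<bar> \<noteq> \<infinity>) \<and>
     (\<lambda>t. real_of_ereal (f t)) integrable_on {0..1}"

definition HK_integral :: "(real \<Rightarrow> ereal) \<Rightarrow> real \<Rightarrow> real \<Rightarrow> real" where
  "HK_integral f a b = integral {a..b} (\<lambda>t. real_of_ereal (f t))"

definition lebesgue_integrable :: "(real \<Rightarrow> ereal) \<Rightarrow> bool" where
  "lebesgue_integrable f \<longleftrightarrow>
     (AE t in lebesgue_on {0..1}. \<bar>f t\<bar> \<noteq> \<infinity>) \<and>
     integrable (lebesgue_on {0..1}) (\<lambda>t. real_of_ereal (f t))"

definition DP_integrable_in :: "'a::banach set set \<Rightarrow> (real \<Rightarrow> 'a set) \<Rightarrow> bool" where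
  "DP_integrable_in \<C> \<Gamma> \<longleftrightarrow>
     (\<forall>x'. denjoy_integrable (\<lambda>t. support_fun x' (\<Gamma> t))) \<and>
     (\<forall>a b. 0 \<le> a \<and> a \<le> b \<and> b \<le> 1 \<longrightarrow>
        (\<exists>N\<in>\<C>. \<forall>x'. support_fun x' N =
           ereal (denjoy_integral (\<lambda>t. support_fun x' (\<Gamma> t)) a b)))"

definition HKP_integrable_in :: "'a::banach set set \<Rightarrow> (real \<Rightarrow> 'a set) \<Rightarrow> bool" where
  "HKP_integrable_in \<C> \<Gamma> \<longleftrightarrow>
     (\<forall>x'. HK_integrable (\<lambda>t. support_fun x' (\<Gamma> t))) \<and>
     (\<forall>a b. 0 \<le> a \<and> a \<le> b \<and> b \<le> 1 \<longrightarrow>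
        (\<exists>N\<in>\<C>. \<forall>x'. support_fun x' N =
           ereal (HK_integral (\<lambda>t. support_fun x' (\<Gamma> t)) a b)))"

definition wMS_integrable_in :: "'a::banach set set \<Rightarrow> (real \<Rightarrow> 'a set) \<Rightarrow> bool" where
  "wMS_integrable_in \<C> \<Gamma> \<longleftrightarrow> HKP_integrable_in \<C> \<Gamma> \<and>
     (\<forall>x'. lebesgue_integrable (\<lambda>t. support_fun x' (\<Gamma> t)))"

definition Pettis_integrable_in :: "'a::banach set set \<Rightarrow> (real \<Rightarrow> 'a set) \<Rightarrow> bool" where
  "Pettis_integrable_in \<C> \<Gamma> \<longleftrightarrow>
     (\<forall>x'. lebesgue_integrable (\<lambda>t. support_fun x' (\<Gamma> t))) \<and>
     (\<forall>A \<in> sets lebesgue. A \<subseteq> {0..1} \<longrightarrow>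
        (\<exists>M\<in>\<C>. \<forall>x'. support_fun x' M =
           ereal (LINT t|lebesgue_on A. real_of_ereal (support_fun x' (\<Gamma> t)))))"

datatype integral_type = DP | HKP | wMS

fun integrable_in :: "integral_type \<Rightarrow> 'a::banach set set \<Rightarrow> (real \<Rightarrow> 'a set) \<Rightarrow> bool" where
  "integrable_in DP \<C> \<Gamma> = DP_integrable_in \<C> \<Gamma>"
| "integrable_in HKP \<C> \<Gamma> = HKP_integrable_in \<C> \<Gamma>"
| "integrable_in wMS \<C> \<Gamma> = wMS_integrable_in \<C> \<Gamma>"

definition fun_integrable :: "integral_type \<Rightarrow> (real \<Rightarrow> 'a::banach) \<Rightarrow> bool" where
  "fun_integrable Q f \<longleftrightarrow> integrable_in Q (range (\<lambda>x. {x})) (\<lambda>t. {f t})"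

definition scalarly_measurable :: "(real \<Rightarrow> 'a::banach) \<Rightarrow> bool" where
  "scalarly_measurable f \<longleftrightarrow>
     (\<forall>x' :: 'a \<Rightarrow>\<^sub>L real. (\<lambda>t. blinfun_apply x' (f t)) \<in> borel_measurable (lebesgue_on {0..1}))"

definition integrable_selections ::
    "integral_type \<Rightarrow> (real \<Rightarrow> 'a::banach set) \<Rightarrow> (real \<Rightarrow> 'a) set" where
  "integrable_selections Q \<Gamma> =
     {f. (\<forall>t\<in>{0..1}. f t \<in> \<Gamma> t) \<and> scalarly_measurable f \<and> fun_integrable Q f}"

definition translate_by :: "(real \<Rightarrow> 'a::banach set) \<Rightarrow> (real \<Rightarrow> 'a) \<Rightarrow> real \<Rightarrow> 'a set" where
  "translate_by \<Gamma> f t = (\<lambda>x. x - f t) ` \<Gamma> t"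

end

theory Submission
  imports Defs
begin

text \<open>Subtracting an integrable selection makes all support functions nonnegative, and a nonnegative
  Denjoy (or Henstock-Kurzweil) integrable function is Lebesgue integrable; adding the selection
  back reverses the step. What remains is to pass from integrals over intervals to integrals over
  all measurable sets.

  Let \<open>0 \<in> G t\<close> and \<open>\<phi> A x\<close> be the integral of the support function of \<open>G\<close> in direction \<open>x\<close>
  over \<open>A\<close>. Unions of intervals show that \<open>\<phi> V\<close> is a support function for every open \<open>V\<close>, and \<open>A\<close> is
  approximated from outside by a decreasing sequence \<open>V m\<close> of open sets. If \<open>\<phi> A\<close> were not weak-star
  lower semicontinuous at \<open>x0\<close>, there would be bounded \<open>x n\<close> with \<open>\<phi> A (x n) \<le> d < \<phi> A x0\<close> that agree
  with \<open>x0\<close> on more and more of countably many points \<open>y m\<close>, where \<open>y m\<close> belongs to the integral over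
  \<open>V m\<close> and \<open>d < c' < x0 (y m)\<close>. After passing to convex combinations the support functions converge
  almost everywhere, so by Fatou's lemma a weak-star cluster point \<open>u\<close> satisfies \<open>\<phi> A u \<le> d\<close>. But
  \<open>u (y m) = x0 (y m) > c'\<close> gives \<open>\<phi> (V m) u > c'\<close> for all \<open>m\<close>, hence \<open>\<phi> A u \<ge> c'\<close>. Boundedness of
  the \<open>x n\<close> is enforced by adding a small multiple of the norm to \<open>\<phi> A\<close>, which a convergent series of
  corrections removes in the end.\<close>

section \<open>Hahn-Banach for sublinear functionals\<close>

text \<open>For a measurable set \<open>A\<close> the functional \<open>\<phi> A\<close> on the dual
  is always sublinear; the question is whether its supremum representation uses points of
  \<open>X\<close> or only of the bidual, which is a matter of weak-star lower semicontinuity. That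
  property passes to increasing limits, hence from intervals to open sets, but a general measurable
  set is reached by open sets only from outside, and the representing sets \<open>M (V m)\<close>
  shrink along the way. Neither separability nor reflexivity of \<open>X\<close> is assumed. The
  dual ball may therefore fail to be weak-star sequentially compact, and the null sets on which
  support functions misbehave depend on the functional. The compactness argument is built so that
  only a sequence of functionals and one cluster functional \<open>u\<close> occur, and so that
  almost everywhere convergence comes from minimising a strictly convex integral over decreasing
  convex sets. Completeness of \<open>X\<close> enters when the norm correction is removed, since
  the corrections are summed in \<open>X\<close>.\<close>

definition sublinear :: "('v::real_vector \<Rightarrow> real) \<Rightarrow> bool" where
  "sublinear p \<longleftrightarrow> (\<forall>x y. p (x + y) \<le> p x + p y) \<and> (\<forall>c x. 0 \<le> c \<longrightarrow> p (c *\<^sub>R x) = c * p x)"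

text \<open>One inequality suffices for positive homogeneity: used with \<open>1/c\<close> at
  \<open>c *\<^sub>R x\<close> it gives the reverse one.\<close>

lemma sublinearI:
  assumes "\<And>x y. p (x + y) \<le> p x + p y" and "p 0 = 0"
    and "\<And>c x. 0 < c \<Longrightarrow> p (c *\<^sub>R x) \<le> c * p x"
  shows "sublinear p"
proof -
  have "p (c *\<^sub>R x) = c * p x" if "0 \<le> c" for c x
  proof (cases "c = 0")
    case True
    then show ?thesis using assms(2) by simp
  next
    case False
    then have "c > 0" using that by simp
    have "p ((1/c) *\<^sub>R (c *\<^sub>R x)) \<le> (1/c) * p (c *\<^sub>R x)"
      using assms(3)[of "1/c" "c *\<^sub>R x"] \<open>c > 0\<close> by simp
    then have "c * p x \<le> p (c *\<^sub>R x)"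
      using \<open>c > 0\<close> by (simp add: field_simps)
    with assms(3)[OF \<open>c > 0\<close>, of x] show ?thesis by simp
  qed
  then show ?thesis using assms(1) by (auto simp: sublinear_def)
qed

lemma sublinear_add: "sublinear p \<Longrightarrow> p (x + y) \<le> p x + p y"
  and sublinear_scale: "sublinear p \<Longrightarrow> 0 \<le> c \<Longrightarrow> p (c *\<^sub>R x) = c * p x"
  and sublinear_zero: "sublinear p \<Longrightarrow> p 0 = 0"
  unfolding sublinear_def by (auto dest: spec[of _ 0])

lemma sublinear_neg_le: "sublinear p \<Longrightarrow> - p (- x) \<le> p x"
  using sublinear_add[of p x "- x"] sublinear_zero[of p] by simp

text \<open>Shifting along a ray drives both the linearity of minimal functionals and the choice of the
  value at one point.\<close>

definition ray_shift :: "('v::real_vector \<Rightarrow> real) \<Rightarrow> 'v \<Rightarrow> 'v \<Rightarrow> real" where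
  "ray_shift p v x = (INF t\<in>{0..}. p (x + t *\<^sub>R v) - t * p v)"

lemma ray_shift_bdd:
  assumes p: "sublinear p"
  shows "bdd_below ((\<lambda>t. p (x + t *\<^sub>R v) - t * p v) ` {0..})"
proof (rule bdd_belowI2)
  fix t :: real assume "t \<in> {0..}"
  then have "t * p v = p (t *\<^sub>R v)" using sublinear_scale[OF p] by simp
  also have "\<dots> \<le> p (x + t *\<^sub>R v) + p (- x)"
    using sublinear_add[OF p, of "x + t *\<^sub>R v" "- x"] by simp
  finally show "- p (- x) \<le> p (x + t *\<^sub>R v) - t * p v" by simp
qed

lemma ray_shift_lower:
  assumes "sublinear p" "0 \<le> t"
  shows "ray_shift p v x \<le> p (x + t *\<^sub>R v) - t * p v"
  unfolding ray_shift_def using assms by (intro cINF_lower ray_shift_bdd) auto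

lemma ray_shift_le: "sublinear p \<Longrightarrow> ray_shift p v x \<le> p x"
  using ray_shift_lower[of p 0 v x] by simp

lemma ray_shift_greatest:
  assumes "\<And>t. 0 \<le> t \<Longrightarrow> z \<le> p (x + t *\<^sub>R v) - t * p v"
  shows "z \<le> ray_shift p v x"
  unfolding ray_shift_def using assms by (intro cINF_greatest) auto

lemma sublinear_ray_shift:
  assumes p: "sublinear p"
  shows "sublinear (ray_shift p v)"
proof (rule sublinearI)
  fix x y
  have "ray_shift p v (x + y) - (p (x + t *\<^sub>R v) - t * p v) \<le> ray_shift p v y" if t: "0 \<le> t" for t
  proof (rule ray_shift_greatest)
    fix s :: real assume s: "0 \<le> s"
    have "ray_shift p v (x + y) \<le> p ((x + y) + (t + s) *\<^sub>R v) - (t + s) * p v"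
      using s t by (intro ray_shift_lower p) auto
    also have "(x + y) + (t + s) *\<^sub>R v = (x + t *\<^sub>R v) + (y + s *\<^sub>R v)"
      by (simp add: algebra_simps)
    also have "p \<dots> \<le> p (x + t *\<^sub>R v) + p (y + s *\<^sub>R v)" by (rule sublinear_add[OF p])
    finally show "ray_shift p v (x + y) - (p (x + t *\<^sub>R v) - t * p v)
        \<le> p (y + s *\<^sub>R v) - s * p v"
      by (simp add: algebra_simps)
  qed
  then have "ray_shift p v (x + y) - ray_shift p v y \<le> ray_shift p v x"
    by (intro ray_shift_greatest) (simp add: algebra_simps)
  then show "ray_shift p v (x + y) \<le> ray_shift p v x + ray_shift p v y" by simp
next
  have "0 \<le> ray_shift p v 0"
    by (rule ray_shift_greatest) (simp add: sublinear_scale[OF p])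
  moreover have "ray_shift p v 0 \<le> 0"
    using ray_shift_le[OF p, of v 0] sublinear_zero[OF p] by simp
  ultimately show "ray_shift p v 0 = 0" by simp
next
  fix c :: real and x assume c: "0 < c"
  have "ray_shift p v (c *\<^sub>R x) / c \<le> ray_shift p v x"
  proof (rule ray_shift_greatest)
    fix t :: real assume t: "0 \<le> t"
    have "ray_shift p v (c *\<^sub>R x) \<le> p (c *\<^sub>R x + (c * t) *\<^sub>R v) - (c * t) * p v"
      using c t by (intro ray_shift_lower p) auto
    also have "c *\<^sub>R x + (c * t) *\<^sub>R v = c *\<^sub>R (x + t *\<^sub>R v)" by (simp add: algebra_simps)
    also have "p \<dots> = c * p (x + t *\<^sub>R v)" using c by (simp add: sublinear_scale[OF p])
    finally show "ray_shift p v (c *\<^sub>R x) / c \<le> p (x + t *\<^sub>R v) - t * p v"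
      using c by (simp add: field_simps)
  qed
  then show "ray_shift p v (c *\<^sub>R x) \<le> c * ray_shift p v x"
    using c by (simp add: field_simps)
qed

text \<open>Zorn's lemma for the reversed pointwise order. A nonempty chain is bounded by its
  pointwise infimum, which is finite because every member satisfies
  \<open>- p (- x) \<le> q x\<close>. Subadditivity of the infimum uses that of two members of the
  chain the smaller one can serve for both arguments.\<close>

lemma minimal_sublinear:
  fixes p :: "'v::real_vector \<Rightarrow> real"
  assumes p: "sublinear p"
  obtains q where "sublinear q" "\<And>x. q x \<le> p x"
    "\<And>r. sublinear r \<Longrightarrow> (\<And>x. r x \<le> q x) \<Longrightarrow> r = q"
proof -
  let ?A = "{q. sublinear q \<and> (\<forall>x. q x \<le> p x)}"
  define R where "R = (\<lambda>q r :: 'v \<Rightarrow> real. \<forall>x. r x \<le> q x)"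
  have "\<exists>m\<in>?A. \<forall>a\<in>?A. R m a \<longrightarrow> a = m"
  proof (rule predicate_Zorn)
    show "partial_order_on ?A (relation_of R ?A)"
      by (rule partial_order_on_relation_ofI)
         (auto simp: R_def fun_eq_iff intro: order_trans antisym)
  next
    fix C assume C: "C \<in> Chains (relation_of R ?A)"
    then have sub: "\<And>q. q \<in> C \<Longrightarrow> sublinear q" "\<And>q x. q \<in> C \<Longrightarrow> q x \<le> p x"
      and tot: "\<And>q r. q \<in> C \<Longrightarrow> r \<in> C \<Longrightarrow> (\<forall>x. q x \<le> r x) \<or> (\<forall>x. r x \<le> q x)"
      by (auto simp: Chains_def relation_of_def R_def)
    show "\<exists>u\<in>?A. \<forall>a\<in>C. R a u"
    proof (cases "C = {}")
      case True
      then show ?thesis using p by auto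
    next
      case False
      define u where "u x = (INF q\<in>C. q x)" for x
      have bdd: "bdd_below ((\<lambda>q. q x) ` C)" for x
      proof (rule bdd_belowI2)
        fix q assume q: "q \<in> C"
        have "- q (- x) \<le> q x" by (rule sublinear_neg_le[OF sub(1)[OF q]])
        with sub(2)[OF q, of "- x"] show "- p (- x) \<le> q x" by linarith
      qed
      have low: "u x \<le> q x" if "q \<in> C" for q x
        unfolding u_def using that by (intro cINF_lower bdd)
      have great: "z \<le> u x" if "\<And>q. q \<in> C \<Longrightarrow> z \<le> q x" for z x
        unfolding u_def using that False by (intro cINF_greatest) auto
      have "sublinear u"
      proof (rule sublinearI)
        fix x y
        have 1: "u (x + y) \<le> q x + r y" if q: "q \<in> C" and r: "r \<in> C" for q r
        proof -
          from tot[OF q r] consider "\<forall>x. q x \<le> r x" | "\<forall>x. r x \<le> q x" by blast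
          then show ?thesis
          proof cases
            case 1
            then show ?thesis
              using low[OF q, of "x + y"] sublinear_add[OF sub(1)[OF q], of x y]
              by (meson add_left_mono order_trans)
          next
            case 2
            then show ?thesis
              using low[OF r, of "x + y"] sublinear_add[OF sub(1)[OF r], of x y]
              by (meson add_right_mono order_trans)
          qed
        qed
        have "u (x + y) - r y \<le> u x" if r: "r \<in> C" for r
          using 1[OF _ r] by (intro great) (simp add: algebra_simps)
        then have "u (x + y) - u x \<le> u y"
          by (intro great) (simp add: algebra_simps)
        then show "u (x + y) \<le> u x + u y" by simp
      next
        have "0 \<le> u 0" using sub(1) by (intro great) (simp add: sublinear_zero)
        moreover obtain q where "q \<in> C" using False by blast
        then have "u 0 \<le> 0" using low[of q 0] sub(1) by (simp add: sublinear_zero)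
        ultimately show "u 0 = 0" by simp
      next
        fix c :: real and x assume c: "0 < c"
        have "u (c *\<^sub>R x) / c \<le> u x"
        proof (rule great)
          fix q assume q: "q \<in> C"
          show "u (c *\<^sub>R x) / c \<le> q x"
            using low[OF q, of "c *\<^sub>R x"] c sublinear_scale[OF sub(1)[OF q], of c x]
            by (simp add: field_simps)
        qed
        then show "u (c *\<^sub>R x) \<le> c * u x" using c by (simp add: field_simps)
      qed
      moreover have "u x \<le> p x" for x
        using False low sub(2) by (meson all_not_in_conv order_trans)
      ultimately show ?thesis using low by (intro bexI[of _ u]) (auto simp: R_def)
    qed
  qed
  then obtain m where m: "sublinear m" "\<forall>x. m x \<le> p x"
    "\<And>a. sublinear a \<Longrightarrow> (\<forall>x. a x \<le> p x) \<Longrightarrow> R m a \<Longrightarrow> a = m"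
    by blast
  show thesis
  proof (rule that[OF m(1)])
    show "m x \<le> p x" for x using m(2) by simp
    fix r assume "sublinear r" "\<And>x. r x \<le> m x"
    then show "r = m" using m(2) by (intro m(3)) (auto simp: R_def intro: order_trans)
  qed
qed

text \<open>Minimality forces additivity: \<open>ray_shift q y\<close> is sublinear and below
  \<open>q\<close>, hence equal to it, and \<open>t = 1\<close> gives
  \<open>q x \<le> q (x + y) - q y\<close>. Minimising below \<open>ray_shift p v\<close> instead of
  \<open>p\<close> fixes the value at \<open>v\<close>, because
  \<open>ray_shift p v (- v) \<le> - p v\<close>.\<close>

theorem sublinear_Hahn_Banach:
  fixes p :: "'v::real_vector \<Rightarrow> real"
  assumes p: "sublinear p"
  obtains l where "linear l" "\<And>x. l x \<le> p x" "l v = p v"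
proof -
  obtain q where q: "sublinear q" "\<And>x. q x \<le> ray_shift p v x"
    and min: "\<And>r. sublinear r \<Longrightarrow> (\<And>x. r x \<le> q x) \<Longrightarrow> r = q"
    using minimal_sublinear[OF sublinear_ray_shift[OF p, of v]] by blast
  have add: "q (x + y) = q x + q y" for x y
  proof -
    have "ray_shift q y = q"
      by (intro min sublinear_ray_shift q ray_shift_le)
    then have "q x \<le> q (x + y) - q y"
      using ray_shift_lower[OF q(1), of 1 y x] by simp
    with sublinear_add[OF q(1), of x y] show ?thesis by simp
  qed
  have neg: "q (- x) = - q x" for x
    using add[of x "- x"] sublinear_zero[OF q(1)] by simp
  have scale: "q (c *\<^sub>R x) = c * q x" for c x
  proof (cases "0 \<le> c")
    case False
    then have "q ((- c) *\<^sub>R x) = (- c) * q x" by (intro sublinear_scale[OF q(1)]) simp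
    then show ?thesis using neg[of "c *\<^sub>R x"] by simp
  qed (rule sublinear_scale[OF q(1)])
  have qp: "q x \<le> p x" for x
    using q(2) ray_shift_le[OF p] by (rule order_trans)
  have "q (- v) \<le> - p v"
    using q(2)[of "- v"] ray_shift_lower[OF p, of 1 v "- v"] sublinear_zero[OF p] by simp
  then have "q v = p v" using qp[of v] neg[of v] by simp
  moreover have "linear q" using add scale by (intro linearI) auto
  ultimately show thesis using qp that by blast
qed

lemma blinfun_Hahn_Banach:
  fixes p :: "'v::real_normed_vector \<Rightarrow> real"
  assumes p: "sublinear p" and bound: "\<And>x. p x \<le> R * norm x"
  obtains l :: "'v \<Rightarrow>\<^sub>L real" where "\<And>x. l x \<le> p x" "l v = p v" "norm l \<le> \<bar>R\<bar>"
proof -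
  obtain l where l: "linear l" "\<And>x. l x \<le> p x" "l v = p v"
    using sublinear_Hahn_Banach[OF p, of v] by blast
  have ab: "\<bar>l x\<bar> \<le> \<bar>R\<bar> * norm x" for x
  proof -
    have "R * norm x \<le> \<bar>R\<bar> * norm x" by (intro mult_right_mono) auto
    then have "l x \<le> \<bar>R\<bar> * norm x" "l (- x) \<le> \<bar>R\<bar> * norm x"
      using l(2)[of x] l(2)[of "- x"] bound[of x] bound[of "- x"] by auto
    then show ?thesis using linear_neg[OF l(1), of x] by auto
  qed
  have "bounded_linear l"
    using l(1) ab by (intro bounded_linear_intro[of _ "\<bar>R\<bar>"])
      (auto simp: linear_add linear_scale mult.commute)
  note app = bounded_linear_Blinfun_apply[OF this]
  show thesis
  proof (rule that[of "Blinfun l"])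
    show "Blinfun l x \<le> p x" for x using l(2) by (simp add: app)
    show "Blinfun l v = p v" using l(3) by (simp add: app)
    show "norm (Blinfun l) \<le> \<bar>R\<bar>" using ab by (intro norm_blinfun_bound) (auto simp: app)
  qed
qed

lemma norming_functional:
  fixes y :: "'v::real_normed_vector"
  obtains l :: "'v \<Rightarrow>\<^sub>L real" where "norm l \<le> 1" "l y = norm y"
proof -
  have "sublinear (norm :: 'v \<Rightarrow> real)" by (intro sublinearI norm_triangle_ineq) auto
  from blinfun_Hahn_Banach[OF this, of 1 y] that show thesis by auto
qed

text \<open>The functional \<open>p\<close> below is the largest sublinear functional that is
  dominated by the norm and satisfies \<open>p (k - y) \<le> - r\<close> on \<open>K\<close>. A
  linear functional under it thus has the norm bound and the full gap \<open>r\<close> at the same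
  time. The distance hypothesis is what keeps the infimum finite.\<close>

lemma separation_at_distance:
  fixes K :: "'v::real_normed_vector set"
  assumes K: "convex K" "K \<noteq> {}" and far: "\<And>k. k \<in> K \<Longrightarrow> r \<le> norm (y - k)"
  obtains l :: "'v \<Rightarrow>\<^sub>L real" where "norm l \<le> 1" "\<And>k. k \<in> K \<Longrightarrow> l k + r \<le> l y"
proof -
  define f where "f z = (\<lambda>(t, k). norm (z + t *\<^sub>R (y - k)) - t * r)" for z
  define p where "p z = (INF s\<in>{0..} \<times> K. f z s)" for z
  have low: "- norm z \<le> f z (t, k)" if "0 \<le> t" "k \<in> K" for z t k
  proof -
    have "t * r \<le> norm (t *\<^sub>R (y - k))" using far[OF that(2)] that(1) by (simp add: mult_left_mono)
    also have "\<dots> \<le> norm (z + t *\<^sub>R (y - k)) + norm z"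
      using norm_triangle_ineq4[of "z + t *\<^sub>R (y - k)" z] by simp
    finally show ?thesis by (simp add: f_def)
  qed
  have bdd: "bdd_below (f z ` ({0..} \<times> K))" for z
    using low by (intro bdd_belowI2[of _ "- norm z"]) auto
  have le: "p z \<le> f z (t, k)" if "0 \<le> t" "k \<in> K" for z t k
    unfolding p_def using that by (intro cINF_lower bdd) auto
  have ge: "w \<le> p z" if "\<And>t k. 0 \<le> t \<Longrightarrow> k \<in> K \<Longrightarrow> w \<le> f z (t, k)" for w z
    unfolding p_def using that K(2) by (intro cINF_greatest) auto
  obtain k0 where k0: "k0 \<in> K" using K(2) by blast
  have pnorm: "p z \<le> 1 * norm z" for z using le[of 0 k0 z] k0 by (simp add: f_def)
  have "sublinear p"
  proof (rule sublinearI)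
    fix z w
    have 1: "p (z + w) \<le> f z (t, k) + f w (s, j)"
      if "0 \<le> t" "0 \<le> s" "k \<in> K" "j \<in> K" for t s k j
    proof (cases "t + s = 0")
      case True
      then have "t = 0" "s = 0" using that by auto
      then show ?thesis
        using pnorm[of "z + w"] norm_triangle_ineq[of z w] by (auto simp: f_def)
    next
      case False
      then have pos: "t + s > 0" using that by linarith
      \<comment> \<open>Convexity of \<open>K\<close> enters here: two rays with parameters
        \<open>t\<close> and \<open>s\<close> merge into a single one with parameter
        \<open>t + s\<close>.\<close>
      let ?m = "(t / (t + s)) *\<^sub>R k + (s / (t + s)) *\<^sub>R j"
      have "?m \<in> K"
        using that pos by (intro convexD[OF K(1)]) (auto simp: add_divide_distrib[symmetric])
      then have "p (z + w) \<le> f (z + w) (t + s, ?m)" using that by (intro le) auto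
      also have "(t + s) *\<^sub>R ?m = t *\<^sub>R k + s *\<^sub>R j" using pos by (simp add: scaleR_add_right)
      then have "z + w + (t + s) *\<^sub>R (y - ?m) = (z + t *\<^sub>R (y - k)) + (w + s *\<^sub>R (y - j))"
        by (simp add: scaleR_diff_right algebra_simps)
      then have "norm (z + w + (t + s) *\<^sub>R (y - ?m))
          \<le> norm (z + t *\<^sub>R (y - k)) + norm (w + s *\<^sub>R (y - j))"
        using norm_triangle_ineq[of "z + t *\<^sub>R (y - k)" "w + s *\<^sub>R (y - j)"] by metis
      then have "f (z + w) (t + s, ?m) \<le> f z (t, k) + f w (s, j)"
        unfolding f_def by (simp add: distrib_right)
      finally show ?thesis .
    qed
    have "p (z + w) - f w (s, j) \<le> p z" if "0 \<le> s" "j \<in> K" for s j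
      using 1 that by (intro ge) (simp add: algebra_simps)
    then have "p (z + w) - p z \<le> p w" by (intro ge) (simp add: algebra_simps)
    then show "p (z + w) \<le> p z + p w" by simp
  next
    have "0 \<le> p 0" using low[of _ _ 0] by (intro ge) auto
    with pnorm[of 0] show "p 0 = 0" by simp
  next
    fix c :: real and z assume c: "0 < c"
    have "p (c *\<^sub>R z) / c \<le> p z"
    proof (rule ge)
      fix t k assume t: "0 \<le> (t::real)" and k: "k \<in> K"
      have "p (c *\<^sub>R z) \<le> f (c *\<^sub>R z) (c * t, k)" using c t k by (intro le) auto
      also have "c *\<^sub>R z + (c * t) *\<^sub>R (y - k) = c *\<^sub>R (z + t *\<^sub>R (y - k))"
        by (simp add: algebra_simps)
      then have "norm (c *\<^sub>R z + (c * t) *\<^sub>R (y - k)) = c * norm (z + t *\<^sub>R (y - k))"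
        using c by (metis norm_scaleR abs_of_pos)
      then have "f (c *\<^sub>R z) (c * t, k) = c * f z (t, k)"
        unfolding f_def by (simp add: right_diff_distrib)
      finally show "p (c *\<^sub>R z) / c \<le> f z (t, k)" using c by (simp add: field_simps)
    qed
    then show "p (c *\<^sub>R z) \<le> c * p z" using c by (simp add: field_simps)
  qed
  then obtain l :: "'v \<Rightarrow>\<^sub>L real" where l: "\<And>x. l x \<le> p x" "norm l \<le> 1"
    using blinfun_Hahn_Banach[OF _ pnorm] by (metis abs_one)
  show thesis
  proof (rule that[OF l(2)])
    fix k assume k: "k \<in> K"
    have "l (k - y) \<le> f (k - y) (1, k)" using l(1)[of "k - y"] le[of 1 k "k - y"] k by simp
    then show "l k + r \<le> l y" by (simp add: f_def blinfun.diff_right)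
  qed
qed

text \<open>Induction on \<open>n\<close>. If some \<open>z\<close> in the kernel of the earlier
  functionals has \<open>f n z \<noteq> 0\<close>, it dictates the coefficient \<open>b\<close> of
  \<open>f n\<close>; projecting along \<open>z\<close> into the kernel of \<open>f n\<close> shows
  that \<open>l - b * f n\<close> satisfies the induction hypothesis.\<close>

lemma linear_vanishing_on_kernels:
  fixes l :: "'v::real_vector \<Rightarrow> real" and f :: "nat \<Rightarrow> 'v \<Rightarrow> real"
  assumes "linear l" "\<And>i. linear (f i)"
    and "\<And>x. (\<And>i. i < n \<Longrightarrow> f i x = 0) \<Longrightarrow> l x = 0"
  shows "\<exists>a. \<forall>x. l x = (\<Sum>i<n. a i * f i x)"
  using assms(1,3)
proof (induction n arbitrary: l)
  case 0
  then show ?case by simp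
next
  case (Suc n)
  show ?case
  proof (cases "\<exists>z. (\<forall>i<n. f i z = 0) \<and> f n z \<noteq> 0")
    case False
    then have "\<And>x. (\<And>i. i < n \<Longrightarrow> f i x = 0) \<Longrightarrow> l x = 0"
      using Suc.prems(2) less_Suc_eq by metis
    from Suc.IH[OF Suc.prems(1) this] obtain a where a: "\<forall>x. l x = (\<Sum>i<n. a i * f i x)" by blast
    then show ?thesis by (intro exI[of _ "a(n := 0)"]) simp
  next
    case True
    then obtain z where z: "\<And>i. i < n \<Longrightarrow> f i z = 0" "f n z \<noteq> 0" by blast
    define b where "b = l z / f n z"
    define l' where "l' x = l x - b * f n x" for x
    have lin: "linear l'"
      using Suc.prems(1) assms(2)[of n] unfolding l'_def
      by (intro linearI) (auto simp: linear_add linear_scale algebra_simps)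
    have "l' x = 0" if x: "\<And>i. i < n \<Longrightarrow> f i x = 0" for x
    proof -
      let ?w = "x - (f n x / f n z) *\<^sub>R z"
      have "f i ?w = 0" if "i < Suc n" for i
        using that x z assms(2)[of i] less_Suc_eq by (auto simp: linear_diff linear_scale)
      then have "l ?w = 0" by (rule Suc.prems(2))
      then show ?thesis
        using Suc.prems(1) by (simp add: l'_def b_def linear_diff linear_scale)
    qed
    from Suc.IH[OF lin this] obtain a where a: "\<forall>x. l' x = (\<Sum>i<n. a i * f i x)" by blast
    have "l x = (\<Sum>i<Suc n. (a(n := b)) i * f i x)" for x
      using a[rule_format, of x] by (simp add: l'_def)
    then show ?thesis by blast
  qed
qed

text \<open>Completeness of Lebesgue measure makes measurability of the exceptional set automatic.
  This is the bridge from almost everywhere statements to the lemmas on gauge integrals, which speak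
  of negligible sets.\<close>

lemma AE_lebesgue_on_iff_negligible:
  assumes "S \<in> sets lebesgue"
  shows "(AE t in lebesgue_on S. P t) \<longleftrightarrow> negligible {t \<in> S. \<not> P t}"
proof -
  have "(AE t in lebesgue_on S. P t) \<longleftrightarrow> (AE t in lebesgue. t \<in> S \<longrightarrow> P t)"
    using assms by (subst AE_restrict_space_iff) auto
  also have "\<dots> \<longleftrightarrow> (\<exists>N. negligible N \<and> {t \<in> S. \<not> P t} \<subseteq> N)"
    by (simp add: eventually_ae_filter_negligible)
  also have "\<dots> \<longleftrightarrow> negligible {t \<in> S. \<not> P t}"
    by (auto intro: negligible_subset)
  finally show ?thesis .
qed

section \<open>Differentiation of indefinite integrals\<close>

lemma integral_difference:
  fixes f :: "real \<Rightarrow> real"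
  assumes "f integrable_on {a..b}" "a \<le> u" "u \<le> v" "v \<le> b"
  shows "integral {a..v} f - integral {a..u} f = integral {u..v} f"
proof -
  have "f integrable_on {a..v}"
    using assms by (auto intro: integrable_on_subinterval)
  then have "integral {a..u} f + integral {u..v} f = integral {a..v} f"
    using assms by (intro Henstock_Kurzweil_Integration.integral_combine) auto
  then show ?thesis by simp
qed

text \<open>Where the derivative fails, arbitrarily short intervals carry an increment error of at
  least a fixed fraction of their length. Vitali's theorem selects disjoint ones that cover almost
  all such points, and Henstock's lemma bounds their total error, hence their total length.\<close>

theorem negligible_not_differentiable_integral:
  fixes f :: "real \<Rightarrow> real"
  assumes f: "f integrable_on {a..b}"
  shows "negligible {x \<in> {a<..<b}.
    \<not> ((\<lambda>x. integral {a..x} f) has_real_derivative f x) (at x)}"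
proof -
  define F where "F x = integral {a..x} f" for x
  \<comment> \<open>Failure at rate \<open>1 / Suc n\<close>. The pair records the tag
    \<open>x\<close> and the other endpoint \<open>y\<close>, which may lie on either side.\<close>
  define K where "K n = {(x, y). x \<in> {a<..<b} \<and> y \<in> {a<..<b} \<and> y \<noteq> x
      \<and> \<bar>y - x\<bar> < Suc n * \<bar>F y - F x - f x * (y - x)\<bar>}" for n
  define bad where "bad n = {x. \<forall>d>0. \<exists>y. (x, y) \<in> K n \<and> \<bar>y - x\<bar> < d}" for n
  have cover: "{x \<in> {a<..<b}. \<not> (F has_real_derivative f x) (at x)} \<subseteq> (\<Union>n. bad n)"
  proof (rule ccontr)
    assume "\<not> ?thesis"
    then obtain x where x: "x \<in> {a<..<b}" "\<not> (F has_real_derivative f x) (at x)"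
      and good: "\<And>n. x \<notin> bad n" by blast
    have "(F has_real_derivative f x) (at x)"
      unfolding has_field_derivative_iff LIM_def
    proof (intro allI impI)
      fix e :: real assume "0 < e"
      then obtain n where n: "inverse (Suc n) < e" using reals_Archimedean by blast
      obtain d where d: "d > 0" "\<And>y. (x, y) \<in> K n \<Longrightarrow> d \<le> \<bar>y - x\<bar>"
        using good[of n] by (fastforce simp: bad_def)
      define d' where "d' = min d (min (x - a) (b - x))"
      have "dist ((F y - F x) / (y - x)) (f x) < e" if "y \<noteq> x" "dist y x < d'" for y
      proof -
        have y: "y \<in> {a<..<b}" "\<bar>y - x\<bar> < d" using that by (auto simp: d'_def dist_real_def)
        then have "Suc n * \<bar>F y - F x - f x * (y - x)\<bar> \<le> \<bar>y - x\<bar>"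
          using d(2)[of y] x that(1) by (force simp: K_def)
        then have "\<bar>F y - F x - f x * (y - x)\<bar> / \<bar>y - x\<bar> \<le> inverse (Suc n)"
          using that(1) by (simp add: field_simps)
        also have "\<bar>F y - F x - f x * (y - x)\<bar> / \<bar>y - x\<bar> = \<bar>(F y - F x) / (y - x) - f x\<bar>"
          using that(1) by (simp add: abs_divide[symmetric] field_simps del: abs_divide)
        finally show ?thesis using n by (simp add: dist_real_def)
      qed
      moreover have "d' > 0" using d(1) x(1) by (auto simp: d'_def)
      ultimately show "\<exists>s>0. \<forall>y. y \<noteq> x \<and> dist y x < s \<longrightarrow>
          dist ((F y - F x) / (y - x)) (f x) < e" by blast
    qed
    with x(2) show False ..
  qed
  have "negligible (bad n)" for n
    unfolding negligible_outer_le
  proof (intro allI impI)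
    fix e :: real assume e: "0 < e"
    \<comment> \<open>The tolerance \<open>e / Suc n\<close> compensates the factor
      \<open>Suc n\<close> lost in passing from errors to lengths.\<close>
    obtain \<gamma> where \<gamma>: "gauge \<gamma>"
      and hen: "\<And>p. p tagged_partial_division_of cbox a b \<Longrightarrow> \<gamma> fine p \<Longrightarrow>
        (\<Sum>(x, k)\<in>p. norm (measure lborel k *\<^sub>R f x - integral k f)) < e / Suc n"
      using Henstock_lemma[of f a b "e / Suc n"] f e by auto
    define I where "I = (\<lambda>(x, y). {min x y..max x y :: real})"
    have Icball: "I s = cball ((fst s + snd s) / 2) (\<bar>snd s - fst s\<bar> / 2)" for s
      by (cases s) (auto simp: I_def cball_eq_atLeastAtMost min_def max_def field_simps)
    let ?K = "{s \<in> K n. I s \<subseteq> \<gamma> (fst s)}"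
    obtain C where C: "countable C" "C \<subseteq> ?K" "pairwise (\<lambda>i j. disjnt (I i) (I j)) C"
      and neg: "negligible (bad n - (\<Union>i\<in>C. I i))"
      unfolding Icball
    proof (rule Vitali_covering_theorem_cballs[of ?K "\<lambda>s. \<bar>snd s - fst s\<bar> / 2" "bad n"
          "\<lambda>s. (fst s + snd s) / 2"])
      show "0 < \<bar>snd s - fst s\<bar> / 2" if "s \<in> ?K" for s
        using that by (auto simp: K_def)
    next
      fix x and d :: real assume x: "x \<in> bad n" and d: "0 < d"
      have "open (\<gamma> x)" "x \<in> \<gamma> x" using \<gamma> by (auto simp: gauge_def)
      then obtain r where r: "r > 0" "ball x r \<subseteq> \<gamma> x" by (meson openE)
      obtain y where y: "(x, y) \<in> K n" "\<bar>y - x\<bar> < min d r"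
        using x d r(1) min_less_iff_conj[of 0 d r] unfolding bad_def by blast
      have "I (x, y) \<subseteq> ball x r" using y(2) by (auto simp: I_def dist_real_def)
      then have "(x, y) \<in> ?K" using y(1) r(2) by auto
      moreover have "x \<in> I (x, y)" by (simp add: I_def)
      ultimately show "\<exists>i. i \<in> ?K \<and> x \<in> cball ((fst i + snd i) / 2) (\<bar>snd i - fst i\<bar> / 2)
          \<and> \<bar>snd i - fst i\<bar> / 2 < d"
        using y(2) unfolding Icball by (intro exI[of _ "(x, y)"]) auto
    next
      fix C assume "countable C" "C \<subseteq> ?K"
        "pairwise (\<lambda>i j. disjnt (cball ((fst i + snd i) / 2) (\<bar>snd i - fst i\<bar> / 2))
          (cball ((fst j + snd j) / 2) (\<bar>snd j - fst j\<bar> / 2))) C"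
        "negligible (bad n - (\<Union>i\<in>C. cball ((fst i + snd i) / 2) (\<bar>snd i - fst i\<bar> / 2)))"
      then show thesis by (intro that[of C]) (simp_all only: Icball)
    qed
    have fin: "measure lebesgue (\<Union>i\<in>D. I i) \<le> e" if D: "D \<subseteq> C" "finite D" for D
    proof -
      define p where "p = (\<lambda>s. (fst s, I s)) ` D"
      have Dn: "fst s \<in> I s" "I s \<subseteq> {a<..<b}" "fst s \<noteq> snd s" "s \<in> K n" "I s \<subseteq> \<gamma> (fst s)"
        if "s \<in> D" for s
        using that D C(2) by (force simp: I_def K_def)+
      have disj: "I s \<inter> I s' = {}" if "s \<in> D" "s' \<in> D" "s \<noteq> s'" for s s'
        using C(3) D(1) that by (auto simp: pairwise_def disjnt_def)
      have inj: "inj_on (\<lambda>s. (fst s, I s)) D"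
        using disj Dn(1) by (intro inj_onI) (metis Int_absorb empty_iff prod.inject)
      have tag: "p tagged_partial_division_of cbox a b"
        unfolding tagged_partial_division_of_def
      proof (intro conjI allI impI)
        show "finite p" using D(2) by (simp add: p_def)
        fix x k assume "(x, k) \<in> p"
        then obtain s where s: "s \<in> D" "x = fst s" "k = I s" by (auto simp: p_def)
        show "x \<in> k" "k \<subseteq> cbox a b" using Dn(1,2)[OF s(1)] s by auto
        show "\<exists>a b. k = cbox a b" using s(3) by (auto simp: I_def split: prod.splits)
      next
        fix x k x' k' assume "(x, k) \<in> p \<and> (x', k') \<in> p \<and> (x, k) \<noteq> (x', k')"
        then obtain s s' where "s \<in> D" "k = I s" "s' \<in> D" "k' = I s'" "s \<noteq> s'"
          by (auto simp: p_def)
        then have "k \<inter> k' = {}" using disj by blast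
        then show "interior k \<inter> interior k' = {}" using interior_subset by blast
      qed
      have fine: "\<gamma> fine p"
        unfolding fine_def p_def using Dn(5) by blast
      note less = hen[OF tag fine]
      have "(\<Sum>(x, k)\<in>p. norm (measure lborel k *\<^sub>R f x - integral k f))
          = (\<Sum>s\<in>D. norm (measure lborel (I s) *\<^sub>R f (fst s) - integral (I s) f))"
        unfolding p_def by (subst sum.reindex[OF inj]) (rule sum.cong, simp_all)
      also have "\<dots> = (\<Sum>s\<in>D. \<bar>F (snd s) - F (fst s) - f (fst s) * (snd s - fst s)\<bar>)"
      proof (rule sum.cong)
        fix s assume s: "s \<in> D"
        obtain x y where xy: "s = (x, y)" by (cases s)
        have mem: "a < x" "x < b" "a < y" "y < b"
          using Dn(4)[OF s] by (auto simp: xy K_def)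
        show "norm (measure lborel (I s) *\<^sub>R f (fst s) - integral (I s) f)
            = \<bar>F (snd s) - F (fst s) - f (fst s) * (snd s - fst s)\<bar>"
        proof (cases "x \<le> y")
          case True
          then show ?thesis
            using integral_difference[OF f, of x y] mem
            by (simp add: xy I_def F_def abs_minus_commute mult.commute)
        next
          case False
          then show ?thesis
            using integral_difference[OF f, of y x] mem
            by (simp add: xy I_def F_def algebra_simps)
        qed
      qed simp
      finally have "(\<Sum>s\<in>D. \<bar>F (snd s) - F (fst s) - f (fst s) * (snd s - fst s)\<bar>) < e / Suc n"
        using less by simp
      then have "Suc n * (\<Sum>s\<in>D. \<bar>F (snd s) - F (fst s) - f (fst s) * (snd s - fst s)\<bar>) < e"
        by (simp add: pos_less_divide_eq mult.commute)
      moreover have "(\<Sum>s\<in>D. \<bar>snd s - fst s\<bar>)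
          \<le> Suc n * (\<Sum>s\<in>D. \<bar>F (snd s) - F (fst s) - f (fst s) * (snd s - fst s)\<bar>)"
        unfolding sum_distrib_left using Dn(4) by (intro sum_mono) (force simp: K_def)
      moreover have "measure lebesgue (\<Union>i\<in>D. I i) \<le> (\<Sum>s\<in>D. measure lebesgue (I s))"
        using D(2) by (intro measure_UNION_le) (auto simp: I_def split: prod.splits)
      moreover have "(\<Sum>s\<in>D. measure lebesgue (I s)) = (\<Sum>s\<in>D. \<bar>snd s - fst s\<bar>)"
        by (intro sum.cong) (auto simp: I_def split: prod.splits)
      ultimately show ?thesis by linarith
    qed
    have Imeas: "I i \<in> lmeasurable" for i by (simp add: Icball)
    have U: "(\<Union>i\<in>C. I i) \<in> lmeasurable" "measure lebesgue (\<Union>i\<in>C. I i) \<le> e"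
      using fmeasurable_UN_bound[OF C(1) Imeas fin] measure_UN_bound[OF C(1) Imeas fin] by blast+
    let ?N = "bad n - (\<Union>i\<in>C. I i)"
    show "\<exists>T. bad n \<subseteq> T \<and> T \<in> lmeasurable \<and> measure lebesgue T \<le> e"
    proof (intro exI conjI)
      show "bad n \<subseteq> (\<Union>i\<in>C. I i) \<union> ?N" by blast
      have N: "?N \<in> lmeasurable" "measure lebesgue ?N = 0"
        using neg negligible_imp_measurable negligible_imp_measure0 by auto
      show "(\<Union>i\<in>C. I i) \<union> ?N \<in> lmeasurable" by (intro fmeasurable.Un U N)
      show "measure lebesgue ((\<Union>i\<in>C. I i) \<union> ?N) \<le> e"
        using measure_Un_le[of "\<Union>i\<in>C. I i" lebesgue ?N] U N by (simp add: fmeasurableD)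
    qed
  qed
  then have "negligible (\<Union>n. bad n)" by (intro negligible_countable_Union) auto
  then show ?thesis using cover unfolding F_def by (rule negligible_subset)
qed

section \<open>Functions of type ACG\<close>

definition nonoverlapping_family :: "real set \<Rightarrow> real \<Rightarrow> (real \<times> real) set \<Rightarrow> bool" where
  "nonoverlapping_family E d P \<longleftrightarrow>
    finite P \<and>
    (\<forall>(u, v)\<in>P. u \<in> E \<and> v \<in> E \<and> u < v) \<and>
    (\<forall>(u, v)\<in>P. \<forall>(u', v')\<in>P. (u, v) \<noteq> (u', v') \<longrightarrow> {u<..<v} \<inter> {u'<..<v'} = {}) \<and>
    (\<Sum>(u, v)\<in>P. v - u) < d"

lemma AC_on_iff:
  "AC_on F E \<longleftrightarrow> (\<forall>e>0. \<exists>d>0. \<forall>P. nonoverlapping_family E d P \<longrightarrow> (\<Sum>(u, v)\<in>P. \<bar>F v - F u\<bar>) < e)"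
  unfolding AC_on_def nonoverlapping_family_def ..

lemma nonoverlapping_family_mono:
  assumes "nonoverlapping_family E d P" "E \<subseteq> E'" "d \<le> d'"
  shows "nonoverlapping_family E' d' P"
  unfolding nonoverlapping_family_def
proof (intro conjI)
  note P = assms(1)[unfolded nonoverlapping_family_def]
  show "finite P" using P by blast
  show "\<forall>(u, v)\<in>P. u \<in> E' \<and> v \<in> E' \<and> u < v" using P assms(2) by blast
  show "\<forall>(u, v)\<in>P. \<forall>(u', v')\<in>P. (u, v) \<noteq> (u', v') \<longrightarrow> {u<..<v} \<inter> {u'<..<v'} = {}"
    using P by (elim conjE)
  show "(\<Sum>(u, v)\<in>P. v - u) < d'" using P assms(3) by (elim conjE) (rule less_le_trans)
qed

lemma AC_on_subset:
  assumes "AC_on F E" "E' \<subseteq> E"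
  shows "AC_on F E'"
proof -
  have "nonoverlapping_family E d P" if "nonoverlapping_family E' d P" for d P
    using that assms(2) by (rule nonoverlapping_family_mono) simp
  then show ?thesis using assms(1) unfolding AC_on_iff by blast
qed

lemma AC_on_uminus: "AC_on F E \<Longrightarrow> AC_on (\<lambda>x. - F x) E"
  unfolding AC_on_iff by (simp add: abs_minus_commute)

lemma AC_on_add:
  assumes "AC_on F E" "AC_on G E"
  shows "AC_on (\<lambda>x. F x + G x) E"
  unfolding AC_on_iff
proof (intro allI impI)
  fix e :: real assume "e > 0"
  then have "e / 2 > 0" by simp
  obtain d1 where d1: "d1 > 0"
    "\<And>P. nonoverlapping_family E d1 P \<Longrightarrow> (\<Sum>(u, v)\<in>P. \<bar>F v - F u\<bar>) < e / 2"
    using assms(1) \<open>e / 2 > 0\<close> unfolding AC_on_iff by blast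
  obtain d2 where d2: "d2 > 0"
    "\<And>P. nonoverlapping_family E d2 P \<Longrightarrow> (\<Sum>(u, v)\<in>P. \<bar>G v - G u\<bar>) < e / 2"
    using assms(2) \<open>e / 2 > 0\<close> unfolding AC_on_iff by blast
  show "\<exists>d>0. \<forall>P. nonoverlapping_family E d P
      \<longrightarrow> (\<Sum>(u, v)\<in>P. \<bar>F v + G v - (F u + G u)\<bar>) < e"
  proof (intro exI[of _ "min d1 d2"] conjI allI impI)
    show "0 < min d1 d2" using d1 d2 by simp
    fix P assume P: "nonoverlapping_family E (min d1 d2) P"
    have "(\<Sum>(u, v)\<in>P. \<bar>F v + G v - (F u + G u)\<bar>)
        \<le> (\<Sum>(u, v)\<in>P. \<bar>F v - F u\<bar> + \<bar>G v - G u\<bar>)"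
      by (intro sum_mono) auto
    also have "\<dots> = (\<Sum>(u, v)\<in>P. \<bar>F v - F u\<bar>) + (\<Sum>(u, v)\<in>P. \<bar>G v - G u\<bar>)"
      by (simp add: split_def sum.distrib)
    also have "\<dots> < e / 2 + e / 2"
      by (intro add_strict_mono d1 d2 nonoverlapping_family_mono[OF P]) auto
    finally show "(\<Sum>(u, v)\<in>P. \<bar>F v + G v - (F u + G u)\<bar>) < e" by simp
  qed
qed

lemma ACG_I:
  fixes A :: "nat \<Rightarrow> real set"
  assumes "continuous_on {0..1} F" "(\<Union>n. A n) = {0..1}" "\<And>n. AC_on F (A n)"
  shows "ACG F"
  unfolding ACG_def using assms by (intro conjI exI[of _ A] allI)

lemma ACG_uminus:
  assumes "ACG F"
  shows "ACG (\<lambda>x. - F x)"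
proof -
  obtain A :: "nat \<Rightarrow> real set" where A: "(\<Union>n. A n) = {0..1}" "\<And>n. AC_on F (A n)"
    using assms unfolding ACG_def by blast
  have "AC_on (\<lambda>x. - F x) (A n)" for n
    using A(2) by (rule AC_on_uminus)
  moreover have "continuous_on {0..1} (\<lambda>x. - F x)"
    using assms unfolding ACG_def by (intro continuous_on_minus) blast
  ultimately show ?thesis
    by (intro ACG_I[of _ A] A(1))
qed

lemma ACG_add:
  assumes "ACG F" "ACG G"
  shows "ACG (\<lambda>x. F x + G x)"
proof -
  obtain A :: "nat \<Rightarrow> real set" where A: "(\<Union>n. A n) = {0..1}" "\<And>n. AC_on F (A n)"
    using assms(1) unfolding ACG_def by blast
  obtain B :: "nat \<Rightarrow> real set" where B: "(\<Union>n. B n) = {0..1}" "\<And>n. AC_on G (B n)"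
    using assms(2) unfolding ACG_def by blast
  define C where "C k = A (fst (prod_decode k)) \<inter> B (snd (prod_decode k))" for k
  have "(\<Union>k. C k) = (\<Union>n. A n) \<inter> (\<Union>n. B n)"
  proof (intro equalityI subsetI)
    fix x assume "x \<in> (\<Union>n. A n) \<inter> (\<Union>n. B n)"
    then obtain m n where "x \<in> A m" "x \<in> B n" by blast
    then have "x \<in> C (prod_encode (m, n))" by (simp add: C_def)
    then show "x \<in> (\<Union>k. C k)" by blast
  qed (auto simp: C_def)
  then have "(\<Union>k. C k) = {0..1}" by (simp only: A(1) B(1) Int_absorb)
  moreover have "AC_on (\<lambda>x. F x + G x) (C k)" for k
  proof (rule AC_on_add)
    show "AC_on F (C k)" unfolding C_def using A(2) Int_lower1 by (rule AC_on_subset)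
    show "AC_on G (C k)" unfolding C_def using B(2) Int_lower2 by (rule AC_on_subset)
  qed
  moreover have "continuous_on {0..1} (\<lambda>x. F x + G x)"
    using assms unfolding ACG_def by (intro continuous_on_add) auto
  ultimately show ?thesis by (intro ACG_I[of _ C])
qed

text \<open>The largest distance from \<open>s\<close> need not be attained; the factor 2 buys an
  actual point \<open>t\<close>. Applied to the image of a set under \<open>F\<close>, this encloses
  the image in a ball governed by a single increment of \<open>F\<close> with both endpoints in that
  set.\<close>

lemma bounded_real_almost_diameter:
  fixes S :: "real set"
  assumes "bounded S" "S \<noteq> {}"
  obtains s t where "s \<in> S" "t \<in> S" "S \<subseteq> cball s (2 * \<bar>t - s\<bar>)"
proof -
  obtain s where s: "s \<in> S" using assms(2) by blast
  show thesis
  proof (cases "S = {s}")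
    case True
    then show thesis using that[of s s] by auto
  next
    case False
    define d where "d = (SUP x\<in>S. \<bar>x - s\<bar>)"
    have bdd: "bdd_above ((\<lambda>x. \<bar>x - s\<bar>) ` S)"
    proof -
      obtain B where "\<And>x. x \<in> S \<Longrightarrow> \<bar>x\<bar> \<le> B" using assms(1) by (auto simp: bounded_iff)
      then show ?thesis by (intro bdd_aboveI2[of _ _ "B + \<bar>s\<bar>"]) (smt (verit))
    qed
    have le: "\<bar>x - s\<bar> \<le> d" if "x \<in> S" for x
      unfolding d_def using that by (intro cSUP_upper bdd)
    obtain x where x: "x \<in> S" "x \<noteq> s" using False s by blast
    then have "d > 0" using le[of x] by auto
    then have "d / 2 < d" by simp
    then obtain t where "t \<in> S" "d / 2 < \<bar>t - s\<bar>"
      unfolding d_def using less_cSUP_iff[OF assms(2) bdd] by (metis d_def)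
    then show thesis
      using le s by (intro that[of s t]) (force simp: dist_real_def abs_minus_commute)+
  qed
qed

text \<open>Lusin's condition (N): the components of a small open neighbourhood of the null set form the
  family of intervals to which absolute continuity is applied.\<close>

lemma negligible_image_AC_on:
  assumes AC: "AC_on F E" and D: "negligible D" "D \<subseteq> E"
  shows "negligible (F ` D)"
  unfolding negligible_outer_le
proof (intro allI impI)
  fix e :: real assume e: "e > 0"
  \<comment> \<open>The covering balls will have radius \<open>2 * \<bar>F t - F s\<bar>\<close>, so
    their length is four increments.\<close>
  then have "e / 4 > 0" by simp
  obtain d where d: "d > 0"
    "\<And>P. nonoverlapping_family E d P \<Longrightarrow> (\<Sum>(u, v)\<in>P. \<bar>F v - F u\<bar>) < e / 4"
    using AC \<open>e / 4 > 0\<close> unfolding AC_on_iff by blast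
  obtain O' where O': "open O'" "D \<subseteq> O'" "O' - D \<in> lmeasurable" "emeasure lebesgue (O' - D) < ennreal d"
    using sets_lebesgue_outer_open[of D d] d(1) D(1) negligible_imp_sets by metis
  have "O' \<in> sets lebesgue" using O'(1) by (simp add: borel_open)
  have "emeasure lebesgue O' = emeasure lebesgue (O' - D)"
    using D(1) O'(1) by (intro emeasure_Diff_null_set[symmetric]) (auto simp: negligible_iff_null_sets)
  then have less: "emeasure lebesgue O' < ennreal d" using O'(4) by simp
  then have Om1: "O' \<in> lmeasurable"
    using \<open>O' \<in> sets lebesgue\<close> by (intro fmeasurableI) (auto intro: less_trans)
  then have "measure lebesgue O' < d"
    using less d(1) by (simp add: emeasure_eq_measure2 ennreal_less_iff)
  note Om = Om1 this
  define \<C> where "\<C> = {J \<in> components O'. D \<inter> J \<noteq> {}}"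
  have comp: "open J" "connected J" "J \<subseteq> O'" if "J \<in> \<C>" for J
    using that O'(1) by (auto simp: \<C>_def open_components in_components_connected in_components_subset)
  have disj: "J \<inter> J' = {}" if "J \<in> \<C>" "J' \<in> \<C>" "J \<noteq> J'" for J J'
    using that components_nonoverlap[of J O' J'] by (auto simp: \<C>_def)
  have cnt: "countable \<C>"
    by (rule countable_disjoint_open_subsets) (use comp disj in \<open>auto simp: disjoint_def\<close>)
  have conv: "{u<..<v} \<subseteq> J" if "J \<in> \<C>" "u \<in> J" "v \<in> J" for J and u v :: real
    using comp(2)[OF that(1)] that(2,3) by (meson connected_contains_Ioo)
  have small: "\<bar>v - u\<bar> < d" if "J \<in> \<C>" "u \<in> J" "v \<in> J" for J and u v :: real
  proof -
    have "{min u v<..<max u v} \<subseteq> O'" using conv[OF that(1)] comp(3)[OF that(1)] that by (metis max_def min_def order.trans)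
    then have "measure lebesgue {min u v<..<max u v} \<le> measure lebesgue O'"
      using Om(1) by (intro measure_mono_fmeasurable) auto
    then show ?thesis using Om(2) by (auto simp: min_def max_def split: if_splits)
  qed
  have "\<exists>s t. s \<in> D \<inter> J \<and> t \<in> D \<inter> J \<and> F ` (D \<inter> J) \<subseteq> cball (F s) (2 * \<bar>F t - F s\<bar>)"
    if J: "J \<in> \<C>" for J
  proof -
    obtain s where s: "s \<in> D \<inter> J" using J by (auto simp: \<C>_def)
    have "\<bar>F t - F s\<bar> \<le> e / 4" if t: "t \<in> D \<inter> J" for t
    proof (cases "t = s")
      case False
      \<comment> \<open>A family with one interval: absolute continuity also bounds each single
        increment, which makes the image of \<open>D \<inter> J\<close> bounded.\<close>
      have "nonoverlapping_family E d {(min s t, max s t)}"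
        using False s t D(2) small[OF J, of s t]
        by (auto simp: nonoverlapping_family_def min_def max_def)
      from d(2)[OF this] show ?thesis
        by (cases "s \<le> t") (auto simp: min_def max_def abs_minus_commute[of "F t"])
    qed (use e in simp)
    then have "bounded (F ` (D \<inter> J))"
      unfolding bounded_def by (intro exI[of _ "F s"] exI[of _ "e / 4"]) (auto simp: dist_real_def abs_minus_commute)
    then show ?thesis using s by (elim bounded_real_almost_diameter) blast+
  qed
  then obtain s t where st: "\<And>J. J \<in> \<C> \<Longrightarrow> s J \<in> D \<inter> J" "\<And>J. J \<in> \<C> \<Longrightarrow> t J \<in> D \<inter> J"
    and im: "\<And>J. J \<in> \<C> \<Longrightarrow> F ` (D \<inter> J) \<subseteq> cball (F (s J)) (2 * \<bar>F (t J) - F (s J)\<bar>)"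
    by metis
  define B where "B J = cball (F (s J)) (2 * \<bar>F (t J) - F (s J)\<bar>)" for J
  have Bm: "B J \<in> lmeasurable" "measure lebesgue (B J) = 4 * \<bar>F (t J) - F (s J)\<bar>" for J
    by (auto simp: B_def cball_eq_atLeastAtMost)
  have fin: "measure lebesgue (\<Union>J\<in>\<D>. B J) \<le> e" if D': "\<D> \<subseteq> \<C>" "finite \<D>" for \<D>
  proof -
    \<comment> \<open>Components with \<open>s J = t J\<close> are dropped because the intervals of
      a family must be nondegenerate; their balls have radius zero and add nothing.\<close>
    define \<D>' where "\<D>' = {J \<in> \<D>. s J \<noteq> t J}"
    define g where "g J = (min (s J) (t J), max (s J) (t J))" for J
    have D'': "finite \<D>'" "\<And>J. J \<in> \<D>' \<Longrightarrow> J \<in> \<C>" using D' by (auto simp: \<D>'_def)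
    have mem: "fst (g J) \<in> D \<inter> J" "snd (g J) \<in> D \<inter> J" "fst (g J) < snd (g J)" if "J \<in> \<D>'" for J
      using st[OF D''(2)[OF that]] that by (auto simp: g_def min_def max_def \<D>'_def)
    have gJ: "{fst (g J)<..<snd (g J)} \<subseteq> J" if "J \<in> \<D>'" for J
      using conv[OF D''(2)[OF that]] mem[OF that] by blast
    have inj: "inj_on g \<D>'"
      using mem(1) disj D''(2) by (intro inj_onI) (metis IntD2 disjoint_iff)
    have fam: "nonoverlapping_family E d (g ` \<D>')"
      unfolding nonoverlapping_family_def
    proof (intro conjI)
      show "\<forall>(u, v)\<in>g ` \<D>'. u \<in> E \<and> v \<in> E \<and> u < v"
      proof (intro ballI)
        fix w assume "w \<in> g ` \<D>'"
        then obtain J where "J \<in> \<D>'" "w = g J" by blast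
        then show "case w of (u, v) \<Rightarrow> u \<in> E \<and> v \<in> E \<and> u < v"
          using mem[of J] D(2) by (auto simp: split_beta)
      qed
      show "\<forall>(u, v)\<in>g ` \<D>'. \<forall>(u', v')\<in>g ` \<D>'.
          (u, v) \<noteq> (u', v') \<longrightarrow> {u<..<v} \<inter> {u'<..<v'} = {}"
        unfolding split_beta
      proof (intro ballI impI)
        fix w w'
        assume "w \<in> g ` \<D>'" "w' \<in> g ` \<D>'" and ne: "(fst w, snd w) \<noteq> (fst w', snd w')"
        then obtain J J' where J: "J \<in> \<D>'" "w = g J" "J' \<in> \<D>'" "w' = g J'" by blast
        then have "J \<inter> J' = {}" using ne disj D''(2) by blast
        then show "{fst w<..<snd w} \<inter> {fst w'<..<snd w'} = {}"
          using gJ[OF J(1)] gJ[OF J(3)] J by blast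
      qed
      have "(\<Sum>(u, v)\<in>g ` \<D>'. v - u) = (\<Sum>J\<in>\<D>'. measure lebesgue {fst (g J)<..<snd (g J)})"
        using mem(3) by (subst sum.reindex[OF inj]) (auto simp: split_def less_imp_le intro!: sum.cong)
      also have "\<dots> = measure lebesgue (\<Union>J\<in>\<D>'. {fst (g J)<..<snd (g J)})"
      proof (rule measure_UNION'[symmetric])
        show "pairwise (\<lambda>J J'. disjnt {fst (g J)<..<snd (g J)} {fst (g J')<..<snd (g J')}) \<D>'"
          unfolding pairwise_def disjnt_def
        proof (intro ballI impI)
          fix J J' assume J: "J \<in> \<D>'" "J' \<in> \<D>'" "J \<noteq> J'"
          then have "J \<inter> J' = {}" using disj D''(2) by blast
          then show "{fst (g J)<..<snd (g J)} \<inter> {fst (g J')<..<snd (g J')} = {}"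
            using gJ[OF J(1)] gJ[OF J(2)] by blast
        qed
      qed (use D'' in auto)
      also have "\<dots> \<le> measure lebesgue O'"
      proof (rule measure_mono_fmeasurable)
        show "(\<Union>J\<in>\<D>'. {fst (g J)<..<snd (g J)}) \<subseteq> O'"
          using gJ comp(3) D''(2) by blast
        show "(\<Union>J\<in>\<D>'. {fst (g J)<..<snd (g J)}) \<in> sets lebesgue"
          using D''(1) by (intro sets.finite_UN) auto
      qed (rule Om(1))
      finally show "(\<Sum>(u, v)\<in>g ` \<D>'. v - u) < d" using Om(2) by simp
    qed (use D'' in simp)
    have "measure lebesgue (\<Union>J\<in>\<D>. B J) \<le> (\<Sum>J\<in>\<D>. measure lebesgue (B J))"
      using D'(2) Bm(1) by (intro measure_UNION_le) (auto dest: fmeasurableD)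
    also have "\<dots> = (\<Sum>J\<in>\<D>'. measure lebesgue (B J))"
      using D'(2) by (intro sum.mono_neutral_right) (auto simp: \<D>'_def Bm)
    also have "\<dots> = 4 * (\<Sum>(u, v)\<in>g ` \<D>'. \<bar>F v - F u\<bar>)"
      unfolding Bm sum.reindex[OF inj] sum_distrib_left
      by (intro sum.cong) (auto simp: g_def min_def max_def abs_minus_commute)
    also have "\<dots> \<le> e" using d(2)[OF fam] by simp
    finally show ?thesis .
  qed
  have "F ` D \<subseteq> (\<Union>J\<in>\<C>. B J)"
  proof clarify
    fix x assume x: "x \<in> D"
    then obtain J where J: "J \<in> components O'" "x \<in> J" using O'(2) by (metis Union_components UnionE subsetD)
    then have "J \<in> \<C>" using x by (auto simp: \<C>_def)
    moreover have "F x \<in> B J" unfolding B_def using im[OF \<open>J \<in> \<C>\<close>] J(2) x by blast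
    ultimately show "F x \<in> (\<Union>J\<in>\<C>. B J)" by blast
  qed
  then show "\<exists>T. F ` D \<subseteq> T \<and> T \<in> lmeasurable \<and> measure lebesgue T \<le> e"
    using fmeasurable_UN_bound[OF cnt Bm(1) fin] measure_UN_bound[OF cnt Bm(1) fin] by blast
qed

lemma negligible_image_ACG:
  assumes "ACG F" "negligible D" "D \<subseteq> {0..1}"
  shows "negligible (F ` D)"
proof -
  obtain A :: "nat \<Rightarrow> real set" where A: "(\<Union>n. A n) = {0..1}" "\<And>n. AC_on F (A n)"
    using assms(1) unfolding ACG_def by blast
  have "negligible (F ` (D \<inter> A n))" for n
    using assms(2) by (intro negligible_image_AC_on[OF A(2)]) (auto intro: negligible_subset)
  then have "negligible (\<Union>n. F ` (D \<inter> A n))" by (intro negligible_countable_Union) auto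
  moreover have "F ` D \<subseteq> (\<Union>n. F ` (D \<inter> A n))" using assms(3) A(1) by blast
  ultimately show ?thesis by (rule negligible_subset)
qed

section \<open>Approximate derivatives\<close>

lemma eventually_at_right_0_less:
  fixes d :: real
  assumes "0 < d"
  shows "\<forall>\<^sub>F h in at_right 0. 0 < h \<and> h < d"
  unfolding eventually_at_right_field using assms by (intro exI[of _ d]) auto

lemma lmeasurable_Int_Icc:
  fixes E :: "real set"
  assumes "E \<in> sets lebesgue"
  shows "E \<inter> {a..b} \<in> lmeasurable"
  using fmeasurable_Int_fmeasurable[of "{a..b}" lebesgue E] assms by (simp add: Int_commute)

text \<open>If \<open>E\<close> missed the rightmost stretch of length \<open>q * h\<close>, its
  share of the window of length \<open>2 * h\<close> would stay at most \<open>1 - q / 2\<close>.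
  Density thereby supplies points of \<open>E\<close> at prescribed places to the right of
  \<open>x\<close>.\<close>

lemma density_point_upper:
  assumes E: "E \<in> sets lebesgue" and x: "density_point E x" and q: "0 < q" "q < 1"
  shows "\<forall>\<^sub>F h in at_right 0. \<exists>z\<in>E. x + (1 - q) * h \<le> z \<and> z \<le> x + h"
proof -
  have "\<forall>\<^sub>F h in at_right 0. 1 - q / 2 < measure lebesgue (E \<inter> {x - h..x + h}) / (2 * h)"
    using x q(1) unfolding density_point_def by (intro order_tendstoD(1)) auto
  moreover have "\<forall>\<^sub>F h in at_right (0::real). 0 < h"
    by (simp add: eventually_at_right_less)
  ultimately show ?thesis
  proof eventually_elim
    case (elim h)
    show ?case
    proof (rule ccontr)
      assume none: "\<not> ?thesis"
      have "E \<inter> {x - h..x + h} \<subseteq> {x - h..x + (1 - q) * h}"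
      proof
        fix z assume "z \<in> E \<inter> {x - h..x + h}"
        then show "z \<in> {x - h..x + (1 - q) * h}" using none by force
      qed
      then have "measure lebesgue (E \<inter> {x - h..x + h}) \<le> measure lebesgue {x - h..x + (1 - q) * h}"
        using E by (intro measure_mono_fmeasurable) auto
      also have "\<dots> = 2 * h - q * h" using elim(2) q mult_strict_right_mono[OF q(2) elim(2)]
        by (simp add: algebra_simps)
      finally have "measure lebesgue (E \<inter> {x - h..x + h}) / (2 * h) \<le> 1 - q / 2"
        using elim(2) by (simp add: field_simps)
      with elim(1) show False by simp
    qed
  qed
qed

text \<open>Inclusion-exclusion inside the window: the share of the intersection is at least the sum
  of both shares minus one. It supplies the common set needed for adding approximate
  derivatives.\<close>

lemma density_point_Int:
  assumes E: "E \<in> sets lebesgue" "E' \<in> sets lebesgue"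
    and x: "density_point E x" "density_point E' x"
  shows "density_point (E \<inter> E') x"
  unfolding density_point_def
proof (rule tendsto_sandwich)
  let ?m = "\<lambda>E h. measure lebesgue (E \<inter> {x - h..x + h}) / (2 * h)"
  have pos: "\<forall>\<^sub>F h in at_right (0::real). 0 < h"
    by (simp add: eventually_at_right_less)
  show "\<forall>\<^sub>F h in at_right 0. ?m E h + ?m E' h - 1 \<le> ?m (E \<inter> E') h"
    using pos
  proof eventually_elim
    case (elim h)
    let ?I = "{x - h..x + h}"
    have m: "E \<inter> ?I \<in> lmeasurable" "E' \<inter> ?I \<in> lmeasurable"
      by (intro lmeasurable_Int_Icc E)+
    have "measure lebesgue (E \<inter> ?I) + measure lebesgue (E' \<inter> ?I)
        = measure lebesgue (E \<inter> ?I \<union> E' \<inter> ?I) + measure lebesgue ((E \<inter> ?I) \<inter> (E' \<inter> ?I))"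
      using measure_Un3[OF m] by simp
    also have "measure lebesgue (E \<inter> ?I \<union> E' \<inter> ?I) \<le> measure lebesgue ?I"
      using fmeasurable.Un[OF m] by (intro measure_mono_fmeasurable) (auto dest: fmeasurableD)
    also have "measure lebesgue ?I = 2 * h" using elim by simp
    also have "(E \<inter> ?I) \<inter> (E' \<inter> ?I) = (E \<inter> E') \<inter> ?I" by blast
    finally have "(measure lebesgue (E \<inter> ?I) + measure lebesgue (E' \<inter> ?I) - 2 * h) / (2 * h)
        \<le> measure lebesgue ((E \<inter> E') \<inter> ?I) / (2 * h)"
      using elim by (intro divide_right_mono) auto
    then show ?case using elim by (simp add: add_divide_distrib diff_divide_distrib)
  qed
  show "\<forall>\<^sub>F h in at_right 0. ?m (E \<inter> E') h \<le> ?m E h"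
    using pos
  proof eventually_elim
    case (elim h)
    have "measure lebesgue ((E \<inter> E') \<inter> {x - h..x + h}) \<le> measure lebesgue (E \<inter> {x - h..x + h})"
      using E by (intro measure_mono_fmeasurable lmeasurable_Int_Icc) auto
    then show ?case using elim by (simp add: divide_right_mono)
  qed
  have "((\<lambda>h. ?m E h + ?m E' h - 1) \<longlongrightarrow> 1 + 1 - 1) (at_right 0)"
    using x unfolding density_point_def by (intro tendsto_intros)
  then show "((\<lambda>h. ?m E h + ?m E' h - 1) \<longlongrightarrow> 1) (at_right 0)" by simp
  show "((\<lambda>h. ?m E h) \<longlongrightarrow> 1) (at_right 0)" using x(1) unfolding density_point_def .
qed

lemma has_approx_derivative_add:
  assumes "has_approx_derivative F l x" "has_approx_derivative G m x"
  shows "has_approx_derivative (\<lambda>x. F x + G x) (l + m) x"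
proof -
  obtain E where E: "E \<in> sets lebesgue" "E \<subseteq> {0..1}" "density_point E x"
    "(F has_real_derivative l) (at x within E)"
    using assms(1) unfolding has_approx_derivative_def by blast
  obtain E' where E': "E' \<in> sets lebesgue" "E' \<subseteq> {0..1}" "density_point E' x"
    "(G has_real_derivative m) (at x within E')"
    using assms(2) unfolding has_approx_derivative_def by blast
  have "((\<lambda>x. F x + G x) has_real_derivative l + m) (at x within E \<inter> E')"
    using E(4) E'(4) by (intro DERIV_add) (auto intro: DERIV_subset)
  then show ?thesis
    unfolding has_approx_derivative_def using E E' density_point_Int[OF E(1) E'(1) E(3) E'(3)]
    by (intro bexI[of _ "E \<inter> E'"]) auto
qed

lemma has_approx_derivative_uminus:
  "has_approx_derivative F l x \<Longrightarrow> has_approx_derivative (\<lambda>x. - F x) (- l) x"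
  unfolding has_approx_derivative_def by (auto intro: DERIV_minus)

text \<open>The endpoints are left out because \<open>density_point\<close> is two-sided: a subset
  of \<open>{0..1}\<close> has density at most 1/2 at 0 and at 1.\<close>

lemma has_approx_derivative_of_derivative:
  assumes F: "(F has_real_derivative l) (at x)" and x: "x \<in> {0<..<1}"
  shows "has_approx_derivative F l x"
proof -
  have "\<forall>\<^sub>F h in at_right (0::real). 0 < h \<and> h < min x (1 - x)"
    using x by (intro eventually_at_right_0_less) auto
  then have "\<forall>\<^sub>F h in at_right 0. measure lebesgue ({0..1} \<inter> {x - h..x + h}) / (2 * h) = 1"
  proof eventually_elim
    case (elim h)
    then have "{0..1} \<inter> {x - h..x + h} = {x - h..x + h}" by auto
    then show ?case using elim by simp
  qed
  then have "density_point {0..1} x"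
    unfolding density_point_def by (rule tendsto_eventually)
  then show ?thesis
    unfolding has_approx_derivative_def using F
    by (intro bexI[of _ "{0..1}"]) (auto intro: has_field_derivative_at_within)
qed

text \<open>The classical argument: a strictly negative increment of \<open>F\<close> leaves room for a level \<open>y\<close>
  outside the null image of the exceptional set, and the derivative cannot be positive at the last
  point where the level \<open>y\<close> is attained.\<close>

lemma ACG_increasing_of_pos:
  assumes F: "ACG F"
    and D: "negligible D" "D \<subseteq> {0..1}"
    and pos: "\<And>x. x \<in> {0..1} - D \<Longrightarrow> \<exists>l>0. has_approx_derivative F l x"
    and ab: "0 \<le> a" "a \<le> b" "b \<le> 1"
  shows "F a \<le> F b"
proof (rule ccontr)
  assume "\<not> ?thesis"
  then have less: "F b < F a" by simp
  have cont: "continuous_on {0..1} F" using F by (simp add: ACG_def)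
  have "\<not> negligible {F b<..<F a}" using less by (simp add: open_not_negligible)
  then obtain y where y: "F b < y" "y < F a" "y \<notin> F ` D"
    using negligible_image_ACG[OF F D] negligible_subset
    by (metis greaterThanLessThan_iff subsetI)
  define S where "S = {z \<in> {a..b}. y \<le> F z}"
  have cab: "continuous_on {a..b} F" by (rule continuous_on_subset[OF cont]) (use ab in auto)
  have "closed S" unfolding S_def
    using continuous_on_closed_Collect_le[OF continuous_on_const cab closed_atLeastAtMost, of y] by simp
  then have "compact S" by (auto simp: S_def compact_eq_bounded_closed intro: bounded_subset[of "{a..b}"])
  moreover have "S \<noteq> {}" using y ab by (auto simp: S_def)
  ultimately obtain x where x: "x \<in> S" "\<And>z. z \<in> S \<Longrightarrow> z \<le> x"
    using compact_attains_sup[of S] by metis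
  have xb: "a \<le> x" "x < b" "y \<le> F x" using x(1) y(1) by (auto simp: S_def less_le)
  have "F x = y"
  proof (rule ccontr)
    assume "F x \<noteq> y"
    have "continuous_on {x..b} F" by (rule continuous_on_subset[OF cab]) (use xb in auto)
    then obtain z where z: "x \<le> z" "z \<le> b" "F z = y"
      using IVT2'[of F b y x] xb y(1) by auto
    then have "z \<in> S" using xb by (auto simp: S_def)
    then show False using x(2)[of z] z \<open>F x \<noteq> y\<close> by auto
  qed
  then have "x \<in> {0..1} - D" using y(3) xb ab by auto
  then obtain l E where l: "l > 0" and E: "E \<in> sets lebesgue" "E \<subseteq> {0..1}" "density_point E x"
    "(F has_real_derivative l) (at x within E)"
    using pos unfolding has_approx_derivative_def by blast
  obtain d where d: "d > 0" "\<And>h. 0 < h \<Longrightarrow> x + h \<in> E \<Longrightarrow> h < d \<Longrightarrow> F x < F (x + h)"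
    using has_real_derivative_pos_inc_right[OF E(4) l] by blast
  have "\<forall>\<^sub>F h in at_right (0::real). 0 < h \<and> h < min d (b - x)"
    using d(1) xb by (intro eventually_at_right_0_less) auto
  then have "\<forall>\<^sub>F h in at_right (0::real). False"
    using density_point_upper[OF E(1) E(3), of "1/2", simplified]
  proof eventually_elim
    case (elim h)
    then obtain z where z: "z \<in> E" "x + h / 2 \<le> z" "z \<le> x + h" by auto
    then have "F x < F z" using d(2)[of "z - x"] elim by auto
    moreover have "z \<notin> S" using x(2)[of z] z elim by auto
    then have "F z < y" using z elim xb by (auto simp: S_def)
    ultimately show False using \<open>F x = y\<close> by simp
  qed
  then show False by (simp add: eventually_False)
qed

lemma AC_on_linear: "AC_on (\<lambda>x. c * x) E"
  unfolding AC_on_iff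
proof (intro allI impI)
  fix e :: real assume e: "e > 0"
  show "\<exists>d>0. \<forall>P. nonoverlapping_family E d P \<longrightarrow> (\<Sum>(u, v)\<in>P. \<bar>c * v - c * u\<bar>) < e"
  proof (intro exI[of _ "e / (\<bar>c\<bar> + 1)"] conjI allI impI)
    show "0 < e / (\<bar>c\<bar> + 1)" using e by (simp add: field_simps add_pos_nonneg)
    fix P assume P: "nonoverlapping_family E (e / (\<bar>c\<bar> + 1)) P"
    have "\<bar>c * v - c * u\<bar> \<le> (\<bar>c\<bar> + 1) * (v - u)" if "(u, v) \<in> P" for u v
    proof -
      have "u < v" using P that by (auto simp: nonoverlapping_family_def)
      then show ?thesis by (simp add: right_diff_distrib[symmetric] abs_mult mult_right_mono)
    qed
    then have "(\<Sum>(u, v)\<in>P. \<bar>c * v - c * u\<bar>) \<le> (\<bar>c\<bar> + 1) * (\<Sum>(u, v)\<in>P. v - u)"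
      unfolding sum_distrib_left by (intro sum_mono) auto
    also have "\<dots> < (\<bar>c\<bar> + 1) * (e / (\<bar>c\<bar> + 1))"
      using P by (intro mult_strict_left_mono) (auto simp: nonoverlapping_family_def)
    also have "\<dots> = e" by simp
    finally show "(\<Sum>(u, v)\<in>P. \<bar>c * v - c * u\<bar>) < e" .
  qed
qed

text \<open>Adding \<open>e * x\<close> makes the approximate derivatives strictly positive at a
  cost of at most \<open>e\<close>. The endpoints join the exceptional set since
  \<open>e * x\<close> has an approximate derivative in the present sense only at interior
  points.\<close>

lemma ACG_increasing:
  assumes F: "ACG F"
    and D: "negligible D" "D \<subseteq> {0..1}"
    and nonneg: "\<And>x. x \<in> {0..1} - D \<Longrightarrow> \<exists>l\<ge>0. has_approx_derivative F l x"
    and ab: "0 \<le> a" "a \<le> b" "b \<le> 1"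
  shows "F a \<le> F b"
proof (rule field_le_epsilon)
  fix e :: real assume e: "0 < e"
  let ?G = "\<lambda>x. F x + e * x"
  have "ACG (\<lambda>x. e * x)"
    by (rule ACG_I[of _ "\<lambda>_. {0..1}"]) (auto intro: AC_on_linear continuous_intros)
  then have G: "ACG ?G" using F by (intro ACG_add)
  have "negligible (D \<union> {0, 1})" using D(1) by (intro negligible_Un) auto
  then have "?G a \<le> ?G b"
  proof (rule ACG_increasing_of_pos[OF G])
    show "D \<union> {0, 1} \<subseteq> {0..1}" using D(2) by auto
    fix x :: real assume x: "x \<in> {0..1} - (D \<union> {0, 1})"
    then obtain l where l: "l \<ge> 0" "has_approx_derivative F l x" using nonneg by blast
    have "((\<lambda>x. e * x) has_real_derivative e) (at x)"
      by (auto intro!: derivative_eq_intros)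
    then have "has_approx_derivative (\<lambda>x. e * x) e x"
      using x by (intro has_approx_derivative_of_derivative) auto
    with l(2) have "has_approx_derivative ?G (l + e) x" by (rule has_approx_derivative_add)
    then show "\<exists>l>0. has_approx_derivative ?G l x" using l(1) e by (intro exI[of _ "l + e"]) auto
  qed (use ab in auto)
  moreover have "e * b - e * a \<le> e * 1"
    unfolding right_diff_distrib[symmetric] using ab e by (intro mult_left_mono) auto
  ultimately show "F a \<le> F b + e" by simp
qed

text \<open>Monotonicity upgrades the approximate derivative to a genuine right derivative:
  \<open>x + h\<close> is caught between points \<open>z\<close> and \<open>w\<close> of
  \<open>E\<close> whose distances from \<open>x\<close> differ from \<open>h\<close> by at most
  \<open>q * h\<close>, and \<open>F (x + h)\<close> lies between \<open>F z\<close> and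
  \<open>F w\<close>.\<close>

lemma approx_derivative_monotone_quotient:
  assumes mono: "mono_on {0..1} F" and F: "has_approx_derivative F l x" and x: "x \<in> {0..<1}"
  shows "((\<lambda>h. (F (x + h) - F x) / h) \<longlongrightarrow> l) (at_right 0)"
proof -
  obtain E where E: "E \<in> sets lebesgue" "E \<subseteq> {0..1}" "density_point E x"
    "(F has_real_derivative l) (at x within E)"
    using F unfolding has_approx_derivative_def by blast
  have quot: "\<forall>q>0. \<exists>d>0. \<forall>z. z \<in> E \<and> x < z \<and> z < x + d \<longrightarrow> \<bar>(F z - F x) - l * (z - x)\<bar> \<le> q * (z - x)"
  proof (intro allI impI)
    fix q :: real assume q: "q > 0"
    have "((\<lambda>y. (F y - F x) / (y - x)) \<longlongrightarrow> l) (at x within E)"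
      using E(4) by (simp add: has_field_derivative_iff)
    then have "\<forall>\<^sub>F y in at x within E. dist ((F y - F x) / (y - x)) l < q"
      using q by (rule tendstoD)
    then obtain d where d: "d > 0" "\<And>y. y \<in> E \<Longrightarrow> y \<noteq> x \<Longrightarrow> dist y x < d \<Longrightarrow> dist ((F y - F x) / (y - x)) l < q"
      unfolding eventually_at by blast
    have "\<bar>(F z - F x) - l * (z - x)\<bar> \<le> q * (z - x)" if z: "z \<in> E" "x < z" "z < x + d" for z
    proof -
      have "\<bar>(F z - F x) / (z - x) - l\<bar> * (z - x) \<le> q * (z - x)"
        using d(2)[of z] z by (intro mult_right_mono) (auto simp: dist_real_def)
      moreover have "\<bar>(F z - F x) / (z - x) - l\<bar> * (z - x) = \<bar>((F z - F x) / (z - x) - l) * (z - x)\<bar>"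
        using z by (simp add: abs_mult)
      moreover have "((F z - F x) / (z - x) - l) * (z - x) = (F z - F x) - l * (z - x)"
        using z by (subst left_diff_distrib) simp
      ultimately show ?thesis by simp
    qed
    then show "\<exists>d>0. \<forall>z. z \<in> E \<and> x < z \<and> z < x + d \<longrightarrow> \<bar>(F z - F x) - l * (z - x)\<bar> \<le> q * (z - x)"
      using d(1) by blast
  qed
  have bounds: "\<forall>\<^sub>F h in at_right 0. (l - q) * (1 - q) \<le> (F (x + h) - F x) / h
      \<and> (F (x + h) - F x) / h \<le> (l + q) * (1 + q)" if q: "0 < q" "q < 1" for q
  proof -
    obtain d where d: "d > 0"
      "\<And>z. z \<in> E \<Longrightarrow> x < z \<Longrightarrow> z < x + d \<Longrightarrow> \<bar>(F z - F x) - l * (z - x)\<bar> \<le> q * (z - x)"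
      using quot q(1) by blast
    \<comment> \<open>Chosen so that \<open>(1 - r) * (1 + q) = 1\<close>: the density lemma at
      scale \<open>(1 + q) * h\<close> then gives a point of \<open>E\<close> in
      \<open>{x + h..x + (1 + q) * h}\<close>.\<close>
    define r where "r = q / (1 + q)"
    have r: "0 < r" "r < 1" "(1 - r) * (1 + q) = 1" using q by (auto simp: r_def field_simps)
    have "filterlim (\<lambda>h. (1 + q) * h) (at_right 0) (at_right (0::real))"
      using q unfolding filterlim_at
      by (auto intro!: tendsto_eq_intros eventually_at_right_less[THEN eventually_mono] simp: eventually_at_filter)
    from eventually_compose_filterlim[OF density_point_upper[OF E(1,3) r(1,2)] this]
    have up: "\<forall>\<^sub>F h in at_right 0. \<exists>z\<in>E. x + h \<le> z \<and> z \<le> x + (1 + q) * h"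
      using r(3) by (simp add: mult.assoc[symmetric])
    have "0 < min (d / 2) ((1 - x) / 2)" using d(1) x by simp
    from eventually_at_right_0_less[OF this] density_point_upper[OF E(1,3) q] up show ?thesis
    proof eventually_elim
      case (elim h)
      then have h: "0 < h" "2 * h < d" "x + 2 * h < 1" by auto
      have qh: "q * h < h" using q h by simp
      obtain z where z: "z \<in> E" "x + (1 - q) * h \<le> z" "z \<le> x + h" using elim by blast
      obtain w where w: "w \<in> E" "x + h \<le> w" "w \<le> x + (1 + q) * h" using elim by blast
      have z0: "x < z" using z(2) q h by (smt (verit) mult_pos_pos)
      have wd: "w < x + 2 * h" using w(3) qh by (simp add: algebra_simps)
      have Fz: "F z \<le> F (x + h)" and Fw: "F (x + h) \<le> F w" and F0: "F x \<le> F (x + h)"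
        using z0 z w wd h x by (auto intro!: mono_onD[OF mono])
      have lz: "(l - q) * (z - x) \<le> F z - F x"
        using d(2)[OF z(1)] z0 z h by (simp add: abs_le_iff algebra_simps)
      have uw: "F w - F x \<le> (l + q) * (w - x)"
        using d(2)[OF w(1)] w wd h by (simp add: abs_le_iff algebra_simps)
      have "(l - q) * (1 - q) * h \<le> F (x + h) - F x"
      proof (cases "l - q \<ge> 0")
        case True
        have "(l - q) * ((1 - q) * h) \<le> (l - q) * (z - x)" using True z(2) by (intro mult_left_mono) auto
        then show ?thesis using lz Fz by (simp add: mult.assoc)
      next
        case False
        then have "(l - q) * ((1 - q) * h) \<le> 0" using q h by (intro mult_nonpos_nonneg) auto
        then show ?thesis using F0 by (simp add: mult.assoc)
      qed
      moreover have "F (x + h) - F x \<le> (l + q) * (1 + q) * h"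
      proof -
        have "0 \<le> (l + q) * (w - x)" using uw F0 Fw by linarith
        then have "0 \<le> l + q" using w h by (auto simp: zero_le_mult_iff)
        then have "(l + q) * (w - x) \<le> (l + q) * ((1 + q) * h)" using w(3) by (intro mult_left_mono) auto
        then show ?thesis using uw Fw by (simp add: mult.assoc)
      qed
      ultimately show ?case using h by (simp add: pos_le_divide_eq pos_divide_le_eq)
    qed
  qed
  show ?thesis
  proof (rule tendstoI)
    fix e :: real assume e: "0 < e"
    \<comment> \<open>Expanding the products \<open>(l + q) * (1 + q)\<close> and
      \<open>(l - q) * (1 - q)\<close> shows a deviation from \<open>l\<close> of at most
      \<open>q * (\<bar>l\<bar> + 2)\<close>.\<close>
    define q where "q = min (1/2) (e / (2 * (\<bar>l\<bar> + 2)))"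
    have q: "0 < q" "q < 1" using e by (auto simp: q_def)
    have "q * (\<bar>l\<bar> + 2) \<le> e / (2 * (\<bar>l\<bar> + 2)) * (\<bar>l\<bar> + 2)" by (intro mult_right_mono) (auto simp: q_def)
    also have "\<dots> = e / 2" by (simp add: field_simps add_nonneg_eq_0_iff)
    finally have ql: "q * (\<bar>l\<bar> + 2) < e" using e by linarith
    have "q * l \<le> q * \<bar>l\<bar>" "- (q * l) \<le> q * \<bar>l\<bar>" "q * q \<le> q * 1"
      using q by (auto simp: abs_if mult_left_mono mult_le_0_iff zero_le_mult_iff)
    have "(l + q) * (1 + q) < l + e" "l - e < (l - q) * (1 - q)"
    proof -
      have exp: "(l + q) * (1 + q) = l + q * l + q + q * q" "(l - q) * (1 - q) = l - q * l - q + q * q"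
        by (simp_all add: algebra_simps)
      have "q * \<bar>l\<bar> + 2 * q < e" using ql by (simp add: distrib_left mult.commute)
      moreover have "0 \<le> q * q" using q by simp
      ultimately show "(l + q) * (1 + q) < l + e" "l - e < (l - q) * (1 - q)"
        using q(1) \<open>q * l \<le> q * \<bar>l\<bar>\<close> \<open>- (q * l) \<le> q * \<bar>l\<bar>\<close> \<open>q * q \<le> q * 1\<close>
        unfolding exp mult_1_right by linarith+
    qed
    with bounds[OF q] show "\<forall>\<^sub>F h in at_right 0. dist ((F (x + h) - F x) / h) l < e"
      by (auto elim!: eventually_mono simp: dist_real_def abs_less_iff)
  qed
qed

section \<open>Denjoy primitives\<close>

lemma integrable_lebesgue_on_iff:
  fixes f :: "'a::euclidean_space \<Rightarrow> 'b::{banach, second_countable_topology}"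
  assumes "S \<in> sets lebesgue"
  shows "integrable (lebesgue_on S) f \<longleftrightarrow> f absolutely_integrable_on S"
  using assms by (simp add: set_integrable_def integrable_restrict_space)

lemma sum_integral_nonoverlapping_le:
  fixes h :: "real \<Rightarrow> real"
  assumes h: "h integrable_on {0..1}" "\<And>t. t \<in> {0..1} \<Longrightarrow> 0 \<le> h t"
    and P: "nonoverlapping_family {0..1} d P"
  shows "(\<Sum>(u, v)\<in>P. integral {u..v} h) \<le> integral {0..1} h"
proof -
  have Pmem: "0 \<le> u" "u < v" "v \<le> 1" if "(u, v) \<in> P" for u v
    using P that by (auto simp: nonoverlapping_family_def)
  have fin: "finite P" using P by (simp add: nonoverlapping_family_def)
  define I where "I = (\<lambda>(u, v). {u..v :: real})"
  have inj: "inj_on I P"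
  proof (rule inj_onI)
    fix p p' assume "p \<in> P" "p' \<in> P" "I p = I p'"
    then show "p = p'"
      using Pmem[of "fst p" "snd p"] Pmem[of "fst p'" "snd p'"] by (auto simp: I_def split_beta prod_eq_iff)
  qed
  have "(h has_integral (\<Sum>S\<in>I ` P. integral S h)) (\<Union>(I ` P))"
  proof (rule has_integral_Union)
    show "finite (I ` P)" using fin by simp
    fix S assume "S \<in> I ` P"
    then obtain u v where uv: "(u, v) \<in> P" "S = {u..v}" by (auto simp: I_def)
    have "h integrable_on {u..v}"
      by (rule integrable_on_subinterval[OF h(1)]) (use Pmem[OF uv(1)] in auto)
    then show "(h has_integral integral S h) S" using uv(2) by (simp add: integrable_integral)
  next
    show "pairwise (\<lambda>S S'. negligible (S \<inter> S')) (I ` P)"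
      unfolding pairwise_def
    proof (intro ballI impI)
      fix S S' assume S: "S \<in> I ` P" "S' \<in> I ` P" "S \<noteq> S'"
      then obtain p p' where p: "p \<in> P" "S = I p" "p' \<in> P" "S' = I p'" "p \<noteq> p'" by blast
      have "(fst p, snd p) \<noteq> (fst p', snd p')" using p(5) by (simp add: prod_eq_iff)
      then have "{fst p<..<snd p} \<inter> {fst p'<..<snd p'} = {}"
        using P p(1,3) unfolding nonoverlapping_family_def split_beta by blast
      then have "S \<inter> S' \<subseteq> {fst p, snd p, fst p', snd p'}"
        unfolding p(2,4) I_def split_beta by (auto simp del: min.bounded_iff)
      then show "negligible (S \<inter> S')" by (rule negligible_subset[rotated]) simp
    qed
  qed
  then have U: "h integrable_on \<Union>(I ` P)" "integral (\<Union>(I ` P)) h = (\<Sum>S\<in>I ` P. integral S h)"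
    by (auto simp: has_integral_iff)
  have "(\<Sum>(u, v)\<in>P. integral {u..v} h) = (\<Sum>S\<in>I ` P. integral S h)"
    unfolding sum.reindex[OF inj] by (intro sum.cong) (auto simp: I_def)
  also have "\<dots> \<le> integral {0..1} h"
    unfolding U(2)[symmetric]
  proof (rule integral_subset_le[OF _ U(1) h(1)])
    show "\<Union>(I ` P) \<subseteq> {0..1}"
    proof
      fix t assume "t \<in> \<Union>(I ` P)"
      then obtain u v where "(u, v) \<in> P" "u \<le> t" "t \<le> v" by (auto simp: I_def)
      then show "t \<in> {0..1}" using Pmem[of u v] by auto
    qed
  qed (use h in auto)
  finally show ?thesis .
qed

text \<open>Truncation: \<open>\<bar>g\<bar>\<close> is a function bounded by \<open>n\<close> plus
  a remainder \<open>r\<close> of integral below \<open>e / 2\<close>. The bounded part contributes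
  at most \<open>n\<close> times the total length, the remainder at most its whole integral,
  whatever the family.\<close>

lemma AC_on_integral:
  fixes g :: "real \<Rightarrow> real"
  assumes g: "g absolutely_integrable_on {0..1}"
  shows "AC_on (\<lambda>x. integral {0..x} g) {0..1}"
  unfolding AC_on_iff
proof (intro allI impI)
  fix e :: real assume e: "e > 0"
  define k where "k n t = min \<bar>g t\<bar> (real n)" for n t
  have ga: "(\<lambda>t. \<bar>g t\<bar>) absolutely_integrable_on {0..1}"
    using g by (rule set_integrable_abs)
  have ka: "k n absolutely_integrable_on {0..1}" for n
    unfolding k_def by (intro absolutely_integrable_min_1 ga) auto
  have kint: "k n integrable_on {0..1}" for n using ka by (rule set_lebesgue_integral_eq_integral(1))
  have gint: "g integrable_on {0..1}" using g by (rule set_lebesgue_integral_eq_integral(1))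
  have gaint: "(\<lambda>t. \<bar>g t\<bar>) integrable_on {0..1}" using ga by (rule set_lebesgue_integral_eq_integral(1))
  have "(\<lambda>n. integral {0..1} (k n)) \<longlonglongrightarrow> integral {0..1} (\<lambda>t. \<bar>g t\<bar>)"
  proof (rule dominated_convergence(2)[OF kint gaint])
    show "norm (k n t) \<le> \<bar>g t\<bar>" for n t by (auto simp: k_def)
    show "(\<lambda>n. k n t) \<longlonglongrightarrow> \<bar>g t\<bar>" for t
    proof (rule tendsto_eventually)
      obtain N where "\<bar>g t\<bar> \<le> real N" using real_arch_simple by blast
      then show "\<forall>\<^sub>F n in sequentially. k n t = \<bar>g t\<bar>"
        by (intro eventually_sequentiallyI[of N]) (auto simp: k_def)
    qed
  qed
  then have "\<forall>\<^sub>F n in sequentially. dist (integral {0..1} (k n)) (integral {0..1} (\<lambda>t. \<bar>g t\<bar>)) < e / 2"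
    using e by (intro tendstoD) auto
  then obtain n where n: "dist (integral {0..1} (k n)) (integral {0..1} (\<lambda>t. \<bar>g t\<bar>)) < e / 2"
    by (auto simp: eventually_sequentially)
  define r where "r t = \<bar>g t\<bar> - k n t" for t
  have rint: "r integrable_on {0..1}" unfolding r_def by (intro integrable_diff gaint kint)
  have "integral {0..1} r = integral {0..1} (\<lambda>t. \<bar>g t\<bar>) - integral {0..1} (k n)"
    unfolding r_def by (intro Henstock_Kurzweil_Integration.integral_diff gaint kint)
  then have rsmall: "integral {0..1} r < e / 2" using n unfolding dist_real_def by linarith
  \<comment> \<open>The summand 1 keeps the quotient meaningful when \<open>n = 0\<close>.\<close>
  define d where "d = e / (2 * (real n + 1))"
  show "\<exists>d>0. \<forall>P. nonoverlapping_family {0..1} d P \<longrightarrow>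
      (\<Sum>(u, v)\<in>P. \<bar>integral {0..v} g - integral {0..u} g\<bar>) < e"
  proof (intro exI[of _ d] conjI allI impI)
    show "0 < d" using e by (simp add: d_def)
    fix P assume P: "nonoverlapping_family {0..1} d P"
    have "\<bar>integral {0..v} g - integral {0..u} g\<bar> \<le> (real n + 1) * (v - u) + integral {u..v} r"
      if "(u, v) \<in> P" for u v
    proof -
      have uv: "0 \<le> u" "u < v" "v \<le> 1" using P that by (auto simp: nonoverlapping_family_def)
      then have sub: "{u..v} \<subseteq> {0..1}" by auto
      have i: "g integrable_on {u..v}" "r integrable_on {u..v}" "(\<lambda>t. \<bar>g t\<bar>) integrable_on {u..v}"
        using gint rint gaint sub by (auto intro: integrable_on_subinterval)
      have "\<bar>integral {0..v} g - integral {0..u} g\<bar> = norm (integral {u..v} g)"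
        using integral_difference[OF gint, of u v] uv by simp
      also have "\<dots> \<le> integral {u..v} (\<lambda>t. real n + r t)"
      proof (rule integral_norm_bound_integral[OF i(1)])
        show "(\<lambda>t. real n + r t) integrable_on {u..v}"
          using i(2) by (intro integrable_add) auto
      qed (auto simp: r_def k_def)
      also have "\<dots> = real n * (v - u) + integral {u..v} r"
        using i(2) uv by (subst Henstock_Kurzweil_Integration.integral_add) auto
      also have "\<dots> \<le> (real n + 1) * (v - u) + integral {u..v} r"
        using uv by (intro add_right_mono mult_right_mono) auto
      finally show ?thesis .
    qed
    then have "(\<Sum>(u, v)\<in>P. \<bar>integral {0..v} g - integral {0..u} g\<bar>)
        \<le> (\<Sum>(u, v)\<in>P. (real n + 1) * (v - u) + integral {u..v} r)"
      by (intro sum_mono) auto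
    also have "\<dots> = (real n + 1) * (\<Sum>(u, v)\<in>P. v - u) + (\<Sum>(u, v)\<in>P. integral {u..v} r)"
      by (simp add: split_beta sum.distrib sum_distrib_left)
    also have "\<dots> < (real n + 1) * d + e / 2"
    proof (rule add_less_le_mono)
      show "(real n + 1) * (\<Sum>(u, v)\<in>P. v - u) < (real n + 1) * d"
        using P by (intro mult_strict_left_mono) (auto simp: nonoverlapping_family_def)
      have "(\<Sum>(u, v)\<in>P. integral {u..v} r) \<le> integral {0..1} r"
        by (rule sum_integral_nonoverlapping_le[OF rint _ P]) (simp add: r_def k_def)
      then show "(\<Sum>(u, v)\<in>P. integral {u..v} r) \<le> e / 2" using rsmall by simp
    qed
    also have "(real n + 1) * d + e / 2 = e"
    proof -
      have "(real n + 1) * d = e / 2" unfolding d_def by (simp add: field_simps)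
      then show ?thesis by simp
    qed
    finally show "(\<Sum>(u, v)\<in>P. \<bar>integral {0..v} g - integral {0..u} g\<bar>) < e" .
  qed
qed

lemma denjoy_primitiveI:
  assumes "ACG F" "negligible N"
    and "\<And>t. t \<in> {0..1} - N \<Longrightarrow> \<exists>l. has_approx_derivative F l t \<and> f t = ereal l"
  shows "denjoy_primitive f F"
proof -
  have "negligible {t \<in> {0..1}. \<not> (\<exists>l. has_approx_derivative F l t \<and> f t = ereal l)}"
    using assms(2) by (rule negligible_subset) (use assms(3) in blast)
  then show ?thesis
    unfolding denjoy_primitive_def using assms(1) by (simp add: AE_lebesgue_on_iff_negligible)
qed

lemma denjoy_primitiveE:
  assumes "denjoy_primitive f F"
  obtains N where "ACG F" "negligible N"
    "\<And>t. t \<in> {0..1} - N \<Longrightarrow> \<exists>l. has_approx_derivative F l t \<and> f t = ereal l"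
proof (rule that)
  show "ACG F" using assms by (simp add: denjoy_primitive_def)
  show "negligible {t \<in> {0..1}. \<not> (\<exists>l. has_approx_derivative F l t \<and> f t = ereal l)}"
    using assms by (simp add: denjoy_primitive_def AE_lebesgue_on_iff_negligible)
qed blast

lemma denjoy_primitive_cong_negligible:
  assumes f: "denjoy_primitive f F" and "negligible N" "\<And>t. t \<in> {0..1} - N \<Longrightarrow> g t = f t"
  shows "denjoy_primitive g F"
proof -
  obtain N' where N': "ACG F" "negligible N'"
    "\<And>t. t \<in> {0..1} - N' \<Longrightarrow> \<exists>l. has_approx_derivative F l t \<and> f t = ereal l"
    using denjoy_primitiveE[OF f] by blast
  show ?thesis
  proof (rule denjoy_primitiveI[OF N'(1)])
    show "negligible (N \<union> N')" using assms(2) N'(2) by (rule negligible_Un)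
    fix t :: real assume t: "t \<in> {0..1} - (N \<union> N')"
    then show "\<exists>l. has_approx_derivative F l t \<and> g t = ereal l"
      using N'(3)[of t] assms(3)[of t] by auto
  qed
qed

lemma denjoy_primitive_add:
  assumes f: "denjoy_primitive f F" and g: "denjoy_primitive g G"
  shows "denjoy_primitive (\<lambda>t. f t + g t) (\<lambda>x. F x + G x)"
proof -
  obtain N where N: "ACG F" "negligible N"
    "\<And>t. t \<in> {0..1} - N \<Longrightarrow> \<exists>l. has_approx_derivative F l t \<and> f t = ereal l"
    using denjoy_primitiveE[OF f] by blast
  obtain N' where N': "ACG G" "negligible N'"
    "\<And>t. t \<in> {0..1} - N' \<Longrightarrow> \<exists>l. has_approx_derivative G l t \<and> g t = ereal l"
    using denjoy_primitiveE[OF g] by blast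
  show ?thesis
  proof (rule denjoy_primitiveI)
    show "ACG (\<lambda>x. F x + G x)" using N(1) N'(1) by (rule ACG_add)
    show "negligible (N \<union> N')" using N(2) N'(2) by (rule negligible_Un)
    fix t :: real assume t: "t \<in> {0..1} - (N \<union> N')"
    then obtain l m where lm: "has_approx_derivative F l t" "f t = ereal l"
      "has_approx_derivative G m t" "g t = ereal m"
      using N(3)[of t] N'(3)[of t] by blast
    have "has_approx_derivative (\<lambda>x. F x + G x) (l + m) t"
      using lm(1,3) by (rule has_approx_derivative_add)
    then show "\<exists>l. has_approx_derivative (\<lambda>x. F x + G x) l t \<and> f t + g t = ereal l"
      using lm(2,4) by auto
  qed
qed

lemma denjoy_primitive_uminus:
  assumes f: "denjoy_primitive f F"
  shows "denjoy_primitive (\<lambda>t. - f t) (\<lambda>x. - F x)"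
proof -
  obtain N where N: "ACG F" "negligible N"
    "\<And>t. t \<in> {0..1} - N \<Longrightarrow> \<exists>l. has_approx_derivative F l t \<and> f t = ereal l"
    using denjoy_primitiveE[OF f] by blast
  show ?thesis
  proof (rule denjoy_primitiveI)
    show "ACG (\<lambda>x. - F x)" using N(1) by (rule ACG_uminus)
    show "negligible N" by (rule N(2))
    fix t :: real assume "t \<in> {0..1} - N"
    then obtain l where l: "has_approx_derivative F l t" "f t = ereal l" using N(3)[of t] by blast
    have "has_approx_derivative (\<lambda>x. - F x) (- l) t" using l(1) by (rule has_approx_derivative_uminus)
    then show "\<exists>l. has_approx_derivative (\<lambda>x. - F x) l t \<and> - f t = ereal l" using l(2) by auto
  qed
qed

lemma denjoy_primitive_integral:
  fixes g :: "real \<Rightarrow> real"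
  assumes g: "integrable (lebesgue_on {0..1}) g"
  shows "denjoy_primitive (\<lambda>t. ereal (g t)) (\<lambda>x. integral {0..x} g)"
proof -
  have ga: "g absolutely_integrable_on {0..1}" using g by (simp add: integrable_lebesgue_on_iff)
  then have gi: "g integrable_on {0..1}" by (rule set_lebesgue_integral_eq_integral(1))
  let ?B = "{x \<in> {0<..<1}. \<not> ((\<lambda>x. integral {0..x} g) has_real_derivative g x) (at x)}"
  show ?thesis
  proof (rule denjoy_primitiveI)
    show "ACG (\<lambda>x. integral {0..x} g)"
      by (rule ACG_I[of _ "\<lambda>_. {0..1}"])
        (auto intro: indefinite_integral_continuous_1[OF gi] AC_on_integral[OF ga])
    show "negligible (?B \<union> {0, 1})"
      by (intro negligible_Un negligible_not_differentiable_integral[OF gi]) auto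
    fix x :: real assume "x \<in> {0..1} - (?B \<union> {0, 1})"
    then have x: "x \<in> {0<..<1}" and "((\<lambda>x. integral {0..x} g) has_real_derivative g x) (at x)" by auto
    then show "\<exists>l. has_approx_derivative (\<lambda>x. integral {0..x} g) l x \<and> ereal (g x) = ereal l"
      using has_approx_derivative_of_derivative[OF _ x] by blast
  qed
qed

text \<open>After the shift of variable the integrals cancel except over windows of length
  \<open>h\<close> at the two ends, where \<open>K\<close> equals \<open>K 1\<close> and is at least
  \<open>K 0\<close>. The bound is uniform in \<open>h\<close>, as Fatou's lemma requires.\<close>

lemma integral_difference_quotient_le:
  fixes K :: "real \<Rightarrow> real"
  assumes mono: "mono K" and cont: "continuous_on UNIV K" and top: "\<And>x. 1 \<le> x \<Longrightarrow> K x = K 1"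
    and h: "0 < h" "h < 1"
  shows "integral {0..1} (\<lambda>t. (K (t + h) - K t) / h) \<le> K 1 - K 0"
proof -
  have ki: "K integrable_on {a..b}" for a b
    by (intro integrable_continuous_real continuous_on_subset[OF cont]) auto
  have sh: "(\<lambda>t. K (t + h)) integrable_on {0..1}"
    by (intro integrable_continuous_real continuous_on_compose2[OF cont] continuous_intros) auto
  have "integral {0..1} (\<lambda>t. K (t + h)) = integral {h..1 + h} K"
    using integral_shift_Icc_real[of 0 1 K h] by (simp add: o_def add.commute)
  also have "\<dots> = integral {h..1} K + integral {1..1 + h} K"
    using h by (intro Henstock_Kurzweil_Integration.integral_combine[symmetric] ki) auto
  also have "integral {1..1 + h} K = integral {1..1 + h} (\<lambda>_. K 1)"
    by (intro integral_cong top) simp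
  finally have 1: "integral {0..1} (\<lambda>t. K (t + h)) = integral {h..1} K + h * K 1"
    using h by simp
  have 2: "integral {0..1} K = integral {0..h} K + integral {h..1} K"
    using h by (intro Henstock_Kurzweil_Integration.integral_combine[symmetric] ki) auto
  have "integral {0..h} (\<lambda>_. K 0) \<le> integral {0..h} K"
    by (intro integral_le ki) (auto intro: monoD[OF mono])
  then have 3: "h * K 0 \<le> integral {0..h} K" using h by simp
  have "integral {0..1} (\<lambda>t. (K (t + h) - K t) / h)
      = (integral {0..1} (\<lambda>t. K (t + h)) - integral {0..1} K) / h"
    by (simp add: Henstock_Kurzweil_Integration.integral_diff[OF sh ki])
  also have "\<dots> \<le> (h * K 1 - h * K 0) / h"
    using 1 2 3 h by (intro divide_right_mono) auto
  also have "\<dots> = K 1 - K 0" using h by (simp add: right_diff_distrib[symmetric])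
  finally show ?thesis .
qed

lemma denjoy_primitive_nonneg_mono_on:
  assumes H: "denjoy_primitive w H" and N: "negligible N" "\<And>t. t \<in> {0..1} - N \<Longrightarrow> 0 \<le> w t"
  shows "mono_on {0..1} H"
proof (rule mono_onI)
  fix a b :: real assume ab: "a \<in> {0..1}" "b \<in> {0..1}" "a \<le> b"
  obtain N' where N': "ACG H" "negligible N'"
    "\<And>t. t \<in> {0..1} - N' \<Longrightarrow> \<exists>l. has_approx_derivative H l t \<and> w t = ereal l"
    using denjoy_primitiveE[OF H] by blast
  show "H a \<le> H b"
  proof (rule ACG_increasing[OF N'(1)])
    show "negligible ((N \<union> N') \<inter> {0..1})"
      using negligible_Un[OF N(1) N'(2)] by (rule negligible_subset) blast
    fix x :: real assume x: "x \<in> {0..1} - ((N \<union> N') \<inter> {0..1})"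
    then obtain l where l: "has_approx_derivative H l x" "w x = ereal l" using N'(3)[of x] by blast
    have "0 \<le> w x" using N(2)[of x] x by blast
    then show "\<exists>l\<ge>0. has_approx_derivative H l x" using l by auto
  qed (use ab in auto)
qed

text \<open>The primitive is monotone, so its difference quotients are nonnegative, have bounded
  integrals and converge almost everywhere to \<open>w\<close>; Fatou's lemma gives integrability.
  The value of the integral follows because \<open>H\<close> minus the Lebesgue primitive is a
  primitive of zero.\<close>

theorem denjoy_primitive_nonneg:
  assumes H: "denjoy_primitive w H" and N: "negligible N" "\<And>t. t \<in> {0..1} - N \<Longrightarrow> 0 \<le> w t"
  shows "integrable (lebesgue_on {0..1}) (\<lambda>t. real_of_ereal (w t))"
    and "\<And>a b. 0 \<le> a \<Longrightarrow> a \<le> b \<Longrightarrow> b \<le> 1 \<Longrightarrow> integral {a..b} (\<lambda>t. real_of_ereal (w t)) = H b - H a"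
proof -
  define g where "g t = real_of_ereal (w t)" for t
  let ?M = "lebesgue_on {0..1::real}"
  have mono: "mono_on {0..1} H" using H N by (rule denjoy_primitive_nonneg_mono_on)
  obtain N' where N': "ACG H" "negligible N'"
    "\<And>t. t \<in> {0..1} - N' \<Longrightarrow> \<exists>l. has_approx_derivative H l t \<and> w t = ereal l"
    using denjoy_primitiveE[OF H] by blast
  \<comment> \<open>Constant continuation beyond \<open>{0..1}\<close>, so that the quotient at
    \<open>t + h\<close> makes sense for \<open>t\<close> close to 1.\<close>
  define K where "K x = H (max 0 (min 1 x))" for x
  have "mono K" by (rule monoI) (auto simp: K_def intro!: mono_onD[OF mono])
  have contK: "continuous_on UNIV K"
    unfolding K_def
    by (rule continuous_on_compose2[of "{0..1}" H]) (use N'(1) in \<open>auto simp: ACG_def intro!: continuous_intros\<close>)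
  have K01: "K x = H x" if "x \<in> {0..1}" for x using that by (simp add: K_def)
  have Ktop: "K x = K 1" if "1 \<le> x" for x using that by (simp add: K_def)
  \<comment> \<open>The shift of the index by two keeps every step strictly below 1, as the integral
    bound demands.\<close>
  define h where "h n = inverse (real (Suc (Suc n)))" for n
  have h: "0 < h n" "h n < 1" for n by (auto simp: h_def inverse_eq_divide)
  have "h \<longlonglongrightarrow> 0" unfolding h_def using LIMSEQ_Suc[OF LIMSEQ_inverse_real_of_nat] .
  then have hlim: "filterlim h (at_right 0) sequentially"
  proof -
    have "h n \<noteq> 0" for n using h(1)[of n] by simp
    then show ?thesis using \<open>h \<longlonglongrightarrow> 0\<close> h(1) by (simp add: filterlim_at)
  qed
  define q where "q n t = (K (t + h n) - K t) / h n" for n t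
  have qnn: "0 \<le> q n t" for n t using h[of n] monoD[OF \<open>mono K\<close>, of t "t + h n"] by (simp add: q_def)
  have qcont: "continuous_on {0..1} (q n)" for n
    unfolding q_def using h(1)[of n]
    by (intro continuous_intros continuous_on_compose2[OF contK]) auto
  have qint: "integrable ?M (q n)" for n
    using absolutely_integrable_continuous_real[OF qcont] by (simp add: integrable_lebesgue_on_iff)
  have qle: "(\<integral>\<^sup>+t. ennreal (q n t) \<partial>?M) \<le> ennreal (K 1 - K 0)" for n
  proof -
    have "(\<integral>\<^sup>+t. ennreal (q n t) \<partial>?M) = ennreal (integral\<^sup>L ?M (q n))"
      using qint qnn by (intro nn_integral_eq_integral) auto
    also have "integral\<^sup>L ?M (q n) = integral {0..1} (q n)"
      using qint by (intro lebesgue_integral_eq_integral) auto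
    also have "\<dots> \<le> K 1 - K 0"
      unfolding q_def using \<open>mono K\<close> contK Ktop h by (rule integral_difference_quotient_le)
    finally show ?thesis by (simp add: ennreal_leI)
  qed
  have lim: "(\<lambda>n. q n t) \<longlonglongrightarrow> g t" if t: "t \<in> {0..1} - (N' \<union> {1})" for t
  proof -
    obtain l where l: "has_approx_derivative H l t" "w t = ereal l" using N'(3)[of t] t by blast
    have "((\<lambda>h. (H (t + h) - H t) / h) \<longlongrightarrow> l) (at_right 0)"
      using mono l(1) by (rule approx_derivative_monotone_quotient) (use t in auto)
    moreover have "\<forall>\<^sub>F h in at_right 0. (H (t + h) - H t) / h = (K (t + h) - K t) / h"
      using eventually_at_right_0_less[of "1 - t"] t by (auto elim!: eventually_mono simp: K01)
    ultimately have "((\<lambda>h. (K (t + h) - K t) / h) \<longlongrightarrow> l) (at_right 0)"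
      by (rule Lim_transform_eventually)
    from filterlim_compose[OF this hlim] show ?thesis by (simp add: q_def g_def l(2))
  qed
  have negN: "negligible (N' \<union> {1})" using N'(2) by (intro negligible_Un) auto
  have AE: "AE t in ?M. (\<lambda>n. q n t) \<longlonglongrightarrow> g t"
  proof -
    have "negligible {t \<in> {0..1}. \<not> (\<lambda>n. q n t) \<longlonglongrightarrow> g t}"
      using negN by (rule negligible_subset) (use lim in blast)
    then show ?thesis by (simp add: AE_lebesgue_on_iff_negligible)
  qed
  \<comment> \<open>A measurable stand-in: \<open>g\<close> is not yet known to be measurable, while
    \<open>lim\<close> of measurable functions is, whatever its default value where the quotients
    diverge.\<close>
  define g' where "g' t = lim (\<lambda>n. q n t)" for t
  have g'm: "g' \<in> borel_measurable ?M"
    unfolding g'_def using qint by (intro borel_measurable_lim_metric) auto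
  have g'int: "integrable ?M g'"
  proof (rule integrableI_nonneg[OF g'm])
    show "AE t in ?M. 0 \<le> g' t"
      using AE by eventually_elim (auto simp: g'_def limI intro: LIMSEQ_le_const qnn)
    have "(\<integral>\<^sup>+t. ennreal (g' t) \<partial>?M) = (\<integral>\<^sup>+t. liminf (\<lambda>n. ennreal (q n t)) \<partial>?M)"
    proof (rule nn_integral_cong_AE)
      show "AE t in ?M. ennreal (g' t) = liminf (\<lambda>n. ennreal (q n t))"
        using AE
      proof eventually_elim
        case (elim t)
        then have "(\<lambda>n. ennreal (q n t)) \<longlonglongrightarrow> ennreal (g' t)" by (simp add: g'_def limI tendsto_ennrealI)
        then show ?case by (simp add: lim_imp_Liminf)
      qed
    qed
    also have "\<dots> \<le> liminf (\<lambda>n. \<integral>\<^sup>+t. ennreal (q n t) \<partial>?M)"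
      using qint by (intro nn_integral_liminf) auto
    also have "\<dots> \<le> liminf (\<lambda>n. ennreal (K 1 - K 0))"
      by (intro Liminf_mono always_eventually allI qle)
    also have "\<dots> < \<infinity>" by (simp add: Liminf_const)
    finally show "(\<integral>\<^sup>+t. ennreal (g' t) \<partial>?M) < \<infinity>" .
  qed
  have "g absolutely_integrable_on {0..1}"
  proof (rule absolutely_integrable_spike[OF _ negN])
    show "g' absolutely_integrable_on {0..1}" using g'int by (simp add: integrable_lebesgue_on_iff)
    show "g t = g' t" if "t \<in> {0..1} - (N' \<union> {1})" for t
      using lim[OF that] by (simp add: g'_def limI)
  qed
  then have gint: "integrable ?M g" by (simp add: integrable_lebesgue_on_iff)
  then show "integrable ?M (\<lambda>t. real_of_ereal (w t))" by (simp add: g_def[abs_def])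
  define P where "P x = integral {0..x} g" for x
  have P: "denjoy_primitive (\<lambda>t. ereal (g t)) P"
    unfolding P_def using gint by (rule denjoy_primitive_integral)
  \<comment> \<open>Zero is nonnegative and so is its negative; hence \<open>H - P\<close> and its
    negative are both increasing.\<close>
  have const: "H a + - P a = H b + - P b" if ab: "a \<in> {0..1}" "b \<in> {0..1}" "a \<le> b" for a b
  proof -
    have R: "denjoy_primitive (\<lambda>t. 0) (\<lambda>x. H x + - P x)"
      using denjoy_primitive_add[OF H denjoy_primitive_uminus[OF P]] N'(2)
    proof (rule denjoy_primitive_cong_negligible)
      fix t :: real assume "t \<in> {0..1} - N'"
      then obtain l where "w t = ereal l" using N'(3) by blast
      then show "0 = w t + - ereal (g t)" by (simp add: g_def)
    qed
    then have "denjoy_primitive (\<lambda>t. - 0) (\<lambda>x. - (H x + - P x))" by (rule denjoy_primitive_uminus)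
    from denjoy_primitive_nonneg_mono_on[OF R negligible_empty] denjoy_primitive_nonneg_mono_on[OF this negligible_empty]
    have "mono_on {0..1} (\<lambda>x. H x + - P x)" "mono_on {0..1} (\<lambda>x. - (H x + - P x))" by auto
    from mono_onD[OF this(1) ab] mono_onD[OF this(2) ab] show ?thesis by simp
  qed
  show "integral {a..b} (\<lambda>t. real_of_ereal (w t)) = H b - H a" if "0 \<le> a" "a \<le> b" "b \<le> 1" for a b
  proof -
    have "P b - P a = integral {a..b} g"
      unfolding P_def using that integrable_on_lebesgue_on[OF gint]
      by (intro integral_difference[of _ 0 1]) auto
    then show ?thesis using const[of a b] that by (simp add: g_def[abs_def])
  qed
qed

text \<open>The difference of two primitives is a primitive of the zero function, whose increments
  the preceding theorem computes. This frees later arguments from the \<open>SOME\<close> in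
  \<open>denjoy_integral\<close>.\<close>

lemma denjoy_integral_eq:
  assumes F: "denjoy_primitive f F" and ab: "0 \<le> a" "a \<le> b" "b \<le> 1"
  shows "denjoy_integral f a b = F b - F a"
proof -
  define G where "G = (SOME F. denjoy_primitive f F)"
  have G: "denjoy_primitive f G" unfolding G_def by (rule someI[of "denjoy_primitive f", OF F])
  obtain N where N: "negligible N" "\<And>t. t \<in> {0..1} - N \<Longrightarrow> \<exists>l. f t = ereal l"
    using denjoy_primitiveE[OF F] by metis
  have "denjoy_primitive (\<lambda>t. 0) (\<lambda>x. F x + - G x)"
    using denjoy_primitive_add[OF F denjoy_primitive_uminus[OF G]] N(1)
  proof (rule denjoy_primitive_cong_negligible)
    fix t :: real assume "t \<in> {0..1} - N"
    then obtain l where "f t = ereal l" using N(2) by blast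
    then show "0 = f t + - f t" by simp
  qed
  from denjoy_primitive_nonneg(2)[OF this negligible_empty _ ab]
  have "F b - F a = G b - G a" by simp
  then show ?thesis by (simp add: denjoy_integral_def G_def Let_def)
qed

section \<open>The scalar integrals\<close>

text \<open>A common interface to the three types, so that a selection is subtracted and added back
  once and not three times.\<close>

fun scalar_integrable :: "integral_type \<Rightarrow> (real \<Rightarrow> ereal) \<Rightarrow> bool" where
  "scalar_integrable DP f = denjoy_integrable f"
| "scalar_integrable HKP f = HK_integrable f"
| "scalar_integrable wMS f = (HK_integrable f \<and> lebesgue_integrable f)"

fun scalar_integral :: "integral_type \<Rightarrow> (real \<Rightarrow> ereal) \<Rightarrow> real \<Rightarrow> real \<Rightarrow> real" where
  "scalar_integral DP = denjoy_integral"
| "scalar_integral HKP = HK_integral"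
| "scalar_integral wMS = HK_integral"

lemma integrable_in_iff:
  "integrable_in Q \<C> \<Gamma> \<longleftrightarrow>
     (\<forall>x'. scalar_integrable Q (\<lambda>t. support_fun x' (\<Gamma> t))) \<and>
     (\<forall>a b. 0 \<le> a \<and> a \<le> b \<and> b \<le> 1 \<longrightarrow>
        (\<exists>N\<in>\<C>. \<forall>x'. support_fun x' N =
           ereal (scalar_integral Q (\<lambda>t. support_fun x' (\<Gamma> t)) a b)))"
  by (cases Q) (auto simp: DP_integrable_in_def HKP_integrable_in_def wMS_integrable_in_def)

lemma scalar_integrable_finite:
  assumes "scalar_integrable Q f"
  shows "negligible {t \<in> {0..1}. \<not> \<bar>f t\<bar> \<noteq> \<infinity>}"
proof (cases "Q = DP")
  case True
  then obtain F where "denjoy_primitive f F" using assms by (auto simp: denjoy_integrable_def)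
  then obtain N where "negligible N" "\<And>t. t \<in> {0..1} - N \<Longrightarrow> \<exists>l. f t = ereal l"
    using denjoy_primitiveE by metis
  then show ?thesis by (elim negligible_subset) fastforce
next
  case False
  then have "HK_integrable f" using assms by (cases Q) auto
  then show ?thesis by (simp add: HK_integrable_def AE_lebesgue_on_iff_negligible)
qed

lemma lebesgue_integrable_iff:
  "lebesgue_integrable f \<longleftrightarrow> negligible {t \<in> {0..1}. \<not> \<bar>f t\<bar> \<noteq> \<infinity>} \<and>
     (\<lambda>t. real_of_ereal (f t)) absolutely_integrable_on {0..1}"
  by (simp add: lebesgue_integrable_def AE_lebesgue_on_iff_negligible integrable_lebesgue_on_iff)

lemma LINT_eq_integral_Icc:
  fixes f :: "real \<Rightarrow> real"
  assumes f: "f absolutely_integrable_on {0..1}" and "0 \<le> a" "b \<le> 1"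
  shows "(LINT t|lebesgue_on {a..b}. f t) = integral {a..b} f"
proof -
  have "f absolutely_integrable_on {a..b}"
    using f by (rule set_integrable_subset) (use assms in auto)
  then show ?thesis
    by (intro lebesgue_integral_eq_integral) (auto simp: integrable_lebesgue_on_iff)
qed

text \<open>The difference is nonnegative, and for each type this upgrades integrability to Lebesgue
  integrability: through monotone primitives for \<open>DP\<close>, through absolute integrability
  of nonnegative gauge integrable functions otherwise. As \<open>v\<close> is real,
  \<open>u - v\<close> makes sense also where \<open>u\<close> is infinite.\<close>

lemma scalar_integral_difference:
  fixes u :: "real \<Rightarrow> ereal" and v :: "real \<Rightarrow> real"
  assumes u: "scalar_integrable Q u" and v: "scalar_integrable Q (\<lambda>t. ereal (v t))"
    and le: "\<And>t. t \<in> {0..1} \<Longrightarrow> ereal (v t) \<le> u t"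
    and w: "\<And>t. t \<in> {0..1} \<Longrightarrow> w t = u t - ereal (v t)"
  shows "lebesgue_integrable w"
    and "\<And>a b. 0 \<le> a \<Longrightarrow> a \<le> b \<Longrightarrow> b \<le> 1 \<Longrightarrow>
      (LINT t|lebesgue_on {a..b}. real_of_ereal (w t))
        = scalar_integral Q u a b - scalar_integral Q (\<lambda>t. ereal (v t)) a b"
proof -
  define N where "N = {t \<in> {0..1}. \<not> \<bar>u t\<bar> \<noteq> \<infinity>}"
  have N: "negligible N" unfolding N_def using u by (rule scalar_integrable_finite)
  have wnn: "0 \<le> w t" if "t \<in> {0..1}" for t
    using le[OF that] w[OF that] by (cases "u t") auto
  have wfin: "w t = ereal (real_of_ereal (u t) - v t)" if "t \<in> {0..1} - N" for t
    using that w[of t] by (cases "u t") (auto simp: N_def)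
  have neg: "negligible {t \<in> {0..1}. \<not> \<bar>w t\<bar> \<noteq> \<infinity>}"
    using N by (rule negligible_subset) (use wfin in fastforce)
  let ?w = "\<lambda>t. real_of_ereal (w t)"
  have key: "?w absolutely_integrable_on {0..1} \<and> (\<forall>a b. 0 \<le> a \<longrightarrow> a \<le> b \<longrightarrow> b \<le> 1 \<longrightarrow>
      integral {a..b} ?w = scalar_integral Q u a b - scalar_integral Q (\<lambda>t. ereal (v t)) a b)"
  proof (cases "Q = DP")
    case True
    then obtain U V where U: "denjoy_primitive u U" and V: "denjoy_primitive (\<lambda>t. ereal (v t)) V"
      using u v by (auto simp: denjoy_integrable_def)
    have H: "denjoy_primitive w (\<lambda>x. U x + - V x)"
      using denjoy_primitive_add[OF U denjoy_primitive_uminus[OF V]] negligible_empty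
      by (rule denjoy_primitive_cong_negligible) (simp add: w minus_ereal_def)
    have nn: "\<And>t. t \<in> {0..1} - {} \<Longrightarrow> 0 \<le> w t" using wnn by simp
    note D = denjoy_primitive_nonneg[OF H negligible_empty nn]
    show ?thesis
      using D True by (simp add: integrable_lebesgue_on_iff denjoy_integral_eq[OF U] denjoy_integral_eq[OF V])
  next
    case False
    then have HK: "HK_integrable u" "HK_integrable (\<lambda>t. ereal (v t))"
      and sc: "scalar_integral Q = HK_integral" using u v by (cases Q; auto)+
    let ?u = "\<lambda>t. real_of_ereal (u t)"
    have ui: "?u integrable_on {0..1}" and vi: "v integrable_on {0..1}"
      using HK by (auto simp: HK_integrable_def)
    have d: "(\<lambda>t. ?u t - v t) integrable_on {0..1}" using ui vi by (rule integrable_diff)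
    have "?w integrable_on {0..1}"
      by (rule integrable_spike[OF d N]) (use wfin in auto)
    then have "?w absolutely_integrable_on {0..1}"
      by (rule nonnegative_absolutely_integrable_1) (use wnn real_of_ereal_pos in blast)
    moreover have "integral {a..b} ?w = integral {a..b} ?u - integral {a..b} v"
      if ab: "0 \<le> a" "a \<le> b" "b \<le> 1" for a b
    proof -
      have sub: "{a..b} \<subseteq> {0..1}" using ab by auto
      have "integral {a..b} ?w = integral {a..b} (\<lambda>t. ?u t - v t)"
        using N by (rule integral_spike) (use wfin sub in auto)
      also have "\<dots> = integral {a..b} ?u - integral {a..b} v"
        using ui vi sub by (intro Henstock_Kurzweil_Integration.integral_diff) (auto intro: integrable_on_subinterval)
      finally show ?thesis .
    qed
    ultimately show ?thesis by (simp add: sc HK_integral_def)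
  qed
  then show "lebesgue_integrable w" using neg by (simp add: lebesgue_integrable_iff)
  show "(LINT t|lebesgue_on {a..b}. ?w t)
      = scalar_integral Q u a b - scalar_integral Q (\<lambda>t. ereal (v t)) a b"
    if "0 \<le> a" "a \<le> b" "b \<le> 1" for a b
    using key that by (simp add: LINT_eq_integral_Icc)
qed

text \<open>Lebesgue integrability implies each of the three scalar notions, and each notion is
  additive. For \<open>wMS\<close> the Lebesgue integrability of the sum also draws on that of
  \<open>v\<close>.\<close>

lemma scalar_integral_sum:
  fixes u w :: "real \<Rightarrow> ereal" and v :: "real \<Rightarrow> real"
  assumes w: "lebesgue_integrable w" and v: "scalar_integrable Q (\<lambda>t. ereal (v t))"
    and u: "\<And>t. t \<in> {0..1} \<Longrightarrow> u t = w t + ereal (v t)"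
  shows "scalar_integrable Q u"
    and "\<And>a b. 0 \<le> a \<Longrightarrow> a \<le> b \<Longrightarrow> b \<le> 1 \<Longrightarrow>
      scalar_integral Q u a b
        = (LINT t|lebesgue_on {a..b}. real_of_ereal (w t)) + scalar_integral Q (\<lambda>t. ereal (v t)) a b"
proof -
  let ?w = "\<lambda>t. real_of_ereal (w t)" and ?u = "\<lambda>t. real_of_ereal (u t)"
  define N where "N = {t \<in> {0..1}. \<not> \<bar>w t\<bar> \<noteq> \<infinity>}"
  have N: "negligible N" and wa: "?w absolutely_integrable_on {0..1}"
    using w by (auto simp: lebesgue_integrable_iff N_def)
  then have wi: "?w integrable_on {0..1}" by (intro set_lebesgue_integral_eq_integral(1))
  have wfin: "w t = ereal (?w t)" if "t \<in> {0..1} - N" for t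
    using that by (auto simp: N_def ereal_real')
  have ufin: "u t = ereal (?w t + v t)" if "t \<in> {0..1} - N" for t
    using u[of t] wfin[OF that] that by (metis DiffD1 plus_ereal.simps(1))
  have uneg: "negligible {t \<in> {0..1}. \<not> \<bar>u t\<bar> \<noteq> \<infinity>}"
    using N by (rule negligible_subset) (use ufin in fastforce)
  have "scalar_integrable Q u \<and> (\<forall>a b. 0 \<le> a \<longrightarrow> a \<le> b \<longrightarrow> b \<le> 1 \<longrightarrow>
      scalar_integral Q u a b = integral {a..b} ?w + scalar_integral Q (\<lambda>t. ereal (v t)) a b)"
  proof (cases "Q = DP")
    case True
    then obtain V where V: "denjoy_primitive (\<lambda>t. ereal (v t)) V"
      using v by (auto simp: denjoy_integrable_def)
    define W where "W x = integral {0..x} ?w" for x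
    have W: "denjoy_primitive (\<lambda>t. ereal (?w t)) W"
      unfolding W_def using wa by (intro denjoy_primitive_integral) (simp add: integrable_lebesgue_on_iff)
    have U: "denjoy_primitive u (\<lambda>x. W x + V x)"
      using denjoy_primitive_add[OF W V] N by (rule denjoy_primitive_cong_negligible) (simp add: ufin)
    have "W b - W a = integral {a..b} ?w" if "0 \<le> a" "a \<le> b" "b \<le> 1" for a b
      unfolding W_def using that by (intro integral_difference[OF wi])
    then show ?thesis
      using True U by (auto simp: denjoy_integrable_def denjoy_integral_eq[OF U] denjoy_integral_eq[OF V])
  next
    case False
    then have HK: "HK_integrable (\<lambda>t. ereal (v t))"
      and sc: "scalar_integral Q = HK_integral" using v by (cases Q; auto)+
    have vi: "v integrable_on {0..1}" using HK by (auto simp: HK_integrable_def)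
    have "?u integrable_on {0..1}"
      by (rule integrable_spike[OF integrable_add[OF wi vi] N]) (simp add: ufin)
    then have "HK_integrable u" using uneg by (simp add: HK_integrable_def AE_lebesgue_on_iff_negligible)
    moreover have "lebesgue_integrable u" if "Q = wMS"
    proof -
      have "v absolutely_integrable_on {0..1}" using v that by (simp add: lebesgue_integrable_iff)
      then have s: "(\<lambda>t. ?w t + v t) absolutely_integrable_on {0..1}"
        using wa by (intro set_integral_add)
      have "?u absolutely_integrable_on {0..1}"
        by (rule absolutely_integrable_spike[OF s N]) (simp add: ufin)
      then show ?thesis using uneg by (simp add: lebesgue_integrable_iff)
    qed
    ultimately have "scalar_integrable Q u" using False by (cases Q) auto
    moreover have "integral {a..b} ?u = integral {a..b} ?w + integral {a..b} v"
      if ab: "0 \<le> a" "a \<le> b" "b \<le> 1" for a b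
    proof -
      have sub: "{a..b} \<subseteq> {0..1}" using ab by auto
      have "integral {a..b} ?u = integral {a..b} (\<lambda>t. ?w t + v t)"
        using N by (rule integral_spike) (use ufin sub in auto)
      also have "\<dots> = integral {a..b} ?w + integral {a..b} v"
        using wi vi sub by (intro Henstock_Kurzweil_Integration.integral_add) (auto intro: integrable_on_subinterval)
      finally show ?thesis .
    qed
    ultimately show ?thesis by (simp add: sc HK_integral_def)
  qed
  then show "scalar_integrable Q u"
    "\<And>a b. 0 \<le> a \<Longrightarrow> a \<le> b \<Longrightarrow> b \<le> 1 \<Longrightarrow>
      scalar_integral Q u a b
        = (LINT t|lebesgue_on {a..b}. ?w t) + scalar_integral Q (\<lambda>t. ereal (v t)) a b"
    using wa by (simp_all add: LINT_eq_integral_Icc)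
qed

section \<open>Support functions\<close>

lemma support_fun_singleton: "support_fun x' {y} = ereal (x' y)"
  by (simp add: support_fun_def)

lemma support_fun_upper: "y \<in> C \<Longrightarrow> ereal (blinfun_apply x' y) \<le> support_fun x' C"
  unfolding support_fun_def by (rule SUP_upper)

lemma support_fun_least:
  "(\<And>y. y \<in> C \<Longrightarrow> ereal (blinfun_apply x' y) \<le> s) \<Longrightarrow> support_fun x' C \<le> s"
  unfolding support_fun_def by (rule SUP_least)

lemma support_fun_translate:
  assumes "C \<noteq> {}"
  shows "support_fun x' ((\<lambda>y. y - z) ` C) = support_fun x' C - ereal (x' z)"
proof -
  have "support_fun x' ((\<lambda>y. y - z) ` C) = (SUP y\<in>C. ereal (x' y) + ereal (- x' z))"
    by (simp add: support_fun_def image_image blinfun.diff_right)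
  also have "\<dots> = support_fun x' C + ereal (- x' z)"
    unfolding support_fun_def using assms by (subst SUP_ereal_add_left) auto
  finally show ?thesis by (simp add: minus_ereal_def)
qed

lemma support_fun_add_le: "support_fun (x' + y') C \<le> support_fun x' C + support_fun y' C"
  by (intro support_fun_least) (auto simp: blinfun.add_left simp flip: plus_ereal.simps(1)
      intro!: add_mono support_fun_upper)

lemma support_fun_scaleR_le:
  assumes "0 < c"
  shows "support_fun (c *\<^sub>R x') C \<le> ereal c * support_fun x' C"
proof (rule support_fun_least)
  fix y assume "y \<in> C"
  then have "ereal c * ereal (x' y) \<le> ereal c * support_fun x' C"
    using assms by (intro ereal_mult_left_mono support_fun_upper) auto
  then show "ereal ((c *\<^sub>R x') y) \<le> ereal c * support_fun x' C"
    by (simp add: blinfun.scaleR_left)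
qed

lemma translate_bounded_closed_convex:
  assumes "C \<in> bounded_closed_convex_sets"
  shows "(\<lambda>y. y - z) ` C \<in> bounded_closed_convex_sets"
proof -
  have eq: "(\<lambda>y. y - z) ` C = (\<lambda>y. (- z) + y) ` C" by (simp add: add.commute)
  show ?thesis
    using assms unfolding bounded_closed_convex_sets_def closed_convex_sets_def eq
    by (auto simp only: mem_Collect_eq image_is_empty closed_translation convex_translation_eq bounded_translation)
qed

section \<open>Almost everywhere convergence along decreasing convex sets\<close>

text \<open>The total variation of the sequence has a finite integral, hence is finite almost
  everywhere.\<close>

lemma AE_convergent_of_summable_variation:
  fixes v :: "nat \<Rightarrow> 'm \<Rightarrow> real"
  assumes v: "\<And>j. integrable M (v j)"
    and le: "\<And>j. (LINT t|M. \<bar>v (Suc j) t - v j t\<bar>) \<le> b j" and b: "summable b"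
  shows "AE t in M. convergent (\<lambda>j. v j t)"
proof -
  let ?d = "\<lambda>j t. \<bar>v (Suc j) t - v j t\<bar>"
  have di: "integrable M (?d j)" for j using v by (intro integrable_abs Bochner_Integration.integrable_diff)
  have b0: "0 \<le> b j" for j using le[of j] by (rule order_trans[rotated]) simp
  have "(\<integral>\<^sup>+t. (\<Sum>j. ennreal (?d j t)) \<partial>M) = (\<Sum>j. \<integral>\<^sup>+t. ennreal (?d j t) \<partial>M)"
    using di by (intro nn_integral_suminf) auto
  also have "\<dots> = (\<Sum>j. ennreal (LINT t|M. ?d j t))"
    using di by (intro suminf_cong nn_integral_eq_integral) auto
  also have "\<dots> \<le> (\<Sum>j. ennreal (b j))"
    using le by (intro suminf_le summableI ennreal_leI)
  also have "\<dots> = ennreal (suminf b)" using b b0 by (intro suminf_ennreal2)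
  finally have "(\<integral>\<^sup>+t. (\<Sum>j. ennreal (?d j t)) \<partial>M) \<noteq> \<infinity>" by (auto simp: top_unique)
  moreover have "(\<lambda>t. \<Sum>j. ennreal (?d j t)) \<in> borel_measurable M"
    using di by (intro borel_measurable_suminf_order) auto
  ultimately have "AE t in M. (\<Sum>j. ennreal (?d j t)) \<noteq> \<infinity>" by (intro nn_integral_noteq_infinite)
  then show ?thesis
  proof eventually_elim
    case (elim t)
    then have "summable (\<lambda>j. ?d j t)" by (intro summable_suminf_not_top) auto
    then have "summable (\<lambda>j. v (Suc j) t - v j t)" by (rule summable_rabs_cancel)
    then have "convergent (\<lambda>n. \<Sum>j<n. v (Suc j) t - v j t)" by (simp add: summable_iff_convergent)
    moreover have "(\<Sum>j<n. v (Suc j) t - v j t) = v n t - v 0 t" for n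
      by (rule sum_lessThan_telescope)
    ultimately have "convergent (\<lambda>n. v n t - v 0 t)" by (simp only:)
    from convergent_add[OF this convergent_const[of "v 0 t"]] show ?case by simp
  qed
qed

text \<open>The purpose of the linear term: \<open>exp (- r)\<close> alone decreases, but a support
  function at a midpoint is only bounded above by the mean, so the strictly convex function applied
  to it has to increase.\<close>

lemma add_exp_minus_mono:
  fixes r r' :: real
  assumes "0 \<le> r" "r \<le> r'"
  shows "r + exp (- r) \<le> r' + exp (- r')"
proof -
  have "exp (- r) - exp (- r') = exp (- r) * (1 - exp (- (r' - r)))"
    by (simp add: right_diff_distrib flip: exp_add)
  also have "\<dots> \<le> 1 * (r' - r)"
  proof (rule mult_mono)
    show "1 - exp (- (r' - r)) \<le> r' - r" using exp_ge_add_one_self[of "- (r' - r)"] by linarith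
  qed (use assms in auto)
  finally show ?thesis by simp
qed

text \<open>The linear terms cancel at the exact midpoint, and the defect of the exponential there
  is a perfect square, \<open>exp (- a) + exp (- b) - 2 * E\<close>.\<close>

lemma add_exp_minus_midpoint:
  fixes a b m :: real
  assumes "0 \<le> m" "m \<le> (a + b) / 2"
  shows "(exp (- (b / 2)) - exp (- (a / 2)))\<^sup>2 \<le> (a + exp (- a)) + (b + exp (- b)) - 2 * (m + exp (- m))"
proof -
  define E where "E = exp (- ((a + b) / 2))"
  have "E = exp (- (a / 2)) * exp (- (b / 2))"
    by (simp add: E_def add_divide_distrib flip: exp_add)
  moreover have "exp (- a) = (exp (- (a / 2)))\<^sup>2" "exp (- b) = (exp (- (b / 2)))\<^sup>2"
    by (simp_all add: power2_eq_square flip: exp_add)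
  ultimately have "(exp (- (b / 2)) - exp (- (a / 2)))\<^sup>2 = exp (- a) + exp (- b) - 2 * E"
    by (simp add: power2_diff)
  moreover have "m + exp (- m) \<le> (a + b) / 2 + E"
    unfolding E_def by (rule add_exp_minus_mono[OF assms])
  ultimately show ?thesis by argo
qed

text \<open>Near minimisers of the strictly convex functional \<open>J x = \<integral> (s x + exp (- s x))\<close> over the sets
  \<open>T n\<close> converge almost everywhere, because the midpoint defect of \<open>J\<close> dominates the squared
  distance of the functions \<open>exp (- s x / 2)\<close>.\<close>

lemma convex_sets_AE_convergent:
  fixes s :: "'x::real_vector \<Rightarrow> 'm \<Rightarrow> real" and T :: "nat \<Rightarrow> 'x set"
  assumes M: "finite_measure M"
    and T: "\<And>n. convex (T n)" "decseq T" "\<And>n. T n \<noteq> {}"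
    and int: "\<And>x. integrable M (s x)" and nonneg: "\<And>x. AE t in M. 0 \<le> s x t"
    and bound: "\<And>x. x \<in> T 0 \<Longrightarrow> (LINT t|M. s x t) \<le> c"
    and mid: "\<And>x y. AE t in M. s ((1/2) *\<^sub>R x + (1/2) *\<^sub>R y) t \<le> (s x t + s y t) / 2"
  obtains X where "\<And>j. X j \<in> T j" "AE t in M. convergent (\<lambda>j. exp (- (s (X j) t / 2)))"
proof -
  interpret finite_measure M by (rule M)
  define g where "g x t = s x t + exp (- s x t)" for x t
  define J where "J x = (LINT t|M. g x t)" for x
  have expint: "integrable M (\<lambda>t. exp (- (s x t / k)))" if "k > 0" for x k
    using nonneg[of x] that int[of x] by (intro integrable_const_bound[of _ 1]) (auto elim!: eventually_mono)
  have Jint: "integrable M (g x)" for x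
    unfolding g_def using int expint[of 1 x] by (intro Bochner_Integration.integrable_add) auto
  have J0: "0 \<le> J x" for x
    unfolding J_def g_def using nonneg[of x] by (intro integral_nonneg_AE) (auto elim!: eventually_mono)
  have Jle: "J x \<le> c + measure M (space M)" if "x \<in> T 0" for x
  proof -
    have "J x = (LINT t|M. s x t) + (LINT t|M. exp (- s x t))"
      unfolding J_def g_def using int expint[of 1 x] by (intro Bochner_Integration.integral_add) auto
    also have "(LINT t|M. exp (- s x t)) \<le> (LINT t|M. 1)"
      using nonneg[of x] expint[of 1 x] by (intro integral_mono_AE) (auto elim!: eventually_mono)
    finally show ?thesis using bound[OF that] by simp
  qed
  have J_mid: "(LINT t|M. (exp (- (s y t / 2)) - exp (- (s x t / 2)))\<^sup>2)
      \<le> J x + J y - 2 * J ((1/2) *\<^sub>R x + (1/2) *\<^sub>R y)" for x y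
  proof -
    let ?z = "(1/2) *\<^sub>R x + (1/2) *\<^sub>R y"
    let ?r = "\<lambda>t. g x t + g y t - 2 * g ?z t"
    have ri: "integrable M ?r"
      by (rule Bochner_Integration.integrable_diff[OF Bochner_Integration.integrable_add[OF Jint Jint]
            integrable_mult_right[OF Jint]])
    have ae: "AE t in M. (exp (- (s y t / 2)) - exp (- (s x t / 2)))\<^sup>2 \<le> ?r t"
      using mid[of x y] nonneg[of ?z]
    proof eventually_elim
      case (elim t)
      then show ?case unfolding g_def by (intro add_exp_minus_midpoint) auto
    qed
    have meas: "(\<lambda>t. (exp (- (s y t / 2)) - exp (- (s x t / 2)))\<^sup>2) \<in> borel_measurable M"
      using int[of x] int[of y] by measurable
    have "integrable M (\<lambda>t. (exp (- (s y t / 2)) - exp (- (s x t / 2)))\<^sup>2)"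
      by (rule Bochner_Integration.integrable_bound[OF ri meas]) (use ae in \<open>auto elim!: eventually_mono\<close>)
    then have "(LINT t|M. (exp (- (s y t / 2)) - exp (- (s x t / 2)))\<^sup>2) \<le> integral\<^sup>L M ?r"
      using ri ae by (intro integral_mono_AE)
    also have "\<dots> = J x + J y - 2 * J ?z"
      unfolding J_def using Jint[of x] Jint[of y] Jint[of ?z] by simp
    finally show ?thesis .
  qed
  define I where "I n = (INF x\<in>T n. J x)" for n
  have bdd: "bdd_below (J ` T n)" for n using J0 by (intro bdd_belowI2[of _ 0])
  have T_mono: "T n \<subseteq> T m" if "m \<le> n" for m n using T(2) that by (rule decseqD)
  have I_le: "I n \<le> J x" if "x \<in> T n" for n x unfolding I_def using that by (intro cINF_lower bdd)
  have "incseq I"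
    unfolding I_def using T_mono T(3) by (intro monoI cINF_superset_mono bdd) auto
  have "I n \<le> c + measure M (space M)" for n
  proof -
    obtain x where "x \<in> T n" using T(3) by blast
    then show ?thesis using I_le Jle T_mono[of 0 n] by (meson order_trans subsetD zero_le)
  qed
  then obtain L where L: "I \<longlonglongrightarrow> L" "\<And>n. I n \<le> L"
    using incseq_convergent[OF \<open>incseq I\<close>] by blast
  have "\<exists>n. L - (1/4) ^ j < I n" for j
  proof -
    have "\<forall>\<^sub>F n in sequentially. L - (1/4) ^ j < I n"
      using L(1) by (rule order_tendstoD(1)) simp
    then show ?thesis by (auto simp: eventually_sequentially)
  qed
  then obtain n where n: "\<And>j. L - (1/4) ^ j < I (n j)" by metis
  \<comment> \<open>Summing makes \<open>k\<close> increasing while it still dominates both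
    \<open>n j\<close> and \<open>j\<close>.\<close>
  define k where "k j = j + (\<Sum>i\<le>j. n i)" for j
  have k_mono: "k j \<le> k (Suc j)" "n j \<le> k j" "j \<le> k j" for j
    by (auto simp: k_def intro: order_trans[OF member_le_sum[of j "{..j}" n]])
  have Ik: "L - (1/4) ^ j < I (k j)" for j
    using n[of j] incseqD[OF \<open>incseq I\<close> k_mono(2)[of j]] by linarith
  have "\<exists>x\<in>T (k j). J x < I (k j) + (1/4) ^ j" for j
    using cINF_less_iff[OF T(3) bdd, of "k j" "I (k j) + (1/4) ^ j"] unfolding I_def by simp
  then obtain X where X: "\<And>j. X j \<in> T (k j)" "\<And>j. J (X j) < I (k j) + (1/4) ^ j" by metis
  let ?v = "\<lambda>j t. exp (- (s (X j) t / 2))"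
  \<comment> \<open>The three units of \<open>(1/4) ^ j\<close> are the near-minimality of
    \<open>X j\<close>, that of \<open>X (Suc j)\<close>, and the gap \<open>L - I (k j)\<close>.
    The midpoint stays in \<open>T (k j)\<close>, so its value is at least
    \<open>I (k j)\<close>.\<close>
  have sq: "(LINT t|M. (?v (Suc j) t - ?v j t)\<^sup>2) \<le> 3 * (1/4) ^ j" for j
  proof -
    have "X (Suc j) \<in> T (k j)" using X(1) T_mono[OF k_mono(1)] by blast
    then have "(1/2) *\<^sub>R X j + (1/2) *\<^sub>R X (Suc j) \<in> T (k j)"
      using X(1)[of j] by (intro convexD[OF T(1)]) auto
    from I_le[OF this] J_mid[where x = "X j" and y = "X (Suc j)"]
    have "(LINT t|M. (?v (Suc j) t - ?v j t)\<^sup>2) \<le> J (X j) + J (X (Suc j)) - 2 * I (k j)" by linarith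
    moreover have "(1/4 :: real) ^ Suc j \<le> (1/4) ^ j" by simp
    ultimately show ?thesis
      using X(2)[of j] X(2)[of "Suc j"] L(2)[of "k (Suc j)"] Ik[of j] by linarith
  qed
  have vint: "integrable M (?v j)" for j using expint[of 2 "X j"] by simp
  define b where "b j = (measure M (space M) + 3) * (1/2) ^ j" for j :: nat
  have "AE t in M. convergent (\<lambda>j. ?v j t)"
  proof (rule AE_convergent_of_summable_variation[OF vint])
    show "summable b" unfolding b_def by (intro summable_mult summable_geometric) simp
    fix j
    let ?D = "\<lambda>t. ?v (Suc j) t - ?v j t"
    have sqint: "integrable M (\<lambda>t. (?D t)\<^sup>2)"
    proof (rule integrable_const_bound[of _ 1])
      show "AE t in M. norm ((?D t)\<^sup>2) \<le> 1"
        using nonneg[of "X j"] nonneg[of "X (Suc j)"]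
      proof eventually_elim
        case (elim t)
        then have "0 < ?v j t" "?v j t \<le> 1" "0 < ?v (Suc j) t" "?v (Suc j) t \<le> 1" by auto
        then have "\<bar>?D t\<bar> \<le> 1" by linarith
        then show ?case using abs_le_square_iff[of "?D t" 1] by simp
      qed
      show "(\<lambda>t. (?D t)\<^sup>2) \<in> borel_measurable M" using vint[of j] vint[of "Suc j"] by measurable
    qed
    \<comment> \<open>Trades the mean-square bound of order \<open>(1/4) ^ j\<close> for a mean
      bound of order \<open>(1/2) ^ j\<close>, which is summable.\<close>
    have "\<bar>d\<bar> \<le> (1/2) ^ j + 2 ^ j * d\<^sup>2" for d :: real
    proof (cases "\<bar>d\<bar> \<le> (1/2) ^ j")
      case False
      then have "(1/2) ^ j * \<bar>d\<bar> \<le> \<bar>d\<bar> * \<bar>d\<bar>" by (intro mult_right_mono) auto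
      then have "2 ^ j * ((1/2) ^ j * \<bar>d\<bar>) \<le> 2 ^ j * d\<^sup>2"
        by (intro mult_left_mono) (auto simp: power2_eq_square)
      moreover have "2 ^ j * ((1/2) ^ j * \<bar>d\<bar>) = \<bar>d\<bar>" by (simp add: power_one_over)
      moreover have "0 \<le> (1/2 :: real) ^ j" by simp
      ultimately show ?thesis by linarith
    qed (simp add: add_increasing2)
    then have "(LINT t|M. \<bar>?D t\<bar>) \<le> (LINT t|M. (1/2) ^ j + 2 ^ j * (?D t)\<^sup>2)"
      using vint sqint by (intro integral_mono) auto
    also have "\<dots> = measure M (space M) * (1/2) ^ j + 2 ^ j * (LINT t|M. (?D t)\<^sup>2)"
      using sqint by simp
    also have "\<dots> \<le> measure M (space M) * (1/2) ^ j + 2 ^ j * (3 * (1/4) ^ j)"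
      using sq[of j] by (intro add_left_mono mult_left_mono) auto
    also have "\<dots> = b j"
      by (simp add: b_def power_divide distrib_right flip: power_mult_distrib)
         (simp add: field_simps flip: power_mult_distrib)
    finally show "(LINT t|M. \<bar>?D t\<bar>) \<le> b j" .
  qed
  moreover have "X j \<in> T j" for j using X(1) T_mono[OF k_mono(3)] by blast
  ultimately show thesis using that by blast
qed

section \<open>Duality\<close>

text \<open>Here \<open>p y\<close> is the limit superior of \<open>X j y\<close>, which is
  sublinear in \<open>y\<close>, and any linear functional below it will do. Applied to
  \<open>- y\<close>, the conclusion also bounds \<open>u y\<close> from below by the limit
  inferior. This takes the place of a weak-star convergent subsequence, which need not
  exist.\<close>

lemma bounded_sequence_cluster_functional:
  fixes X :: "nat \<Rightarrow> 'a::real_normed_vector \<Rightarrow>\<^sub>L real"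
  assumes bound: "\<And>j. norm (X j) \<le> R"
  obtains u :: "'a \<Rightarrow>\<^sub>L real" where "\<And>y r. \<forall>\<^sub>F j in sequentially. X j y \<le> r \<Longrightarrow> u y \<le> r"
proof -
  define A where "A y = {r. \<forall>\<^sub>F j in sequentially. X j y \<le> r}" for y
  define p where "p y = Inf (A y)" for y
  have ab: "\<bar>X j y\<bar> \<le> R * norm y" for j y
    using norm_blinfun[of "X j" y] bound[of j] mult_right_mono[of "norm (X j)" R "norm y"] by simp
  have top: "R * norm y \<in> A y" for y
    using ab by (auto simp: A_def abs_le_iff)
  have low: "- (R * norm y) \<le> r" if "r \<in> A y" for r y
  proof -
    have "\<exists>j. X j y \<le> r" using that by (auto simp: A_def eventually_sequentially)
    then show ?thesis using ab[of _ y] by (meson abs_le_iff minus_le_iff order_trans)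
  qed
  have bdd: "bdd_below (A y)" for y using low by (rule bdd_belowI)
  have le: "p y \<le> r" if "r \<in> A y" for r y unfolding p_def using that bdd by (rule cInf_lower)
  have ge: "w \<le> p y" if "\<And>r. r \<in> A y \<Longrightarrow> w \<le> r" for w y
    unfolding p_def using top that by (intro cInf_greatest) blast+
  have "sublinear p"
  proof (rule sublinearI)
    fix x y
    have 1: "p (x + y) \<le> r + q" if "r \<in> A x" "q \<in> A y" for r q
    proof (rule le)
      have "\<forall>\<^sub>F j in sequentially. X j x \<le> r" "\<forall>\<^sub>F j in sequentially. X j y \<le> q"
        using that by (auto simp: A_def)
      then have "\<forall>\<^sub>F j in sequentially. X j (x + y) \<le> r + q"
        by eventually_elim (simp add: blinfun.add_right add_mono)
      then show "r + q \<in> A (x + y)" by (simp add: A_def)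
    qed
    have "p (x + y) - q \<le> p x" if "q \<in> A y" for q using 1[OF _ that] by (intro ge) (simp add: algebra_simps)
    then have "p (x + y) - p x \<le> p y" by (intro ge) (simp add: algebra_simps)
    then show "p (x + y) \<le> p x + p y" by simp
  next
    show "p 0 = 0" using le[OF top[of 0]] ge[of 0 0] low[of _ 0] by (intro antisym) auto
  next
    fix c :: real and x assume c: "0 < c"
    have "p (c *\<^sub>R x) / c \<le> p x"
    proof (rule ge)
      fix r assume "r \<in> A x"
      then have "\<forall>\<^sub>F j in sequentially. X j x \<le> r" by (simp add: A_def)
      then have "\<forall>\<^sub>F j in sequentially. X j (c *\<^sub>R x) \<le> c * r"
        by eventually_elim (use c in \<open>simp add: blinfun.scaleR_right mult_left_mono\<close>)
      then have "p (c *\<^sub>R x) \<le> c * r" by (intro le) (simp add: A_def)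
      then show "p (c *\<^sub>R x) / c \<le> r" using c by (simp add: field_simps)
    qed
    then show "p (c *\<^sub>R x) \<le> c * p x" using c by (simp add: field_simps)
  qed
  moreover have "p x \<le> R * norm x" for x using top by (rule le)
  ultimately obtain u :: "'a \<Rightarrow>\<^sub>L real" where u: "\<And>x. u x \<le> p x"
    using blinfun_Hahn_Banach by metis
  show thesis
  proof (rule that)
    fix y r assume "\<forall>\<^sub>F j in sequentially. X j y \<le> r"
    then have "p y \<le> r" by (intro le) (simp add: A_def)
    then show "u y \<le> r" using u[of y] by simp
  qed
qed

text \<open>A linear functional on the dual space that vanishes on the common kernel of finitely many
  evaluations is itself an evaluation; this replaces weak-star separation.\<close>

lemma finite_constraints_attained:
  fixes \<psi> :: "('a::real_normed_vector \<Rightarrow>\<^sub>L real) \<Rightarrow> real" and y :: "nat \<Rightarrow> 'a"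
  assumes sub: "sublinear \<psi>" and nonneg: "\<And>x. 0 \<le> \<psi> x"
    and le: "\<And>v. (\<And>x. blinfun_apply x v \<le> \<psi> x) \<Longrightarrow> blinfun_apply x0 v \<le> c" and d: "c < d"
  obtains x :: "'a \<Rightarrow>\<^sub>L real" where "\<And>i. i < n \<Longrightarrow> blinfun_apply x (y i) = x0 (y i)" "\<psi> x < d"
proof -
  define E where "E = {z :: 'a \<Rightarrow>\<^sub>L real. \<forall>i<n. z (y i) = 0}"
  \<comment> \<open>The quotient of \<open>\<psi>\<close> by the functionals that vanish at all
    \<open>y i\<close>; the goal amounts to \<open>p x0 < d\<close>. Since \<open>p \<le> 0\<close>
    on \<open>E\<close>, a linear functional below \<open>p\<close> vanishes there.\<close>
  define p where "p x = (INF z\<in>E. \<psi> (x + z))" for x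
  have E: "0 \<in> E" "\<And>z w. z \<in> E \<Longrightarrow> w \<in> E \<Longrightarrow> z + w \<in> E" "\<And>k z. z \<in> E \<Longrightarrow> k *\<^sub>R z \<in> E"
    by (auto simp: E_def blinfun.add_left blinfun.scaleR_left)
  have bdd: "bdd_below ((\<lambda>z. \<psi> (x + z)) ` E)" for x using nonneg by (intro bdd_belowI2[of _ 0])
  have low: "p x \<le> \<psi> (x + z)" if "z \<in> E" for x z unfolding p_def using that by (intro cINF_lower bdd)
  have great: "w \<le> p x" if "\<And>z. z \<in> E \<Longrightarrow> w \<le> \<psi> (x + z)" for w x
    unfolding p_def using E(1) that by (intro cINF_greatest) auto
  have "sublinear p"
  proof (rule sublinearI)
    fix x w
    have 1: "p (x + w) \<le> \<psi> (x + z) + \<psi> (w + z')" if "z \<in> E" "z' \<in> E" for z z'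
    proof -
      have "p (x + w) \<le> \<psi> ((x + w) + (z + z'))" using E(2)[OF that] by (rule low)
      also have "(x + w) + (z + z') = (x + z) + (w + z')" by simp
      also have "\<psi> \<dots> \<le> \<psi> (x + z) + \<psi> (w + z')" by (rule sublinear_add[OF sub])
      finally show ?thesis .
    qed
    have "p (x + w) - \<psi> (w + z') \<le> p x" if "z' \<in> E" for z'
      using 1[OF _ that] by (intro great) (simp add: algebra_simps)
    then have "p (x + w) - p x \<le> p w" by (intro great) (simp add: algebra_simps)
    then show "p (x + w) \<le> p x + p w" by simp
  next
    show "p 0 = 0"
      using low[OF E(1), of 0] great[of 0 0] nonneg sublinear_zero[OF sub] by (intro antisym) auto
  next
    fix k :: real and x assume k: "0 < k"
    have "p (k *\<^sub>R x) / k \<le> p x"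
    proof (rule great)
      fix z assume "z \<in> E"
      then have "p (k *\<^sub>R x) \<le> \<psi> (k *\<^sub>R x + k *\<^sub>R z)" by (intro low E(3))
      also have "\<dots> = k * \<psi> (x + z)"
        using k by (simp add: sublinear_scale[OF sub] flip: scaleR_add_right)
      finally show "p (k *\<^sub>R x) / k \<le> \<psi> (x + z)" using k by (simp add: field_simps)
    qed
    then show "p (k *\<^sub>R x) \<le> k * p x" using k by (simp add: field_simps)
  qed
  then obtain l where l: "linear l" "\<And>x. l x \<le> p x" "l x0 = p x0"
    using sublinear_Hahn_Banach by metis
  have l0: "l z \<le> 0" if "z \<in> E" for z
    using l(2)[of z] low[OF E(3)[OF that, of "- 1"], of z] sublinear_zero[OF sub] by simp
  have "l z = 0" if z: "\<And>i. i < n \<Longrightarrow> blinfun_apply z (y i) = 0" for z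
  proof -
    have "z \<in> E" using z by (simp add: E_def)
    then show ?thesis
      using l0[of z] l0[of "- z"] E(3)[of z "- 1"] linear_neg[OF l(1), of z] by simp
  qed
  then obtain a where a: "\<And>x. l x = (\<Sum>i<n. a i * x (y i))"
    using linear_vanishing_on_kernels[OF l(1), of "\<lambda>i x. blinfun_apply x (y i)" n]
    by (auto simp: linear_iff blinfun.add_left blinfun.scaleR_left)
  \<comment> \<open>The point at which \<open>l\<close> evaluates. It is dominated by
    \<open>\<psi>\<close>, so the hypothesis bounds \<open>p x0 = x0 v\<close> by
    \<open>c\<close>.\<close>
  define v where "v = (\<Sum>i<n. a i *\<^sub>R y i)"
  have lv: "l x = x v" for x
    by (simp add: a v_def blinfun.sum_right blinfun.scaleR_right)
  have "blinfun_apply x v \<le> \<psi> x" for x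
    using l(2)[of x] low[OF E(1), of x] by (simp add: lv)
  then have "blinfun_apply x0 v \<le> c" by (rule le)
  then have "p x0 \<le> c" using l(3) by (simp add: lv)
  then have "p x0 < d" using d by simp
  then obtain z where z: "z \<in> E" "\<psi> (x0 + z) < d"
    unfolding p_def using cINF_less_iff[OF _ bdd, of x0 d] E(1) by blast
  show thesis
    by (rule that[of "x0 + z"]) (use z in \<open>auto simp: E_def blinfun.add_left\<close>)
qed

section \<open>Positive multifunctions with integrals over intervals\<close>

lemma le_of_limit_inferior_bounds:
  fixes a :: real and f :: "nat \<Rightarrow> ennreal"
  assumes "\<And>b. 0 \<le> b \<Longrightarrow> b < a \<Longrightarrow> \<forall>\<^sub>F j in sequentially. ennreal b < f j"
  shows "ennreal a \<le> liminf f"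
  unfolding le_Liminf_iff
proof (intro allI impI)
  fix y assume y: "y < ennreal a"
  then obtain b where b: "0 \<le> b" "y = ennreal b"
    by (cases y) auto
  then have "b < a" using y by (auto simp: ennreal_less_iff)
  then show "\<forall>\<^sub>F j in sequentially. y < f j" using assms b by simp
qed

text \<open>Abstracts \<open>translate_by \<Gamma> f\<close>. Zero lies in the values because
  \<open>f\<close> is a selection, and the condition on intervals is what remains of the integrals
  of \<open>\<Gamma>\<close> and \<open>f\<close> after subtraction.\<close>

locale positive_multifunction =
  fixes G :: "real \<Rightarrow> 'a::banach set"
  assumes zero_mem: "\<And>t. t \<in> {0..1} \<Longrightarrow> 0 \<in> G t"
    and support_integrable: "\<And>x. lebesgue_integrable (\<lambda>t. support_fun x (G t))"
    and interval_integrals: "\<And>a b. 0 \<le> a \<Longrightarrow> a \<le> b \<Longrightarrow> b \<le> 1 \<Longrightarrow>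
      \<exists>N. bounded N \<and> (\<forall>x. support_fun x N =
        ereal (LINT t|lebesgue_on {a..b}. real_of_ereal (support_fun x (G t))))"
begin

section \<open>Real-valued support functions and their integrals over measurable sets\<close>

definition S :: "('a \<Rightarrow>\<^sub>L real) \<Rightarrow> real \<Rightarrow> real" where
  "S x t = real_of_ereal (support_fun x (G t))"

definition \<phi> :: "real set \<Rightarrow> ('a \<Rightarrow>\<^sub>L real) \<Rightarrow> real" where
  "\<phi> A x = (LINT t:A|lebesgue. S x t)"

definition domains :: "real set set" where
  "domains = {A \<in> sets lebesgue. A \<subseteq> {0..1}}"

lemma domainsD: "A \<in> domains \<Longrightarrow> A \<in> sets lebesgue" "A \<in> domains \<Longrightarrow> A \<subseteq> {0..1}"
  by (auto simp: domains_def)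

lemma \<phi>_eq: "A \<in> domains \<Longrightarrow> \<phi> A x = (LINT t|lebesgue_on A. real_of_ereal (support_fun x (G t)))"
  by (simp add: \<phi>_def S_def integral_restrict_space set_lebesgue_integral_def domains_def)

lemma S_integrable: "A \<in> domains \<Longrightarrow> set_integrable lebesgue A (S x)"
  using support_integrable[of x] unfolding lebesgue_integrable_iff S_def[abs_def]
  by (auto simp: domains_def intro: set_integrable_subset)

lemma support_nonneg: "t \<in> {0..1} \<Longrightarrow> 0 \<le> support_fun x (G t)"
  using support_fun_upper[OF zero_mem, of t x] by (simp add: blinfun.zero_right zero_ereal_def)

lemma S_nonneg: "t \<in> {0..1} \<Longrightarrow> 0 \<le> S x t"
  unfolding S_def using support_nonneg by (rule real_of_ereal_pos)

lemma AE_support_finite: "AE t in lebesgue. t \<in> {0..1} \<longrightarrow> support_fun x (G t) = ereal (S x t)"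
proof -
  have "AE t in lebesgue_on {0..1}. \<bar>support_fun x (G t)\<bar> \<noteq> \<infinity>"
    using support_integrable[of x] by (simp add: lebesgue_integrable_def)
  then have "AE t in lebesgue. t \<in> {0..1} \<longrightarrow> \<bar>support_fun x (G t)\<bar> \<noteq> \<infinity>"
    by (subst (asm) AE_restrict_space_iff) auto
  then show ?thesis by eventually_elim (auto simp: S_def ereal_real')
qed

text \<open>Only almost everywhere: \<open>real_of_ereal\<close> sends infinity to 0, which can
  destroy subadditivity where a support function is infinite. The null set depends on
  \<open>x\<close> and \<open>y\<close>.\<close>

lemma AE_S_add: "AE t in lebesgue. t \<in> {0..1} \<longrightarrow> S (x + y) t \<le> S x t + S y t"
  using AE_support_finite[of x] AE_support_finite[of y] AE_support_finite[of "x + y"]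
proof eventually_elim
  case (elim t)
  show ?case
  proof
    assume "t \<in> {0..1}"
    then show "S (x + y) t \<le> S x t + S y t"
      using support_fun_add_le[of x y "G t"] elim by simp
  qed
qed

lemma AE_S_scale:
  assumes "0 < c"
  shows "AE t in lebesgue. t \<in> {0..1} \<longrightarrow> S (c *\<^sub>R x) t \<le> c * S x t"
  using AE_support_finite[of x] AE_support_finite[of "c *\<^sub>R x"]
proof eventually_elim
  case (elim t)
  show ?case
  proof
    assume "t \<in> {0..1}"
    then show "S (c *\<^sub>R x) t \<le> c * S x t"
      using support_fun_scaleR_le[OF assms, of x "G t"] elim by simp
  qed
qed

lemma \<phi>_nonneg: "A \<in> domains \<Longrightarrow> 0 \<le> \<phi> A x"
  unfolding \<phi>_def set_lebesgue_integral_def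
  using S_nonneg by (intro integral_nonneg_AE AE_I2) (auto simp: domains_def indicator_def)

lemma \<phi>_mono:
  assumes "A \<in> domains" "B \<in> domains" "A \<subseteq> B"
  shows "\<phi> A x \<le> \<phi> B x"
  unfolding \<phi>_def set_lebesgue_integral_def
  using S_integrable[OF assms(1), of x] S_integrable[OF assms(2), of x] S_nonneg assms
  by (intro integral_mono) (auto simp: set_integrable_def domains_def indicator_def)

lemma \<phi>_Un:
  assumes "A \<in> domains" "B \<in> domains" "negligible (A \<inter> B)"
  shows "\<phi> (A \<union> B) x = \<phi> A x + \<phi> B x"
  unfolding \<phi>_def
proof (rule set_integral_Un_AE)
  show "AE t in lebesgue. \<not> (t \<in> A \<and> t \<in> B)"
    using assms(3) by (intro AE_I'[of "A \<inter> B"]) (auto simp: negligible_iff_null_sets)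
qed (use assms S_integrable in \<open>auto simp: domains_def\<close>)

lemma sublinear_\<phi>:
  assumes A: "A \<in> domains"
  shows "sublinear (\<phi> A)"
proof (rule sublinearI)
  fix x y
  have "\<phi> A (x + y) \<le> (LINT t:A|lebesgue. S x t + S y t)"
    unfolding \<phi>_def
    by (intro set_integral_mono_AE S_integrable[OF A] set_integral_add S_integrable)
       (use AE_S_add[of x y] domainsD(2)[OF A] A in \<open>auto elim!: eventually_mono\<close>)
  also have "\<dots> = \<phi> A x + \<phi> A y"
    unfolding \<phi>_def by (intro set_integral_add S_integrable[OF A])
  finally show "\<phi> A (x + y) \<le> \<phi> A x + \<phi> A y" .
next
  have "S 0 t = 0" if "t \<in> {0..1}" for t
  proof -
    have "G t \<noteq> {}" using zero_mem[OF that] by blast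
    then show ?thesis by (simp add: S_def support_fun_def)
  qed
  then show "\<phi> A 0 = 0"
    unfolding \<phi>_def set_lebesgue_integral_def using domainsD(2)[OF A]
    by (intro integral_eq_zero_AE AE_I2) (auto simp: indicator_def)
next
  fix c :: real and x assume c: "0 < c"
  have "\<phi> A (c *\<^sub>R x) \<le> (LINT t:A|lebesgue. c * S x t)"
    unfolding \<phi>_def
    by (intro set_integral_mono_AE S_integrable[OF A] set_integrable_mult_right)
       (use AE_S_scale[OF c, of x] domainsD(2)[OF A] in \<open>auto elim!: eventually_mono\<close>)
  then show "\<phi> A (c *\<^sub>R x) \<le> c * \<phi> A x" by (simp add: \<phi>_def)
qed

section \<open>Representation of the integrals over intervals and open sets\<close>

definition M :: "real set \<Rightarrow> 'a set" where
  "M A = {y. \<forall>x. blinfun_apply x y \<le> \<phi> A x}"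

text \<open>Says that \<open>\<phi> A\<close> is the supremum over \<open>M A\<close>. As
  \<open>M A\<close> is the largest set with support function at most \<open>\<phi> A\<close>, this
  holds as soon as any subset of \<open>X\<close> has support function
  \<open>\<phi> A\<close>.\<close>

definition represented :: "real set \<Rightarrow> bool" where
  "represented A \<longleftrightarrow> A \<in> domains \<and> (\<forall>x c. c < \<phi> A x \<longrightarrow> (\<exists>y\<in>M A. c < blinfun_apply x y))"

lemma Icc_domain: "0 \<le> a \<Longrightarrow> b \<le> 1 \<Longrightarrow> {a..b} \<in> domains"
  by (auto simp: domains_def)

lemma M_mono: "A \<in> domains \<Longrightarrow> B \<in> domains \<Longrightarrow> A \<subseteq> B \<Longrightarrow> M A \<subseteq> M B"
  unfolding M_def using \<phi>_mono by (blast intro: order_trans)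

lemma represented_Icc:
  assumes "0 \<le> a" "a \<le> b" "b \<le> 1"
  shows "represented {a..b}"
proof -
  have dom: "{a..b} \<in> domains" using assms by (intro Icc_domain) auto
  obtain N where N: "\<And>x. support_fun x N = ereal (\<phi> {a..b} x)"
    using interval_integrals[OF assms] \<phi>_eq[OF dom] by metis
  have "N \<subseteq> M {a..b}"
    unfolding M_def using support_fun_upper[of _ N] by (auto simp: N simp flip: ereal_less_eq(3))
  moreover have "\<exists>y\<in>N. c < blinfun_apply x y" if "c < \<phi> {a..b} x" for x c
  proof -
    have "ereal c < support_fun x N" using that by (simp add: N)
    then show ?thesis unfolding support_fun_def less_SUP_iff by simp
  qed
  ultimately show ?thesis unfolding represented_def using dom by blast
qed

lemma represented_empty: "represented {}"
proof -
  have "\<phi> {} x = 0" for x by (simp add: \<phi>_def set_lebesgue_integral_def)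
  then show ?thesis
    by (auto simp: represented_def M_def domains_def blinfun.zero_right intro!: exI[of _ 0])
qed

lemma represented_Un:
  assumes A: "represented A" and B: "represented B" and null: "negligible (A \<inter> B)"
  shows "represented (A \<union> B)"
  unfolding represented_def
proof (intro conjI allI impI)
  have dom: "A \<in> domains" "B \<in> domains" using A B by (auto simp: represented_def)
  then show "A \<union> B \<in> domains" by (auto simp: domains_def)
  fix x c assume "c < \<phi> (A \<union> B) x"
  then have c: "c < \<phi> A x + \<phi> B x" by (simp add: \<phi>_Un[OF dom null])
  define e where "e = (\<phi> A x + \<phi> B x - c) / 2"
  have "0 < e" using c by (simp add: e_def)
  then have "\<phi> A x - e < \<phi> A x" "\<phi> B x - e < \<phi> B x" by auto
  then obtain y z where y: "y \<in> M A" "\<phi> A x - e < x y" and z: "z \<in> M B" "\<phi> B x - e < x z"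
    using A B unfolding represented_def by blast
  have "y + z \<in> M (A \<union> B)"
    using y(1) z(1) by (simp add: M_def \<phi>_Un[OF dom null] blinfun.add_right add_mono)
  moreover have "c < x (y + z)"
    using y(2) z(2) by (simp add: blinfun.add_right e_def field_simps)
  ultimately show "\<exists>y\<in>M (A \<union> B). c < blinfun_apply x y" by blast
qed

text \<open>\<open>M\<close> grows with its argument, so a point found for a late \<open>A n\<close>
  serves the union. Along decreasing sequences such points may be lost, hence the separate treatment
  of general measurable sets.\<close>

lemma represented_incseq:
  assumes A: "\<And>n. represented (A n)" and inc: "incseq A"
  shows "represented (\<Union>n. A n)"
  unfolding represented_def
proof (intro conjI allI impI)
  have dom: "A n \<in> domains" for n using A by (auto simp: represented_def)
  then show U: "(\<Union>n. A n) \<in> domains" by (auto simp: domains_def)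
  fix x c assume c: "c < \<phi> (\<Union>n. A n) x"
  have "(\<lambda>n. \<phi> (A n) x) \<longlonglongrightarrow> \<phi> (\<Union>n. A n) x"
    unfolding \<phi>_def by (intro set_integral_cont_up inc S_integrable U domainsD(1)[OF dom])
  then have "\<forall>\<^sub>F n in sequentially. c < \<phi> (A n) x" using c by (rule order_tendstoD(1))
  then obtain n where "c < \<phi> (A n) x" by (auto simp: eventually_sequentially)
  then obtain y where "y \<in> M (A n)" "c < x y" using A unfolding represented_def by blast
  moreover have "M (A n) \<subseteq> M (\<Union>n. A n)" by (intro M_mono dom U) blast
  ultimately show "\<exists>y\<in>M (\<Union>n. A n). c < blinfun_apply x y" by blast
qed

lemma represented_division:
  assumes p: "p division_of U" and U: "U \<subseteq> {0..1}"
  shows "represented U"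
proof -
  have rep: "represented K" if Kp: "K \<in> p" for K
  proof -
    obtain a b where K: "K = {a..b}" using division_ofD(4)[OF p Kp] by (auto simp: cbox_interval)
    have "K \<noteq> {}" "K \<subseteq> {0..1}" using division_ofD(2,3)[OF p Kp] U by auto
    then show ?thesis unfolding K by (intro represented_Icc) auto
  qed
  have null: "negligible (K \<inter> K')" if KK': "K \<in> p" "K' \<in> p" "K \<noteq> K'" for K K'
  proof -
    obtain a b where K: "K = cbox a b" using division_ofD(4)[OF p KK'(1)] by blast
    obtain a' b' where K': "K' = cbox a' b'" using division_ofD(4)[OF p KK'(2)] by blast
    have "interior (K \<inter> K') = {}" using division_ofD(5)[OF p KK'] by simp
    moreover have "convex (K \<inter> K')" unfolding K K' by (intro convex_Int convex_box)
    ultimately show ?thesis using negligible_convex_interior by blast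
  qed
  have "represented (\<Union>F)" if "finite F" "F \<subseteq> p" for F
    using that
  proof (induction F)
    case empty
    then show ?case by (simp add: represented_empty)
  next
    case (insert K F)
    have "negligible (K \<inter> \<Union>F)"
      unfolding Int_Union using insert null by (intro negligible_Union) auto
    then have "represented (K \<union> \<Union>F)" using insert rep by (intro represented_Un) auto
    then show ?case by simp
  qed
  then show ?thesis using division_ofD(1,6)[OF p] by blast
qed

lemma represented_open:
  assumes V: "open V"
  shows "represented (V \<inter> {0..1})"
proof -
  obtain \<D> where \<D>: "countable \<D>" "\<And>X. X \<in> \<D> \<Longrightarrow> \<exists>a b. X = cbox a b" "\<Union>\<D> = V"
    using open_countable_Union_open_cbox[OF V] by metis
  show ?thesis
  proof (cases "\<D> = {}")
    case True
    then show ?thesis using \<D>(3) represented_empty by auto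
  next
    case False
    then obtain f :: "nat \<Rightarrow> real set" where f: "range f = \<D>" using uncountable_def \<D>(1) by metis
    define A where "A n = (\<Union>i<n. f i \<inter> {0..1})" for n
    have "represented (A n)" for n
    proof -
      have "\<exists>a b. s = cbox a b" if s: "s \<in> (\<lambda>i. f i \<inter> {0..1}) ` {..<n}" for s
      proof -
        obtain i where i: "s = f i \<inter> {0..1}" using s by blast
        obtain a b where "f i = cbox a b" using \<D>(2)[of "f i"] f by blast
        then have "s = cbox (max a 0) (min b 1)" using i by auto
        then show ?thesis by blast
      qed
      then obtain p where "p division_of \<Union>((\<lambda>i. f i \<inter> {0..1}) ` {..<n})"
        using elementary_unions_intervals[of "(\<lambda>i. f i \<inter> {0..1}) ` {..<n}"] by blast
      then show ?thesis unfolding A_def by (rule represented_division) blast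
    qed
    moreover have "incseq A" unfolding A_def by (intro monoI UN_mono) auto
    ultimately have "represented (\<Union>n. A n)" by (rule represented_incseq)
    moreover have "(\<Union>n. A n) = V \<inter> {0..1}"
      unfolding A_def using \<D>(3) f by (auto intro: lessI)
    ultimately show ?thesis by simp
  qed
qed

section \<open>Outer approximation and weak-star compactness\<close>

lemma outer_approximation:
  assumes A: "A \<in> domains"
  obtains V where "\<And>m. represented (V m)" "\<And>m. A \<subseteq> V m" "\<And>x. (\<lambda>m. \<phi> (V m) x) \<longlonglongrightarrow> \<phi> A x"
proof -
  have "\<exists>O'. open O' \<and> A \<subseteq> O' \<and> O' - A \<in> lmeasurable \<and> emeasure lebesgue (O' - A) < ennreal ((1/2) ^ m)" for m
    using sets_lebesgue_outer_open[OF domainsD(1)[OF A], of "(1/2) ^ m"] by (metis zero_less_power zero_less_divide_1_iff zero_less_numeral)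
  then obtain O' where O': "\<And>m. open (O' m)" "\<And>m. A \<subseteq> O' m" "\<And>m. O' m - A \<in> lmeasurable"
    "\<And>m. emeasure lebesgue (O' m - A) < ennreal ((1/2) ^ m)" by metis
  define V where "V m = (\<Inter>i\<le>m. O' i) \<inter> {0..1}" for m
  have rep: "represented (V m)" for m
    unfolding V_def using O'(1) by (intro represented_open open_INT) auto
  have sub: "A \<subseteq> V m" for m unfolding V_def using O'(2) domainsD(2)[OF A] by blast
  have dom: "V m \<in> domains" for m using rep by (simp add: represented_def)
  have "decseq V" unfolding V_def by (intro antimonoI) auto
  have "negligible ((\<Inter>m. V m) - A)"
    unfolding negligible_outer_le
  proof (intro allI impI)
    fix e :: real assume "0 < e"
    then obtain m where m: "(1/2) ^ m < e" using real_arch_pow_inv[of e "1/2"] by auto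
    have "measure lebesgue (O' m - A) \<le> (1/2) ^ m"
      using O'(4)[of m] O'(3)[of m] by (simp add: emeasure_eq_measure2 ennreal_less_iff)
    then show "\<exists>T. (\<Inter>m. V m) - A \<subseteq> T \<and> T \<in> lmeasurable \<and> measure lebesgue T \<le> e"
      using O'(3)[of m] m by (intro exI[of _ "O' m - A"]) (auto simp: V_def)
  qed
  then have null: "(\<Inter>m. V m) - A \<in> null_sets lebesgue" by (simp add: negligible_iff_null_sets)
  have domI: "(\<Inter>m. V m) \<in> domains" using dom by (auto simp: domains_def)
  have "\<phi> (\<Inter>m. V m) x = \<phi> A x" for x
    unfolding \<phi>_def
  proof (rule set_integral_cong_set)
    show "AE t in lebesgue. t \<in> A \<longleftrightarrow> t \<in> (\<Inter>m. V m)"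
      using AE_not_in[OF null] by eventually_elim (use sub in blast)
  qed (use S_integrable[OF A] S_integrable[OF domI] in \<open>auto simp: set_integrable_def set_borel_measurable_def\<close>)
  moreover have "(\<lambda>m. \<phi> (V m) x) \<longlonglongrightarrow> \<phi> (\<Inter>m. V m) x" for x
    unfolding \<phi>_def
    by (intro set_integral_cont_down S_integrable dom \<open>decseq V\<close> domainsD(1)[OF dom])
  ultimately have "(\<lambda>m. \<phi> (V m) x) \<longlonglongrightarrow> \<phi> A x" for x by simp
  with rep sub show thesis by (rule that)
qed

text \<open>The compactness property of \<open>\<phi> A\<close>: a weak-star cluster point of near minimisers stays in the
  sublevel set by Fatou's lemma.\<close>

lemma \<phi>_compactness:
  assumes A: "A \<in> domains"
    and T: "\<And>n. convex (T n)" "decseq T" "\<And>n. T n \<noteq> {}"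
    and bound: "\<And>x. x \<in> T 0 \<Longrightarrow> norm x \<le> R" "\<And>x. x \<in> T 0 \<Longrightarrow> \<phi> A x \<le> c"
  obtains u where "\<phi> A u \<le> c"
    "\<And>n y r. (\<And>x. x \<in> T n \<Longrightarrow> blinfun_apply x y = r) \<Longrightarrow> blinfun_apply u y = r"
proof -
  let ?M = "lebesgue_on A"
  have As: "A \<in> sets lebesgue" "A \<subseteq> {0..1}" using A by (auto simp: domains_def)
  have fin: "finite_measure ?M"
  proof (rule finite_measureI)
    have "A \<in> lmeasurable" using As by (meson bounded_closed_interval bounded_set_imp_lmeasurable bounded_subset)
    then show "emeasure ?M (space ?M) \<noteq> \<infinity>"
      using As by (simp add: emeasure_restrict_space fmeasurable_def)
  qed
  have AE_A: "AE t in ?M. P t" if "AE t in lebesgue. t \<in> {0..1} \<longrightarrow> P t" for P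
  proof -
    have "AE t in lebesgue. t \<in> A \<longrightarrow> P t" using that by eventually_elim (use As(2) in blast)
    then show ?thesis using As(1) by (subst AE_restrict_space_iff) auto
  qed
  have int: "integrable ?M (S x)" for x
    using S_integrable[OF A, of x] As by (simp add: integrable_lebesgue_on_iff)
  have \<phi>M: "\<phi> A x = integral\<^sup>L ?M (S x)" for x
    using As(1) by (simp add: \<phi>_def integral_restrict_space set_lebesgue_integral_def)
  have nn: "AE t in ?M. 0 \<le> S x t" for x using S_nonneg by (intro AE_A AE_I2) blast
  have mid: "AE t in ?M. S ((1/2) *\<^sub>R x + (1/2) *\<^sub>R y) t \<le> (S x t + S y t) / 2" for x y
  proof -
    have half: "0 < (1/2 :: real)" by simp
    show ?thesis
      using AE_A[OF AE_S_add[of "(1/2) *\<^sub>R x" "(1/2) *\<^sub>R y"]] AE_A[OF AE_S_scale[OF half, of x]]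
        AE_A[OF AE_S_scale[OF half, of y]]
      by eventually_elim (simp add: field_simps)
  qed
  obtain X where X: "\<And>j. X j \<in> T j"
    and conv: "AE t in ?M. convergent (\<lambda>j. exp (- (S (X j) t / 2)))"
    using convex_sets_AE_convergent[OF fin T int nn _ mid, of c] bound(2) by (metis \<phi>M)
  have XT: "X j \<in> T n" if "n \<le> j" for j n using X[of j] decseqD[OF T(2) that] by blast
  obtain u where u: "\<And>y r. \<forall>\<^sub>F j in sequentially. X j y \<le> r \<Longrightarrow> blinfun_apply u y \<le> r"
    using bounded_sequence_cluster_functional[of X R] bound(1) XT[of 0] by (metis zero_le)
  have ev_const: "blinfun_apply u y = r" if "\<And>x. x \<in> T n \<Longrightarrow> blinfun_apply x y = r" for n y r
  proof (rule antisym)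
    have ev: "\<forall>\<^sub>F j in sequentially. X j y = r"
      using that XT by (intro eventually_sequentiallyI[of n]) auto
    then show "u y \<le> r" by (intro u) (auto elim: eventually_mono)
    have "u (- y) \<le> - r" using ev by (intro u) (auto elim: eventually_mono simp: blinfun.minus_right)
    then show "r \<le> u y" by (simp add: blinfun.minus_right)
  qed
  have "AE t in ?M. ennreal (S u t) \<le> liminf (\<lambda>j. ennreal (S (X j) t))"
  proof -
    have "AE t in ?M. \<forall>j. support_fun (X j) (G t) = ereal (S (X j) t)"
      unfolding AE_all_countable using AE_support_finite by (intro allI AE_A)
    then show ?thesis
      using conv AE_A[OF AE_support_finite[of u]]
    proof eventually_elim
      case (elim t)
      define v where "v j = exp (- (S (X j) t / 2))" for j
      obtain w where w: "v \<longlonglongrightarrow> w" using elim(2) unfolding v_def convergent_def by blast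
      show ?case
      proof (rule le_of_limit_inferior_bounds)
        fix b assume b: "0 \<le> b" "b < S u t"
        define b' where "b' = (b + S u t) / 2"
        have b': "b < b'" "b' < S u t" using b by (auto simp: b'_def)
        then have "ereal b' < support_fun u (G t)" using elim(3) by simp
        then obtain y where y: "y \<in> G t" "b' < u y" unfolding support_fun_def less_SUP_iff by auto
        \<comment> \<open>The cluster property of \<open>u\<close> yields \<open>X j y > b'\<close>
          only for infinitely many \<open>j\<close>; convergence of \<open>v\<close> turns this into
          a bound for almost all \<open>j\<close>. The exponential form lets
          \<open>S (X j) t\<close> tend to infinity, that is \<open>w = 0\<close>.\<close>
        have freq: "\<exists>\<^sub>F j in sequentially. v j \<le> exp (- (b' / 2))"
        proof -
          have "\<not> (\<forall>\<^sub>F j in sequentially. X j y \<le> b')" using u[of y b'] y(2) by auto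
          then have "\<exists>\<^sub>F j in sequentially. \<not> X j y \<le> b'" by (simp add: not_eventually)
          then show ?thesis
          proof (rule frequently_elim1)
            fix j assume "\<not> X j y \<le> b'"
            moreover have "X j y \<le> S (X j) t"
              using support_fun_upper[OF y(1), of "X j"] elim(1) by simp
            ultimately show "v j \<le> exp (- (b' / 2))" by (simp add: v_def)
          qed
        qed
        have "w \<le> exp (- (b' / 2))"
        proof (rule ccontr)
          assume "\<not> ?thesis"
          then have "\<forall>\<^sub>F j in sequentially. exp (- (b' / 2)) < v j"
            using w by (intro order_tendstoD(1)) auto
          then have "\<forall>\<^sub>F j in sequentially. \<not> v j \<le> exp (- (b' / 2))" by (auto elim: eventually_mono)
          then show False using freq by (simp add: frequently_def)
        qed
        also have "\<dots> < exp (- (b / 2))" using b'(1) by simp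
        finally have "w < exp (- (b / 2))" .
        then have "\<forall>\<^sub>F j in sequentially. v j < exp (- (b / 2))" using w by (intro order_tendstoD(2))
        then show "\<forall>\<^sub>F j in sequentially. ennreal b < ennreal (S (X j) t)"
        proof (rule eventually_mono)
          fix j assume "v j < exp (- (b / 2))"
          then have "b < S (X j) t" by (simp add: v_def)
          then show "ennreal b < ennreal (S (X j) t)" using b(1) by (simp add: ennreal_less_iff)
        qed
      qed
    qed
  qed
  then have "(\<integral>\<^sup>+t. ennreal (S u t) \<partial>?M) \<le> (\<integral>\<^sup>+t. liminf (\<lambda>j. ennreal (S (X j) t)) \<partial>?M)"
    by (rule nn_integral_mono_AE)
  also have "\<dots> \<le> liminf (\<lambda>j. \<integral>\<^sup>+t. ennreal (S (X j) t) \<partial>?M)"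
    using int by (intro nn_integral_liminf) auto
  also have "\<dots> = liminf (\<lambda>j. ennreal (\<phi> A (X j)))"
    unfolding \<phi>M using int nn by (simp add: nn_integral_eq_integral)
  also have "\<dots> \<le> liminf (\<lambda>j. ennreal c)"
    using bound(2) XT[of 0] by (intro Liminf_mono always_eventually allI ennreal_leI) auto
  also have "\<dots> = ennreal c" by (simp add: Liminf_const)
  finally have "ennreal (\<phi> A u) \<le> ennreal c"
    using int[of u] nn[of u] by (simp add: nn_integral_eq_integral \<phi>M)
  moreover have "0 \<le> c" using \<phi>_nonneg[OF A, of "X 0"] bound(2)[OF X[of 0]] by simp
  ultimately have "\<phi> A u \<le> c" by simp
  then show thesis using ev_const that by blast
qed

section \<open>Enlarged sets and removal of the norm term\<close>

definition M_enlarged :: "real \<Rightarrow> real set \<Rightarrow> 'a set" where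
  "M_enlarged e A = {y. \<forall>x. blinfun_apply x y \<le> \<phi> A x + e * norm x}"

text \<open>If \<open>M_enlarged e A\<close> were too small, the duality lemma and compactness would produce a functional
  agreeing with \<open>x0\<close> on representing points \<open>y m\<close> of the open sets \<open>V m\<close>, but with too small a value
  of \<open>\<phi> A\<close>.\<close>

lemma M_enlarged_dense:
  assumes A: "A \<in> domains" and e: "0 < e" and c: "c < \<phi> A x0"
  shows "\<exists>y\<in>M_enlarged e A. c < blinfun_apply x0 y"
proof (rule ccontr)
  assume "\<not> ?thesis"
  then have small: "blinfun_apply x0 v \<le> c" if "v \<in> M_enlarged e A" for v
    using that by (auto simp: not_less)
  define \<psi> where "\<psi> x = \<phi> A x + e * norm x" for x
  have sub: "sublinear \<psi>"
  proof (rule sublinearI)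
    show "\<psi> (x + y) \<le> \<psi> x + \<psi> y" for x y
      using sublinear_add[OF sublinear_\<phi>[OF A], of x y] mult_left_mono[OF norm_triangle_ineq[of x y], of e] e
      by (simp add: \<psi>_def distrib_left)
    show "\<psi> 0 = 0" by (simp add: \<psi>_def sublinear_zero[OF sublinear_\<phi>[OF A]])
    show "\<psi> (k *\<^sub>R x) \<le> k * \<psi> x" if "0 < k" for k x
      using that by (simp add: \<psi>_def sublinear_scale[OF sublinear_\<phi>[OF A]] distrib_left)
  qed
  have \<psi>_nonneg: "0 \<le> \<psi> x" for x using \<phi>_nonneg[OF A] e by (simp add: \<psi>_def)
  have \<phi>_le: "\<phi> A x \<le> \<psi> x" and norm_le: "e * norm x \<le> \<psi> x" for x
    using \<phi>_nonneg[OF A, of x] e by (auto simp: \<psi>_def)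
  \<comment> \<open>Two levels: \<open>d\<close> bounds \<open>\<psi>\<close> on the sets
    \<open>T n\<close>, while \<open>c'\<close> is exceeded by \<open>x0\<close> at every
    \<open>y m\<close>. The contradiction will be
    \<open>c' \<le> \<phi> A u \<le> d\<close>.\<close>
  obtain d c' where d: "c < d" "d < c'" "c' < \<phi> A x0" using c by (meson dense)
  obtain V where V: "\<And>m. represented (V m)" "\<And>m. A \<subseteq> V m" "\<And>x. (\<lambda>m. \<phi> (V m) x) \<longlonglongrightarrow> \<phi> A x"
    using outer_approximation[OF A] by blast
  have "\<exists>y\<in>M (V m). c' < blinfun_apply x0 y" for m
  proof -
    have "V m \<in> domains" using V(1) by (simp add: represented_def)
    then have "c' < \<phi> (V m) x0" using d(3) \<phi>_mono[OF A _ V(2)] by (meson less_le_trans)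
    then show ?thesis using V(1) unfolding represented_def by blast
  qed
  then obtain y where y: "\<And>m. y m \<in> M (V m)" "\<And>m. c' < blinfun_apply x0 (y m)" by metis
  define T where "T n = {x. \<psi> x \<le> d \<and> (\<forall>i<n. blinfun_apply x (y i) = blinfun_apply x0 (y i))}" for n
  have conv: "convex (T n)" for n
    unfolding convex_def T_def
  proof (intro ballI allI impI CollectI conjI)
    fix x z and u v :: real
    assume x: "x \<in> {x. \<psi> x \<le> d \<and> (\<forall>i<n. blinfun_apply x (y i) = blinfun_apply x0 (y i))}"
      and z: "z \<in> {x. \<psi> x \<le> d \<and> (\<forall>i<n. blinfun_apply x (y i) = blinfun_apply x0 (y i))}"
      and uv: "0 \<le> u" "0 \<le> v" "u + v = 1"
    have "\<psi> (u *\<^sub>R x + v *\<^sub>R z) \<le> u * \<psi> x + v * \<psi> z"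
      using sublinear_add[OF sub, of "u *\<^sub>R x" "v *\<^sub>R z"] uv by (simp add: sublinear_scale[OF sub])
    also have "\<dots> \<le> d" using x z uv by (intro convex_bound_le) auto
    finally show "\<psi> (u *\<^sub>R x + v *\<^sub>R z) \<le> d" .
    fix i assume "i < n"
    then have "blinfun_apply (u *\<^sub>R x + v *\<^sub>R z) (y i) = (u + v) * blinfun_apply x0 (y i)"
      using x z by (simp add: blinfun.add_left blinfun.scaleR_left distrib_right)
    then show "blinfun_apply (u *\<^sub>R x + v *\<^sub>R z) (y i) = blinfun_apply x0 (y i)" using uv(3) by simp
  qed
  have dec: "decseq T" unfolding T_def by (intro antimonoI) auto
  have ne: "T n \<noteq> {}" for n
  proof -
    have "blinfun_apply x0 v \<le> c" if "\<And>x. blinfun_apply x v \<le> \<psi> x" for v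
      using that by (intro small) (simp add: M_enlarged_def \<psi>_def)
    from finite_constraints_attained[OF sub \<psi>_nonneg this d(1), where y = y and n = n]
    obtain x where "\<And>i. i < n \<Longrightarrow> blinfun_apply x (y i) = blinfun_apply x0 (y i)" "\<psi> x < d" by blast
    then have "x \<in> T n" by (simp add: T_def)
    then show ?thesis by blast
  qed
  have b1: "norm x \<le> d / e" and b2: "\<phi> A x \<le> d" if "x \<in> T 0" for x
    using that norm_le[of x] \<phi>_le[of x] e by (auto simp: T_def field_simps)
  obtain u where u: "\<phi> A u \<le> d"
    "\<And>n z r. (\<And>x. x \<in> T n \<Longrightarrow> blinfun_apply x z = r) \<Longrightarrow> blinfun_apply u z = r"
    using \<phi>_compactness[OF A conv dec ne b1 b2] by blast
  have "c' \<le> \<phi> (V m) u" for m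
  proof -
    have "blinfun_apply u (y m) = blinfun_apply x0 (y m)"
      \<comment> \<open>\<open>T n\<close> prescribes values at \<open>y i\<close> for
        \<open>i < n\<close> only, so the value at \<open>y m\<close> is fixed from
        \<open>T (Suc m)\<close> on.\<close>
      by (rule u(2)[of "Suc m"]) (simp add: T_def)
    moreover have "blinfun_apply u (y m) \<le> \<phi> (V m) u" using y(1)[of m] by (simp add: M_def)
    ultimately show ?thesis using y(2)[of m] by simp
  qed
  then have "c' \<le> \<phi> A u" by (intro LIMSEQ_le_const[OF V(3)]) auto
  then show False using u(1) d(2) by simp
qed

text \<open>Were \<open>y\<close> at distance at least \<open>2 * e\<close> from the smaller
  enlargement, a separating \<open>l\<close> of norm at most 1 would give
  \<open>\<phi> A l \<le> l y - 2 * e\<close> by density, whereas membership of \<open>y\<close>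
  gives \<open>l y \<le> \<phi> A l + e\<close>. The distance does not depend on \<open>e'\<close>,
  so the enlargement may shrink at any rate.\<close>

lemma M_enlarged_step:
  assumes A: "A \<in> domains" and e: "0 < e" "0 < e'" and y: "y \<in> M_enlarged e A"
  shows "\<exists>z\<in>M_enlarged e' A. norm (y - z) < 2 * e"
proof (rule ccontr)
  assume "\<not> ?thesis"
  then have far: "2 * e \<le> norm (y - z)" if "z \<in> M_enlarged e' A" for z using that by (auto simp: not_less)
  have "convex (M_enlarged e' A)"
    unfolding convex_def M_enlarged_def
    by (auto simp: blinfun.add_right blinfun.scaleR_right intro!: convex_bound_le)
  moreover have "0 \<in> M_enlarged e' A"
    using \<phi>_nonneg[OF A] e(2) by (auto simp: M_enlarged_def blinfun.zero_right)
  ultimately obtain l :: "'a \<Rightarrow>\<^sub>L real" where l: "norm l \<le> 1"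
    "\<And>z. z \<in> M_enlarged e' A \<Longrightarrow> blinfun_apply l z + 2 * e \<le> l y"
    using separation_at_distance[of "M_enlarged e' A" "2 * e" y] far by blast
  have "\<phi> A l \<le> blinfun_apply l y - 2 * e"
  proof (rule ccontr)
    assume "\<not> ?thesis"
    then have "blinfun_apply l y - 2 * e < \<phi> A l" by simp
    from M_enlarged_dense[OF A e(2) this] obtain z where "z \<in> M_enlarged e' A" "l y - 2 * e < l z" by blast
    then show False using l(2)[of z] by simp
  qed
  moreover have "l y \<le> \<phi> A l + e * norm l" using y by (simp add: M_enlarged_def)
  moreover have "e * norm l \<le> e * 1" using l(1) e(1) by (intro mult_left_mono) auto
  ultimately show False using e(1) by simp
qed

text \<open>Halving the enlargement at each step costs less than \<open>2 * r n\<close>, and these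
  costs add up to \<open>4 * e\<close>. The sequence converges by completeness, and its limit meets
  the defining inequalities with vanishing correction.\<close>

lemma M_near_M_enlarged:
  assumes A: "A \<in> domains" and e: "0 < e" and y: "y \<in> M_enlarged e A"
  shows "\<exists>z\<in>M A. norm (y - z) \<le> 4 * e"
proof -
  define r where "r n = e * (1/2) ^ n" for n :: nat
  have r: "0 < r n" for n using e by (simp add: r_def)
  \<comment> \<open>The clause for \<open>n = 0\<close> makes the dependent choice start at the
    given \<open>y\<close>.\<close>
  define P where "P n v \<longleftrightarrow> v \<in> M_enlarged (r n) A \<and> (n = 0 \<longrightarrow> v = y)" for n v
  have "\<exists>f. \<forall>n. P n (f n) \<and> norm (f n - f (Suc n)) < 2 * r n"
  proof (rule dependent_nat_choice)
    show "\<exists>v. P 0 v" using y by (auto simp: P_def r_def)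
    fix v n assume "P n v"
    then have "v \<in> M_enlarged (r n) A" by (simp add: P_def)
    from M_enlarged_step[OF A r[of n] r[of "Suc n"] this]
    show "\<exists>w. P (Suc n) w \<and> norm (v - w) < 2 * r n" by (auto simp: P_def)
  qed
  then obtain f where f: "\<And>n. f n \<in> M_enlarged (r n) A" "f 0 = y" "\<And>n. norm (f n - f (Suc n)) < 2 * r n"
    unfolding P_def by blast
  have sr: "summable r" unfolding r_def by (intro summable_mult summable_geometric) simp
  have "summable (\<lambda>n. norm (f (Suc n) - f n))"
    using f(3) by (intro summable_comparison_test'[OF summable_mult[OF sr, of 2], of 0])
      (auto simp: norm_minus_commute intro: less_imp_le)
  note sn = this
  then have s: "summable (\<lambda>n. f (Suc n) - f n)" by (rule summable_norm_cancel)
  define z where "z = f 0 + (\<Sum>n. f (Suc n) - f n)"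
  have "f \<longlonglongrightarrow> z"
  proof -
    have "(\<lambda>n. f 0 + (\<Sum>j<n. f (Suc j) - f j)) \<longlonglongrightarrow> z"
      unfolding z_def by (intro tendsto_add tendsto_const summable_LIMSEQ s)
    moreover have "f 0 + (\<Sum>j<n. f (Suc j) - f j) = f n" for n
      using sum_lessThan_telescope[of f n] by simp
    ultimately show ?thesis by simp
  qed
  have "norm (y - z) \<le> (\<Sum>n. norm (f (Suc n) - f n))"
    using summable_norm[OF sn] by (simp add: z_def f(2) norm_minus_commute)
  also have "\<dots> \<le> (\<Sum>n. 2 * r n)"
    using f(3) sn sr by (intro suminf_le summable_mult) (auto simp: norm_minus_commute intro: less_imp_le)
  also have "\<dots> = 4 * e"
    using suminf_geometric[of "1/2 :: real"] by (simp add: suminf_mult sr r_def summable_geometric)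
  finally have "norm (y - z) \<le> 4 * e" .
  moreover have "z \<in> M A"
    unfolding M_def
  proof (intro CollectI allI)
    fix x :: "'a \<Rightarrow>\<^sub>L real"
    have "(\<lambda>n. blinfun_apply x (f n)) \<longlonglongrightarrow> blinfun_apply x z"
      using \<open>f \<longlonglongrightarrow> z\<close> by (intro tendsto_intros)
    moreover have "(\<lambda>n. \<phi> A x + r n * norm x) \<longlonglongrightarrow> \<phi> A x + 0 * norm x"
      using summable_LIMSEQ_zero[OF sr] by (intro tendsto_intros)
    ultimately show "blinfun_apply x z \<le> \<phi> A x"
      using f(1) by (intro LIMSEQ_le[of _ _ "\<lambda>n. \<phi> A x + r n * norm x"]) (auto simp: M_enlarged_def)
  qed
  ultimately show ?thesis by blast
qed

lemma represented_domain:
  assumes A: "A \<in> domains"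
  shows "represented A"
  unfolding represented_def
proof (intro conjI allI impI)
  fix x c assume c: "c < \<phi> A x"
  \<comment> \<open>Half of the gap \<open>\<phi> A x - c\<close> pays for the move from
    \<open>M_enlarged e A\<close> to \<open>M A\<close>, which changes the value of \<open>x\<close>
    by at most \<open>4 * e * norm x\<close>. The summand 1 covers \<open>x = 0\<close>.\<close>
  define e where "e = (\<phi> A x - c) / (2 * (4 * norm x + 1))"
  have pos: "0 < 4 * norm x + 1" using norm_ge_zero[of x] by linarith
  then have e: "0 < e" using c by (simp add: e_def)
  have "c + (\<phi> A x - c) / 2 < \<phi> A x" using c by (simp add: field_simps)
  then obtain y where y: "y \<in> M_enlarged e A" "c + (\<phi> A x - c) / 2 < blinfun_apply x y"
    using M_enlarged_dense[OF A e] by blast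
  obtain z where z: "z \<in> M A" "norm (y - z) \<le> 4 * e" using M_near_M_enlarged[OF A e y(1)] by blast
  have "x (y - z) \<le> norm x * norm (y - z)" using norm_blinfun[of x "y - z"] by simp
  also have "\<dots> \<le> norm x * (4 * e)" using z(2) by (intro mult_left_mono) auto
  also have "\<dots> \<le> (4 * norm x + 1) * e" using e by (simp add: algebra_simps)
  also have "\<dots> = (\<phi> A x - c) / 2" using pos by (simp add: e_def field_simps)
  finally have "blinfun_apply x y - blinfun_apply x z \<le> (\<phi> A x - c) / 2" by (simp only: blinfun.diff_right)
  then have "c < x z" using y(2) by argo
  then show "\<exists>y\<in>M A. c < blinfun_apply x y" using z(1) by blast
qed (rule A)

lemma support_fun_M:
  assumes A: "A \<in> domains"
  shows "support_fun x (M A) = ereal (\<phi> A x)"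
proof (rule antisym)
  show "support_fun x (M A) \<le> ereal (\<phi> A x)"
    by (rule support_fun_least) (simp add: M_def)
  show "ereal (\<phi> A x) \<le> support_fun x (M A)"
  proof (rule ereal_le_real)
    fix c assume "ereal c \<ge> support_fun x (M A)"
    show "ereal (\<phi> A x) \<le> ereal c"
    proof (rule ccontr)
      assume "\<not> ?thesis"
      then obtain y where "y \<in> M A" "c < blinfun_apply x y"
        using represented_domain[OF A] unfolding represented_def by (auto simp: not_le)
      then have "ereal c < support_fun x (M A)"
        using support_fun_upper[of y "M A" x] by (metis less_ereal.simps(1) less_le_trans)
      then show False using \<open>ereal c \<ge> support_fun x (M A)\<close> by simp
    qed
  qed
qed

text \<open>Boundedness is inherited from the integral over the whole interval: a norming functional
  \<open>l\<close> of \<open>y\<close> gives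
  \<open>norm y \<le> \<phi> A l \<le> \<phi> {0..1} l\<close>, and the last value is bounded
  through \<open>N\<close>.\<close>

lemma M_bounded_closed_convex:
  assumes A: "A \<in> domains"
  shows "M A \<in> bounded_closed_convex_sets"
proof -
  have M_Int: "M A = (\<Inter>x. {y. blinfun_apply x y \<le> \<phi> A x})" by (auto simp: M_def)
  have "closed (M A)"
    unfolding M_Int by (intro closed_INT ballI closed_Collect_le continuous_intros)
  moreover have "convex (M A)"
    unfolding convex_def M_def
    by (auto simp: blinfun.add_right blinfun.scaleR_right intro!: convex_bound_le)
  moreover have "0 \<in> M A" using \<phi>_nonneg[OF A] by (simp add: M_def blinfun.zero_right)
  moreover have "bounded (M A)"
  proof -
    have dom: "{0..1} \<in> domains" by (rule Icc_domain) auto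
    obtain N where N: "bounded N" "\<And>x. support_fun x N = ereal (\<phi> {0..1} x)"
      using interval_integrals[of 0 1] \<phi>_eq[OF dom] by auto
    obtain R where R: "0 < R" "\<And>y. y \<in> N \<Longrightarrow> norm y \<le> R" using N(1) by (auto simp: bounded_pos)
    have "norm y \<le> R" if y: "y \<in> M A" for y
    proof -
      obtain l :: "'a \<Rightarrow>\<^sub>L real" where l: "norm l \<le> 1" "blinfun_apply l y = norm y"
        using norming_functional by blast
      have "support_fun l N \<le> ereal R"
      proof (rule support_fun_least)
        fix w assume "w \<in> N"
        have "blinfun_apply l w \<le> norm l * norm w" using norm_blinfun[of l w] by simp
        also have "\<dots> \<le> 1 * R" using l(1) R(2)[OF \<open>w \<in> N\<close>] by (intro mult_mono) auto
        finally show "ereal (blinfun_apply l w) \<le> ereal R" by simp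
      qed
      then have "\<phi> {0..1} l \<le> R" by (simp add: N(2))
      moreover have "\<phi> A l \<le> \<phi> {0..1} l" using A dom by (rule \<phi>_mono) (rule domainsD(2)[OF A])
      moreover have "norm y \<le> \<phi> A l" using y l(2) by (simp add: M_def) metis
      ultimately show ?thesis by simp
    qed
    then show ?thesis by (auto simp: bounded_iff)
  qed
  ultimately show ?thesis
    unfolding bounded_closed_convex_sets_def closed_convex_sets_def by blast
qed

theorem Pettis_integrable: "Pettis_integrable_in bounded_closed_convex_sets G"
  unfolding Pettis_integrable_in_def
proof (intro conjI allI ballI impI support_integrable)
  fix A :: "real set" assume "A \<in> sets lebesgue" "A \<subseteq> {0..1}"
  then have A: "A \<in> domains" by (simp add: domains_def)
  show "\<exists>N\<in>bounded_closed_convex_sets. \<forall>x. support_fun x N =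
      ereal (LINT t|lebesgue_on A. real_of_ereal (support_fun x (G t)))"
    using M_bounded_closed_convex[OF A] support_fun_M[OF A] \<phi>_eq[OF A] by auto
qed

end

section \<open>Decomposition by selections\<close>

lemma integrable_selectionsD:
  assumes "f \<in> integrable_selections Q \<Gamma>"
  shows "t \<in> {0..1} \<Longrightarrow> f t \<in> \<Gamma> t"
    and "scalar_integrable Q (\<lambda>t. ereal (blinfun_apply x' (f t)))"
    and "0 \<le> a \<Longrightarrow> a \<le> b \<Longrightarrow> b \<le> 1 \<Longrightarrow>
      \<exists>y. \<forall>x'. blinfun_apply x' y = scalar_integral Q (\<lambda>t. ereal (blinfun_apply x' (f t))) a b"
  using assms
  by (auto simp: integrable_selections_def fun_integrable_def integrable_in_iff support_fun_singleton)

text \<open>Over an interval the integral of the translate is \<open>N - y\<close>, with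
  \<open>N\<close> and \<open>y\<close> the integrals of \<open>\<Gamma>\<close> and
  \<open>f\<close>. This makes the translate a positive multifunction.\<close>

lemma translate_Pettis_integrable:
  assumes \<Gamma>: "integrable_in Q bounded_closed_convex_sets \<Gamma>" and f: "f \<in> integrable_selections Q \<Gamma>"
  shows "Pettis_integrable_in bounded_closed_convex_sets (translate_by \<Gamma> f)"
proof -
  note f = integrable_selectionsD[OF f]
  have \<Gamma>i: "scalar_integrable Q (\<lambda>t. support_fun x (\<Gamma> t))" for x
    using \<Gamma> unfolding integrable_in_iff by blast
  have \<Gamma>N: "\<And>a b. 0 \<le> a \<Longrightarrow> a \<le> b \<Longrightarrow> b \<le> 1 \<Longrightarrow> \<exists>N\<in>bounded_closed_convex_sets.
      \<forall>x. support_fun x N = ereal (scalar_integral Q (\<lambda>t. support_fun x (\<Gamma> t)) a b)"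
    using \<Gamma> unfolding integrable_in_iff by blast
  have G: "support_fun x (translate_by \<Gamma> f t) = support_fun x (\<Gamma> t) - ereal (blinfun_apply x (f t))"
    if "t \<in> {0..1}" for x t
    unfolding translate_by_def using f(1)[OF that] by (intro support_fun_translate) blast
  have le: "ereal (blinfun_apply x (f t)) \<le> support_fun x (\<Gamma> t)" if "t \<in> {0..1}" for x t
    using f(1)[OF that] by (rule support_fun_upper)
  have diff: "lebesgue_integrable (\<lambda>t. support_fun x (translate_by \<Gamma> f t))"
    "0 \<le> a \<Longrightarrow> a \<le> b \<Longrightarrow> b \<le> 1 \<Longrightarrow>
      (LINT t|lebesgue_on {a..b}. real_of_ereal (support_fun x (translate_by \<Gamma> f t)))
        = scalar_integral Q (\<lambda>t. support_fun x (\<Gamma> t)) a b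
          - scalar_integral Q (\<lambda>t. ereal (blinfun_apply x (f t))) a b" for x a b
    using scalar_integral_difference[OF \<Gamma>i[of x] f(2)[of x] le G] by auto
  interpret positive_multifunction "translate_by \<Gamma> f"
  proof
    fix t :: real assume "t \<in> {0..1}"
    then have "f t \<in> \<Gamma> t" by (rule f(1))
    then show "0 \<in> translate_by \<Gamma> f t" unfolding translate_by_def by (intro image_eqI[of _ _ "f t"]) auto
  next
    show "lebesgue_integrable (\<lambda>t. support_fun x (translate_by \<Gamma> f t))" for x by (rule diff(1))
  next
    fix a b :: real assume ab: "0 \<le> a" "a \<le> b" "b \<le> 1"
    obtain N where N: "N \<in> bounded_closed_convex_sets"
      "\<And>x. support_fun x N = ereal (scalar_integral Q (\<lambda>t. support_fun x (\<Gamma> t)) a b)"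
      using \<Gamma>N[OF ab] by blast
    obtain y where y: "\<And>x. blinfun_apply x y = scalar_integral Q (\<lambda>t. ereal (blinfun_apply x (f t))) a b"
      using f(3)[OF ab] by blast
    have "N \<noteq> {}" using N(1) by (simp add: bounded_closed_convex_sets_def closed_convex_sets_def)
    then have "support_fun x ((\<lambda>z. z - y) ` N) =
        ereal (LINT t|lebesgue_on {a..b}. real_of_ereal (support_fun x (translate_by \<Gamma> f t)))" for x
      by (simp add: support_fun_translate N(2) y diff(2)[OF ab])
    moreover have "bounded ((\<lambda>z. z - y) ` N)"
      using translate_bounded_closed_convex[OF N(1), of y] by (simp add: bounded_closed_convex_sets_def)
    ultimately show "\<exists>N. bounded N \<and> (\<forall>x. support_fun x N =
        ereal (LINT t|lebesgue_on {a..b}. real_of_ereal (support_fun x (translate_by \<Gamma> f t))))"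
      by blast
  qed
  show ?thesis by (rule Pettis_integrable)
qed

lemma integrable_of_translate:
  assumes G: "Pettis_integrable_in bounded_closed_convex_sets (translate_by \<Gamma> f)"
    and f: "f \<in> integrable_selections Q \<Gamma>"
  shows "integrable_in Q bounded_closed_convex_sets \<Gamma>"
proof -
  note f = integrable_selectionsD[OF f]
  let ?w = "\<lambda>x t. support_fun x (translate_by \<Gamma> f t)"
  have w: "lebesgue_integrable (?w x)" for x using G by (simp add: Pettis_integrable_in_def)
  have sum: "support_fun x (\<Gamma> t) = ?w x t + ereal (blinfun_apply x (f t))" if "t \<in> {0..1}" for x t
  proof -
    have "\<Gamma> t \<noteq> {}" using f(1)[OF that] by blast
    then show ?thesis
      by (cases "support_fun x (\<Gamma> t)") (auto simp: translate_by_def support_fun_translate)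
  qed
  have int: "scalar_integrable Q (\<lambda>t. support_fun x (\<Gamma> t))"
    "0 \<le> a \<Longrightarrow> a \<le> b \<Longrightarrow> b \<le> 1 \<Longrightarrow>
      scalar_integral Q (\<lambda>t. support_fun x (\<Gamma> t)) a b
        = (LINT t|lebesgue_on {a..b}. real_of_ereal (?w x t))
          + scalar_integral Q (\<lambda>t. ereal (blinfun_apply x (f t))) a b" for x a b
    using scalar_integral_sum[OF w[of x] f(2)[of x] sum] by auto
  show ?thesis
    unfolding integrable_in_iff
  proof (intro conjI allI impI)
    show "scalar_integrable Q (\<lambda>t. support_fun x (\<Gamma> t))" for x by (rule int(1))
    fix a b :: real assume ab: "0 \<le> a \<and> a \<le> b \<and> b \<le> 1"
    then have "{a..b} \<in> sets lebesgue" "{a..b} \<subseteq> {0..1}" by auto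
    then obtain N where N: "N \<in> bounded_closed_convex_sets"
      "\<And>x. support_fun x N = ereal (LINT t|lebesgue_on {a..b}. real_of_ereal (?w x t))"
      using G unfolding Pettis_integrable_in_def by blast
    obtain y where y: "\<And>x. blinfun_apply x y = scalar_integral Q (\<lambda>t. ereal (blinfun_apply x (f t))) a b"
      using f(3)[of a b] ab by blast
    have "N \<noteq> {}" using N(1) by (simp add: bounded_closed_convex_sets_def closed_convex_sets_def)
    \<comment> \<open>The set \<open>N + y\<close>, written as a difference to match the translation
      lemmas.\<close>
    then have "support_fun x ((\<lambda>z. z - (- y)) ` N) =
        ereal (scalar_integral Q (\<lambda>t. support_fun x (\<Gamma> t)) a b)" for x
      using ab unfolding support_fun_translate[OF \<open>N \<noteq> {}\<close>]
      by (simp add: N(2) y int(2) blinfun.minus_right)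
    then show "\<exists>N\<in>bounded_closed_convex_sets. \<forall>x. support_fun x N =
        ereal (scalar_integral Q (\<lambda>t. support_fun x (\<Gamma> t)) a b)"
      using translate_bounded_closed_convex[OF N(1), of "- y"] by blast
  qed
qed

text \<open>The cycle is (iii) to (i) to (ii) to (iii): one good selection recovers the
  integrability of \<open>\<Gamma>\<close>, which then makes every integrable selection
  good.\<close>

theorem theorem3p5:
  fixes \<Gamma> :: "real \<Rightarrow> 'a::banach set" and Q :: integral_type
  assumes "\<forall>t\<in>{0..1}. \<Gamma> t \<in> closed_convex_sets"
  shows
    "(integrable_in Q bounded_closed_convex_sets \<Gamma> \<and> integrable_selections Q \<Gamma> \<noteq> {}
      \<longleftrightarrow>
      integrable_selections Q \<Gamma> \<noteq> {} \<and>
      (\<forall>f\<in>integrable_selections Q \<Gamma>.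
         Pettis_integrable_in bounded_closed_convex_sets (translate_by \<Gamma> f)))
     \<and>
     (integrable_selections Q \<Gamma> \<noteq> {} \<and>
      (\<forall>f\<in>integrable_selections Q \<Gamma>.
         Pettis_integrable_in bounded_closed_convex_sets (translate_by \<Gamma> f))
      \<longleftrightarrow>
      (\<exists>f\<in>integrable_selections Q \<Gamma>.
         Pettis_integrable_in bounded_closed_convex_sets (translate_by \<Gamma> f)))"
  using translate_Pettis_integrable[of Q \<Gamma>] integrable_of_translate[of \<Gamma> _ Q] by blast

end
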